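(* Let $1<p<\infty$, let $a\in GL^\infty(\mathbb T)$, and let $A$ denote any of the operators $$T(a)-H_\alpha(a\chi^{-1}),\quad T(a)+H_\alpha(a\chi),\quad T(a)+H_\alpha(a),\quad T(a)-H_\alpha(a)$$ on $H^p$. Then $\min\{\dim\ker A,\dim\operatorname{coker}A\}=0$.
   Context: $\mathbb T$ is the unit circle; $H^p=\{f\in L^p(\mathbb T):\hat f_n=0\ \forall n<0\}$; $P$ is the Riesz projection onto $H^p$, $Q=I-P$; $T(a)f=P(af)$ on $H^p$. Fix $\beta\in\mathbb C$ with $|\beta|>1$ and let $\alpha(z)=\frac{z-\beta}{\bar\beta z-1}$; $\alpha$ maps $\mathbb T$ onto itself, reverses orientation and satisfies $\alpha(\alpha(t))=t$. Put $\lambda=i\sqrt{|\beta|^2-1}$, $\alpha_-(t)=\frac{\lambda t}{\bar\beta t-1}$, $\chi(t)=t/\alpha_-(t)$, and define $J_\alpha\varphi(t)=t^{-1}\alpha_-(t)\varphi(\alpha(t))=\chi^{-1}(t)\varphi(\alpha(t))$ on $L^p(\mathbb T)$. For $a\in L^\infty$, $a_\alpha:=a\circ\alpha$, and the generalized Hankel operator on $H^p$ is $H_\alpha(a)f=P(a\,QJ_\alpha f)$. $\operatorname{coker}A$ is $H^p/\overline{\operatorname{im}A}$. *)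

theory Defs
  imports "HOL-Analysis.Analysis"
begin

text \<open>Functions on the unit circle are modelled as functions \<open>complex \<Rightarrow> complex\<close>,
  of which only the values on the unit circle matter; the circle is parametrised by
  \<open>cis \<theta>\<close>, \<open>\<theta> \<in> [0, 2\<pi>]\<close>, with normalised Lebesgue measure. Elements of \<open>L^p\<close>
  are identified up to equality almost everywhere (relation \<open>circ_ae_eq\<close>).\<close>

definition circ_meas :: "real measure" where
  "circ_meas = lebesgue_on {0..2*pi}"

definition circ_ae_eq :: "(complex \<Rightarrow> complex) \<Rightarrow> (complex \<Rightarrow> complex) \<Rightarrow> bool" where
  "circ_ae_eq f g \<longleftrightarrow> (AE \<theta> in circ_meas. f (cis \<theta>) = g (cis \<theta>))"

definition Lp :: "real \<Rightarrow> (complex \<Rightarrow> complex) \<Rightarrow> bool" where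
  "Lp p f \<longleftrightarrow> (\<lambda>\<theta>. f (cis \<theta>)) \<in> borel_measurable circ_meas
      \<and> integrable circ_meas (\<lambda>\<theta>. norm (f (cis \<theta>)) powr p)"

definition Lp_norm :: "real \<Rightarrow> (complex \<Rightarrow> complex) \<Rightarrow> real" where
  "Lp_norm p f = ((\<integral>\<theta>. norm (f (cis \<theta>)) powr p \<partial>circ_meas) / (2*pi)) powr (1/p)"

definition GL_inf :: "(complex \<Rightarrow> complex) \<Rightarrow> bool" where
  "GL_inf a \<longleftrightarrow> (\<lambda>\<theta>. a (cis \<theta>)) \<in> borel_measurable circ_meas
      \<and> (\<exists>C. AE \<theta> in circ_meas. norm (a (cis \<theta>)) \<le> C)
      \<and> (\<exists>c>0. AE \<theta> in circ_meas. c \<le> norm (a (cis \<theta>)))"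

definition fourier_coeff :: "(complex \<Rightarrow> complex) \<Rightarrow> int \<Rightarrow> complex" where
  "fourier_coeff f n = (\<integral>\<theta>. f (cis \<theta>) * cis (- (of_int n * \<theta>)) \<partial>circ_meas) / (2*pi)"

definition Hp :: "real \<Rightarrow> (complex \<Rightarrow> complex) \<Rightarrow> bool" where
  "Hp p f \<longleftrightarrow> Lp p f \<and> (\<forall>n<0. fourier_coeff f n = 0)"

text \<open>Riesz projection: the (a.e. unique) \<open>H^p\<close> function with the same nonnegative
  Fourier coefficients (it exists for \<open>f \<in> L^p\<close>, \<open>1<p<\<infinity>\<close>, by M. Riesz' theorem).\<close>
definition rieszP :: "real \<Rightarrow> (complex \<Rightarrow> complex) \<Rightarrow> (complex \<Rightarrow> complex)" where
  "rieszP p f = (SOME g. Hp p g \<and> (\<forall>n\<ge>0. fourier_coeff g n = fourier_coeff f n))"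

definition rieszQ :: "real \<Rightarrow> (complex \<Rightarrow> complex) \<Rightarrow> (complex \<Rightarrow> complex)" where
  "rieszQ p f = (\<lambda>z. f z - rieszP p f z)"

definition toeplitz :: "real \<Rightarrow> (complex \<Rightarrow> complex) \<Rightarrow> (complex \<Rightarrow> complex) \<Rightarrow> (complex \<Rightarrow> complex)" where
  "toeplitz p a f = rieszP p (\<lambda>z. a z * f z)"

definition alpha :: "complex \<Rightarrow> complex \<Rightarrow> complex" where
  "alpha \<beta> z = (z - \<beta>) / (cnj \<beta> * z - 1)"

definition lam :: "complex \<Rightarrow> complex" where
  "lam \<beta> = \<i> * complex_of_real (sqrt ((cmod \<beta>)\<^sup>2 - 1))"

definition alpha_minus :: "complex \<Rightarrow> complex \<Rightarrow> complex" where
  "alpha_minus \<beta> t = lam \<beta> * t / (cnj \<beta> * t - 1)"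

definition chi :: "complex \<Rightarrow> complex \<Rightarrow> complex" where
  "chi \<beta> t = t / alpha_minus \<beta> t"

definition J_alpha :: "complex \<Rightarrow> (complex \<Rightarrow> complex) \<Rightarrow> (complex \<Rightarrow> complex)" where
  "J_alpha \<beta> \<phi> t = \<phi> (alpha \<beta> t) / chi \<beta> t"

definition hankel_alpha :: "real \<Rightarrow> complex \<Rightarrow> (complex \<Rightarrow> complex) \<Rightarrow> (complex \<Rightarrow> complex) \<Rightarrow> (complex \<Rightarrow> complex)" where
  "hankel_alpha p \<beta> a f = rieszP p (\<lambda>z. a z * rieszQ p (J_alpha \<beta> f) z)"

definition ops :: "real \<Rightarrow> complex \<Rightarrow> (complex \<Rightarrow> complex) \<Rightarrow> ((complex \<Rightarrow> complex) \<Rightarrow> (complex \<Rightarrow> complex)) set" where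
  "ops p \<beta> a =
    {(\<lambda>f z. toeplitz p a f z - hankel_alpha p \<beta> (\<lambda>t. a t / chi \<beta> t) f z),
     (\<lambda>f z. toeplitz p a f z + hankel_alpha p \<beta> (\<lambda>t. a t * chi \<beta> t) f z),
     (\<lambda>f z. toeplitz p a f z + hankel_alpha p \<beta> a f z),
     (\<lambda>f z. toeplitz p a f z - hankel_alpha p \<beta> a f z)}"

definition ker_trivial :: "real \<Rightarrow> ((complex \<Rightarrow> complex) \<Rightarrow> (complex \<Rightarrow> complex)) \<Rightarrow> bool" where
  "ker_trivial p A \<longleftrightarrow> (\<forall>f. Hp p f \<and> circ_ae_eq (A f) (\<lambda>_. 0) \<longrightarrow> circ_ae_eq f (\<lambda>_. 0))"

text \<open>\<open>dim coker A = 0\<close>: \<open>H^p / closure (im A)\<close> is trivial, i.e. the image is dense in \<open>H^p\<close>.\<close>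
definition coker_trivial :: "real \<Rightarrow> ((complex \<Rightarrow> complex) \<Rightarrow> (complex \<Rightarrow> complex)) \<Rightarrow> bool" where
  "coker_trivial p A \<longleftrightarrow> (\<forall>g. Hp p g \<longrightarrow>
      (\<forall>\<epsilon>>0. \<exists>f. Hp p f \<and> Lp_norm p (\<lambda>z. A f z - g z) < \<epsilon>))"

end

theory Submission
  imports Defs "HOL-Complex_Analysis.Complex_Analysis" "HOL-Real_Asymp.Real_Asymp"
begin

text \<open>Since \<open>J\<^sub>\<alpha>\<close> maps \<open>H\<^sup>p\<close> into functions with only negative Fourier coefficients, each of the four
  operators has the form \<open>A f = P (a (f + \<epsilon> \<chi>\<^sup>-\<^sup>j (f \<circ> \<alpha>)))\<close>. Put \<open>s = \<chi> + 1/\<chi>\<close>; because \<open>\<chi> \<circ> \<alpha> = 1/\<chi>\<close>,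
  the space of functions \<open>f + \<epsilon> \<chi>\<^sup>-\<^sup>j (f \<circ> \<alpha>)\<close>, \<open>f \<in> H\<^sup>p\<close>, is stable under multiplication by \<open>s\<close>.
  If \<open>f \<noteq> 0\<close> lies in the kernel, then \<open>h = a (f + \<epsilon> \<chi>\<^sup>-\<^sup>j (f \<circ> \<alpha>))\<close> is nonzero with only negative
  coefficients. Let \<open>- m\<close> be the index of its top coefficient. As \<open>\<chi>\<close> is a polynomial of degree one
  and \<open>1/\<chi>\<close> has only negative coefficients, \<open>s\<^sup>n h\<close> has top coefficient at \<open>n - m\<close>, so the functions
  \<open>P (s\<^sup>n h)\<close>, which all lie in the image of \<open>A\<close>, span the polynomials, and the image is dense.

  That \<open>P\<close> is defined on \<open>L\<^sup>p\<close> is M. Riesz' theorem. For \<open>1 < p \<le> 2\<close> one integrates a pointwise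
  inequality \<open>|w|\<^sup>p \<le> A (Re w)\<^sup>p - B Re (w\<^sup>p)\<close>, \<open>Re w > 0\<close>, along a polynomial with positive real part and
  applies the mean value property to the last term; \<open>p > 2\<close> follows by duality.\<close>

section \<open>Integrals and Fourier coefficients on the circle\<close>

text \<open>Membership in \<open>Hp\<close> is tested by Fourier coefficients alone, without
  boundary values of analytic functions: multiplication by \<chi> is a two-term recursion on
  coefficients, and its inverse is controlled because |\<beta>| > 1 makes that recursion expand
  towards large indices. The obstacle to stability under s is that 1/\<chi> has a pole in the disc,
  at 1/cnj \<beta>. With f = c + \<chi> g and g in \<open>Hp\<close>, both \<chi> f and (f -
  c)/\<chi> stay in \<open>Hp\<close> and reproduce s times the bracket up to terms proportional to
  c. That these terms lie in the same space is checked for each pair of exponent j and sign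
  \<epsilon>. That h is nonzero needs an argument: f has coefficients only at indices \<ge> 0 and
  \<chi>^(-j) (f \<circ> \<alpha>) only at indices \<le> -j. The two ranges meet only for j = 0, in
  the constants, where \<epsilon> = 1 excludes cancellation. The lower bound on |a| carries this
  over to h. The exponents n \<ge> m give exactly one function with top index n - m for each
  nonnegative index, so a prescribed nonnegative part is found by solving a triangular
  system.\<close>

definition p_moment :: "real \<Rightarrow> (complex \<Rightarrow> complex) \<Rightarrow> real" where
  "p_moment p f = (\<integral>\<theta>. norm (f (cis \<theta>)) powr p \<partial>circ_meas)"

lemma space_circ_meas [simp]: "space circ_meas = {0..2*pi}"
  by (simp add: circ_meas_def)

lemma measure_circ_meas [simp]: "measure circ_meas {0..2*pi} = 2*pi"
  by (simp add: circ_meas_def measure_restrict_space)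

lemma finite_measure_circ_meas: "finite_measure circ_meas"
  by (rule finite_measureI) (simp add: circ_meas_def emeasure_restrict_space)

interpretation circ: finite_measure circ_meas
  by (rule finite_measure_circ_meas)

lemma circ_measurable_continuous:
  assumes "continuous_on (sphere 0 1) f"
  shows "(\<lambda>\<theta>. f (cis \<theta>)) \<in> borel_measurable circ_meas"
  unfolding circ_meas_def
  by (intro continuous_imp_measurable_on_sets_lebesgue continuous_on_compose2[OF assms])
    (auto intro!: continuous_intros)

lemma circ_AE_iff: "(AE \<theta> in circ_meas. P \<theta>) \<longleftrightarrow> (AE \<theta> in lebesgue. \<theta> \<in> {0..2*pi} \<longrightarrow> P \<theta>)"
  unfolding circ_meas_def by (subst AE_restrict_space_iff) auto

text \<open>Follows from x + y \<le> 2 max x y. The crude factor 2^p takes the place of Minkowski's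
  inequality: all later estimates concern p-th moments, and only the existence of constants
  matters.\<close>

lemma powr_add_le:
  fixes x y p :: real
  assumes "0 \<le> x" "0 \<le> y" "0 < p"
  shows "(x + y) powr p \<le> 2 powr p * (x powr p + y powr p)"
proof -
  have "(x + y) powr p \<le> (2 * max x y) powr p"
    using assms by (intro powr_mono2) auto
  also have "\<dots> = 2 powr p * max x y powr p"
    using assms by (simp add: powr_mult)
  also have "\<dots> \<le> 2 powr p * (x powr p + y powr p)"
    by (intro mult_left_mono) (auto simp: max_def)
  finally show ?thesis .
qed

lemma norm_add_powr_le:
  fixes x y :: "'a::real_normed_vector"
  assumes "0 < p"
  shows "norm (x + y) powr p \<le> 2 powr p * (norm x powr p + norm y powr p)"
proof -
  have "norm (x + y) powr p \<le> (norm x + norm y) powr p"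
    using assms by (intro powr_mono2 norm_triangle_ineq) auto
  also have "\<dots> \<le> 2 powr p * (norm x powr p + norm y powr p)"
    using assms by (intro powr_add_le) auto
  finally show ?thesis .
qed

text \<open>Substitute for the inclusion of L^p in L^1 via Hoelder. The threshold \<delta> is free;
  taking it of the size of the function balances the two terms.\<close>

lemma le_add_powr:
  fixes x \<delta> p :: real
  assumes "0 \<le> x" "0 < \<delta>" "1 \<le> p"
  shows "x \<le> \<delta> + \<delta> powr (1 - p) * x powr p"
proof (cases "x \<le> \<delta>")
  case True
  then show ?thesis by (simp add: add_increasing2)
next
  case False
  then have "x = x powr (1 - p) * x powr p"
    using assms by (simp flip: powr_add)
  also have "\<dots> \<le> \<delta> powr (1 - p) * x powr p"
    using False assms by (intro mult_right_mono powr_mono2') auto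
  finally show ?thesis using assms by simp
qed

text \<open>Young's inequality with constants 1, by comparing y with x^(p-1), the value at which
  both terms on the right coincide.\<close>

lemma mult_le_powr_add_powr:
  fixes x y p q :: real
  assumes "0 \<le> x" "0 \<le> y" "1 < p" "1 < q" "1/p + 1/q = 1"
  shows "x * y \<le> x powr p + y powr q"
proof (cases "x = 0 \<or> y = 0")
  case True
  then show ?thesis by auto
next
  case False
  with assms have pos: "x > 0" "y > 0" by auto
  have pq: "p + q = p * q" using assms by (simp add: field_simps)
  show ?thesis
  proof (cases "y \<le> x powr (p - 1)")
    case True
    have "x * y \<le> x * x powr (p - 1)" using True pos by simp
    also have "\<dots> = x powr p" using pos by (simp add: powr_mult_base)
    finally show ?thesis by (simp add: add_increasing2)
  next
    case False
    \<comment> \<open>Conjugacy means that raising to the powers p - 1 and q - 1 are inverse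
      operations.\<close>
    have "(p - 1) * (q - 1) = 1" using pq by (simp add: left_diff_distrib right_diff_distrib)
    then have "x = (x powr (p - 1)) powr (q - 1)"
      using pos by (simp add: powr_powr)
    also have "\<dots> \<le> y powr (q - 1)"
      using False assms by (intro powr_mono2) auto
    finally have "x * y \<le> y powr (q - 1) * y" using pos by simp
    also have "\<dots> = y powr q" using pos by (simp add: powr_mult_base mult.commute)
    finally show ?thesis by (simp add: add_increasing)
  qed
qed

lemma Lp_measurable: "Lp p f \<Longrightarrow> (\<lambda>\<theta>. f (cis \<theta>)) \<in> borel_measurable circ_meas"
  by (simp add: Lp_def)

lemma Lp_integrable_powr: "Lp p f \<Longrightarrow> integrable circ_meas (\<lambda>\<theta>. norm (f (cis \<theta>)) powr p)"
  by (simp add: Lp_def)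

lemma Lp_dominated:
  assumes "Lp p g" "(\<lambda>\<theta>. f (cis \<theta>)) \<in> borel_measurable circ_meas" "0 < p"
    "AE \<theta> in circ_meas. norm (f (cis \<theta>)) \<le> C * norm (g (cis \<theta>))"
  shows "Lp p f"
  unfolding Lp_def
proof
  have [measurable]: "(\<lambda>\<theta>. f (cis \<theta>)) \<in> borel_measurable circ_meas" by fact
  show "integrable circ_meas (\<lambda>\<theta>. norm (f (cis \<theta>)) powr p)"
  proof (rule Bochner_Integration.integrable_bound)
    show "integrable circ_meas (\<lambda>\<theta>. \<bar>C\<bar> powr p * norm (g (cis \<theta>)) powr p)"
      using Lp_integrable_powr[OF assms(1)] by simp
    show "AE \<theta> in circ_meas. norm (norm (f (cis \<theta>)) powr p) \<le> norm (\<bar>C\<bar> powr p * norm (g (cis \<theta>)) powr p)"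
      using assms(4)
    proof eventually_elim
      case (elim \<theta>)
      have "norm (f (cis \<theta>)) powr p \<le> (\<bar>C\<bar> * norm (g (cis \<theta>))) powr p"
      proof (rule powr_mono2)
        show "norm (f (cis \<theta>)) \<le> \<bar>C\<bar> * norm (g (cis \<theta>))"
          using elim by (meson abs_ge_self mult_right_mono norm_ge_zero order_trans)
      qed (use assms in auto)
      then show ?case by (simp add: powr_mult)
    qed
  qed (use assms in measurable)
qed fact

lemma Lp_continuous:
  assumes "continuous_on (sphere 0 1) f" "0 < p"
  shows "Lp p f"
proof -
  obtain B where "\<forall>z\<in>sphere 0 1. norm (f z) \<le> B"
    using compact_imp_bounded[OF compact_continuous_image[OF assms(1) compact_sphere]]
    by (auto simp: bounded_iff)
  then have "AE \<theta> in circ_meas. norm (f (cis \<theta>)) \<le> B * norm ((\<lambda>_. 1::complex) (cis \<theta>))"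
    by auto
  moreover have "Lp p (\<lambda>_. 1)"
    by (simp add: Lp_def)
  ultimately show ?thesis
    by (rule Lp_dominated[OF _ circ_measurable_continuous[OF assms(1)] assms(2), rotated])
qed

lemma Lp_add:
  assumes "Lp p f" "Lp p g" "0 < p"
  shows "Lp p (\<lambda>z. f z + g z)"
  unfolding Lp_def
proof
  have [measurable]: "(\<lambda>\<theta>. f (cis \<theta>)) \<in> borel_measurable circ_meas"
    "(\<lambda>\<theta>. g (cis \<theta>)) \<in> borel_measurable circ_meas"
    using assms by (auto simp: Lp_def)
  show "(\<lambda>\<theta>. f (cis \<theta>) + g (cis \<theta>)) \<in> borel_measurable circ_meas" by measurable
  show "integrable circ_meas (\<lambda>\<theta>. norm (f (cis \<theta>) + g (cis \<theta>)) powr p)"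
  proof (rule Bochner_Integration.integrable_bound)
    show "integrable circ_meas (\<lambda>\<theta>. 2 powr p * (norm (f (cis \<theta>)) powr p + norm (g (cis \<theta>)) powr p))"
      using assms by (auto simp: Lp_def)
    show "AE \<theta> in circ_meas. norm (norm (f (cis \<theta>) + g (cis \<theta>)) powr p)
      \<le> norm (2 powr p * (norm (f (cis \<theta>)) powr p + norm (g (cis \<theta>)) powr p))"
      using norm_add_powr_le[OF assms(3)] by (intro AE_I2) simp
  qed measurable
qed

lemma Lp_bounded_mult:
  assumes "Lp p f" "(\<lambda>\<theta>. m (cis \<theta>)) \<in> borel_measurable circ_meas" "0 < p"
    "AE \<theta> in circ_meas. norm (m (cis \<theta>)) \<le> C"
  shows "Lp p (\<lambda>z. m z * f z)"
proof (rule Lp_dominated)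
  show "Lp p f" by fact
  show "AE \<theta> in circ_meas. norm (m (cis \<theta>) * f (cis \<theta>)) \<le> C * norm (f (cis \<theta>))"
    using assms(4) by eventually_elim (auto simp: norm_mult intro: mult_right_mono)
qed (use assms Lp_measurable[OF assms(1)] in auto)

lemma Lp_cmult: "Lp p f \<Longrightarrow> 0 < p \<Longrightarrow> Lp p (\<lambda>z. c * f z)"
  by (rule Lp_bounded_mult[where C = "norm c"]) auto

lemma Lp_diff:
  assumes "Lp p f" "Lp p g" "0 < p"
  shows "Lp p (\<lambda>z. f z - g z)"
  using Lp_add[OF assms(1) Lp_cmult[OF assms(2,3), of "-1"] assms(3)] by simp

lemma continuous_bounded_circ:
  assumes "continuous_on (sphere 0 1) m"
  obtains C where "AE \<theta> in circ_meas. norm (m (cis \<theta>)) \<le> C"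
proof -
  obtain B where "\<forall>z\<in>sphere 0 1. norm (m z) \<le> B"
    using compact_imp_bounded[OF compact_continuous_image[OF assms(1) compact_sphere]]
    by (auto simp: bounded_iff)
  then show ?thesis by (intro that[of B]) auto
qed

lemma Lp_continuous_mult:
  assumes "Lp p f" "continuous_on (sphere 0 1) m" "0 < p"
  shows "Lp p (\<lambda>z. m z * f z)"
proof -
  obtain C where "AE \<theta> in circ_meas. norm (m (cis \<theta>)) \<le> C"
    using continuous_bounded_circ[OF assms(2)] .
  then show ?thesis
    by (rule Lp_bounded_mult[OF assms(1) circ_measurable_continuous[OF assms(2)] assms(3)])
qed

lemma Lp_integrable:
  assumes "Lp p f" "1 \<le> p"
  shows "integrable circ_meas (\<lambda>\<theta>. f (cis \<theta>))"
proof (rule Bochner_Integration.integrable_bound)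
  show "integrable circ_meas (\<lambda>\<theta>. 1 + 1 powr (1 - p) * norm (f (cis \<theta>)) powr p)"
    using Lp_integrable_powr[OF assms(1)] by simp
  show "AE \<theta> in circ_meas. norm (f (cis \<theta>)) \<le> norm (1 + 1 powr (1 - p) * norm (f (cis \<theta>)) powr p)"
  proof (rule AE_I2)
    fix \<theta>
    show "norm (f (cis \<theta>)) \<le> norm (1 + 1 powr (1 - p) * norm (f (cis \<theta>)) powr p)"
      using le_add_powr[of "norm (f (cis \<theta>))" 1 p] assms by simp
  qed
qed (use assms Lp_measurable in auto)

text \<open>Measurability survives a change on a null set because Lebesgue measure is complete; the
  functions are extended by 0 to the line to use this.\<close>

lemma Lp_cong_AE:
  assumes "Lp p f" "circ_ae_eq g f" "0 < p"
  shows "Lp p g"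
proof (rule Lp_dominated[OF assms(1)])
  show "(\<lambda>\<theta>. g (cis \<theta>)) \<in> borel_measurable circ_meas"
  proof -
    have "(\<lambda>\<theta>. if \<theta> \<in> {0..2*pi} then f (cis \<theta>) else 0) \<in> borel_measurable lebesgue"
      using Lp_measurable[OF assms(1)] by (intro borel_measurable_if_I) (auto simp: circ_meas_def)
    moreover have "AE \<theta> in lebesgue. (if \<theta> \<in> {0..2*pi} then f (cis \<theta>) else 0) =
        (if \<theta> \<in> {0..2*pi} then g (cis \<theta>) else 0)"
      using assms(2) unfolding circ_ae_eq_def circ_AE_iff by eventually_elim auto
    ultimately have "(\<lambda>\<theta>. if \<theta> \<in> {0..2*pi} then g (cis \<theta>) else 0) \<in> borel_measurable lebesgue"
      by (rule borel_measurable_AE)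
    then show ?thesis
      unfolding circ_meas_def by (rule borel_measurable_if_D)
  qed
  show "AE \<theta> in circ_meas. norm (g (cis \<theta>)) \<le> 1 * norm (f (cis \<theta>))"
    using assms(2) unfolding circ_ae_eq_def by eventually_elim auto
qed fact

lemma p_moment_nonneg: "0 \<le> p_moment p f"
  by (simp add: p_moment_def)

lemma p_moment_cong_AE:
  assumes "circ_ae_eq f g" "Lp p f" "0 < p"
  shows "p_moment p f = p_moment p g"
proof -
  have "circ_ae_eq g f" using assms(1) unfolding circ_ae_eq_def by eventually_elim auto
  then have "Lp p g" using Lp_cong_AE assms by blast
  then show ?thesis
    unfolding p_moment_def
  proof (intro integral_cong_AE)
    show "AE \<theta> in circ_meas. norm (f (cis \<theta>)) powr p = norm (g (cis \<theta>)) powr p"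
      using assms(1) unfolding circ_ae_eq_def by eventually_elim auto
  qed (use assms \<open>Lp p g\<close> Lp_integrable_powr in auto)
qed

lemma p_moment_add:
  assumes "Lp p f" "Lp p g" "0 < p"
  shows "p_moment p (\<lambda>z. f z + g z) \<le> 2 powr p * (p_moment p f + p_moment p g)"
proof -
  have "p_moment p (\<lambda>z. f z + g z) \<le>
    (\<integral>\<theta>. 2 powr p * (norm (f (cis \<theta>)) powr p + norm (g (cis \<theta>)) powr p) \<partial>circ_meas)"
    unfolding p_moment_def
    using Lp_add[OF assms] assms(1,2)
    by (intro integral_mono norm_add_powr_le assms) (auto simp: Lp_def)
  also have "\<dots> = 2 powr p * (p_moment p f + p_moment p g)"
    unfolding p_moment_def using assms by (simp add: Lp_def)
  finally show ?thesis .
qed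

lemma p_moment_commute: "p_moment p (\<lambda>z. f z - g z) = p_moment p (\<lambda>z. g z - f z)"
  by (simp add: p_moment_def norm_minus_commute)

lemma p_moment_cmult: "p_moment p (\<lambda>z. c * f z) = norm c powr p * p_moment p f"
  by (simp add: p_moment_def norm_mult powr_mult)

lemma p_moment_diff:
  assumes "Lp p f" "Lp p g" "0 < p"
  shows "p_moment p (\<lambda>z. f z - g z) \<le> 2 powr p * (p_moment p f + p_moment p g)"
  using p_moment_add[OF assms(1) Lp_cmult[OF assms(2,3), of "-1"] assms(3)] p_moment_cmult[of p "-1" g]
  by simp

lemma p_moment_mono:
  assumes "Lp p f" "Lp p g" "0 < p" "AE \<theta> in circ_meas. norm (f (cis \<theta>)) \<le> norm (g (cis \<theta>))"
  shows "p_moment p f \<le> p_moment p g"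
  unfolding p_moment_def
proof (rule integral_mono_AE)
  show "AE \<theta> in circ_meas. norm (f (cis \<theta>)) powr p \<le> norm (g (cis \<theta>)) powr p"
    using assms(4) by eventually_elim (use assms in \<open>auto intro: powr_mono2\<close>)
qed (use assms Lp_integrable_powr in auto)

lemma norm_integral_le_p_moment:
  assumes "Lp p f" "1 \<le> p" "0 < \<delta>"
  shows "(\<integral>\<theta>. norm (f (cis \<theta>)) \<partial>circ_meas) \<le> 2*pi*\<delta> + \<delta> powr (1 - p) * p_moment p f"
proof -
  have "(\<integral>\<theta>. norm (f (cis \<theta>)) \<partial>circ_meas) \<le>
    (\<integral>\<theta>. \<delta> + \<delta> powr (1 - p) * norm (f (cis \<theta>)) powr p \<partial>circ_meas)"
    using Lp_integrable[OF assms(1,2)] Lp_integrable_powr[OF assms(1)]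
    by (intro integral_mono le_add_powr assms) auto
  also have "\<dots> = 2*pi*\<delta> + \<delta> powr (1 - p) * p_moment p f"
    using assms unfolding p_moment_def by (simp add: Lp_def)
  finally show ?thesis .
qed

section \<open>Fourier coefficients: linearity, shift and size\<close>

lemma integrable_cis_mult:
  assumes "integrable circ_meas (\<lambda>\<theta>. f (cis \<theta>))"
  shows "integrable circ_meas (\<lambda>\<theta>. f (cis \<theta>) * cis (c * \<theta>))"
proof (rule Bochner_Integration.integrable_bound[OF assms])
  have "(\<lambda>\<theta>. cis (c * \<theta>)) \<in> borel_measurable circ_meas"
    unfolding circ_meas_def
    by (intro continuous_imp_measurable_on_sets_lebesgue) (auto intro!: continuous_intros)
  then show "(\<lambda>\<theta>. f (cis \<theta>) * cis (c * \<theta>)) \<in> borel_measurable circ_meas"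
    using assms by measurable
qed (auto simp: norm_mult)

lemma fourier_integrable:
  assumes "integrable circ_meas (\<lambda>\<theta>. f (cis \<theta>))"
  shows "integrable circ_meas (\<lambda>\<theta>. f (cis \<theta>) * cis (- (of_int n * \<theta>)))"
  using integrable_cis_mult[OF assms, of "- of_int n"] by simp

lemma fourier_coeff_add:
  assumes "integrable circ_meas (\<lambda>\<theta>. f (cis \<theta>))" "integrable circ_meas (\<lambda>\<theta>. g (cis \<theta>))"
  shows "fourier_coeff (\<lambda>z. f z + g z) n = fourier_coeff f n + fourier_coeff g n"
  unfolding fourier_coeff_def distrib_right
  using fourier_integrable[OF assms(1), of n] fourier_integrable[OF assms(2), of n]
  by (simp add: add_divide_distrib)

lemma fourier_coeff_cmult:
  "fourier_coeff (\<lambda>z. c * f z) n = c * fourier_coeff f n"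
  unfolding fourier_coeff_def by (simp add: mult.assoc)

lemma fourier_coeff_diff:
  assumes "integrable circ_meas (\<lambda>\<theta>. f (cis \<theta>))" "integrable circ_meas (\<lambda>\<theta>. g (cis \<theta>))"
  shows "fourier_coeff (\<lambda>z. f z - g z) n = fourier_coeff f n - fourier_coeff g n"
  using fourier_coeff_add[OF assms(1), of "\<lambda>z. (-1) * g z" n] assms(2) fourier_coeff_cmult[of "-1" g n]
  by simp

lemma fourier_coeff_cong_AE:
  assumes "circ_ae_eq f g" "integrable circ_meas (\<lambda>\<theta>. f (cis \<theta>))" "integrable circ_meas (\<lambda>\<theta>. g (cis \<theta>))"
  shows "fourier_coeff f n = fourier_coeff g n"
proof -
  have "(\<integral>\<theta>. f (cis \<theta>) * cis (- (of_int n * \<theta>)) \<partial>circ_meas) = (\<integral>\<theta>. g (cis \<theta>) * cis (- (of_int n * \<theta>)) \<partial>circ_meas)"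
  proof (intro integral_cong_AE)
    show "AE \<theta> in circ_meas. f (cis \<theta>) * cis (- (of_int n * \<theta>)) = g (cis \<theta>) * cis (- (of_int n * \<theta>))"
      using assms(1) unfolding circ_ae_eq_def by eventually_elim auto
  qed (use fourier_integrable[OF assms(2), of n] fourier_integrable[OF assms(3), of n] in auto)
  then show ?thesis by (simp add: fourier_coeff_def)
qed

lemma fourier_coeff_cong:
  assumes "\<And>z. norm z = 1 \<Longrightarrow> f z = g z"
  shows "fourier_coeff f n = fourier_coeff g n"
  unfolding fourier_coeff_def using assms by simp

lemma fourier_coeff_shift: "fourier_coeff (\<lambda>z. z * f z) n = fourier_coeff f (n - 1)"
proof -
  have "cis \<theta> * f (cis \<theta>) * cis (- (of_int n * \<theta>)) = f (cis \<theta>) * cis (- (of_int (n - 1) * \<theta>))" for \<theta>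
  proof -
    have "cis \<theta> * cis (- (of_int n * \<theta>)) = cis (- (of_int (n - 1) * \<theta>))"
      by (simp add: cis_mult algebra_simps)
    then show ?thesis by (metis mult.assoc mult.commute)
  qed
  then show ?thesis unfolding fourier_coeff_def by presburger
qed

lemma norm_fourier_coeff_le:
  "2*pi * norm (fourier_coeff f n) \<le> (\<integral>\<theta>. norm (f (cis \<theta>)) \<partial>circ_meas)"
proof -
  have "2*pi * norm (fourier_coeff f n) = norm (\<integral>\<theta>. f (cis \<theta>) * cis (- (of_int n * \<theta>)) \<partial>circ_meas)"
    by (simp add: fourier_coeff_def norm_divide)
  also have "\<dots> \<le> (\<integral>\<theta>. norm (f (cis \<theta>) * cis (- (of_int n * \<theta>))) \<partial>circ_meas)"
    by (rule integral_norm_bound)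
  finally show ?thesis by (simp add: norm_mult)
qed

lemma fourier_coeff_small:
  assumes "Lp p f" "1 \<le> p" "0 < \<delta>"
  shows "2*pi * norm (fourier_coeff f n) \<le> 2*pi*\<delta> + \<delta> powr (1 - p) * p_moment p f"
  using norm_fourier_coeff_le norm_integral_le_p_moment[OF assms] order_trans by blast

lemma circ_integral_0_iff:
  assumes "integrable circ_meas (\<lambda>\<theta>. f (cis \<theta>))"
  shows "(\<integral>\<theta>. norm (f (cis \<theta>)) \<partial>circ_meas) = 0 \<longleftrightarrow> circ_ae_eq f (\<lambda>_. 0)"
  using assms by (subst integral_nonneg_eq_0_iff_AE) (auto simp: circ_ae_eq_def)

section \<open>Trigonometric polynomials\<close>

text \<open>On the circle cnj z = 1/z, so the pair of polynomials encodes a Laurent polynomial with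
  its analytic and antianalytic parts already separated.\<close>

definition trig_poly :: "(complex \<Rightarrow> complex) \<Rightarrow> bool" where
  "trig_poly f \<longleftrightarrow> (\<exists>A B. \<forall>z. norm z = 1 \<longrightarrow> f z = poly A z + cnj (poly B z))"

lemma trig_polyI: "(\<And>z. norm z = 1 \<Longrightarrow> f z = poly A z + cnj (poly B z)) \<Longrightarrow> trig_poly f"
  unfolding trig_poly_def by blast

text \<open>Moving the constant term of the antianalytic part into \<open>A\<close> makes
  \<open>A\<close> exactly the Riesz projection of the trigonometric polynomial.\<close>

lemma trig_poly_normalE:
  assumes "trig_poly f"
  obtains A B where "poly B 0 = 0" "\<And>z. norm z = 1 \<Longrightarrow> f z = poly A z + cnj (poly B z)"
proof -
  obtain A B where AB: "\<And>z. norm z = 1 \<Longrightarrow> f z = poly A z + cnj (poly B z)"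
    using assms unfolding trig_poly_def by blast
  show ?thesis
    by (rule that[of "B - [:poly B 0:]" "A + [:cnj (poly B 0):]"]) (auto simp: AB)
qed

lemma trig_poly_cong: "trig_poly f \<Longrightarrow> (\<And>z. norm z = 1 \<Longrightarrow> g z = f z) \<Longrightarrow> trig_poly g"
  unfolding trig_poly_def by metis

lemma trig_poly_add:
  assumes "trig_poly f" "trig_poly g"
  shows "trig_poly (\<lambda>z. f z + g z)"
proof -
  obtain A B where 1: "\<And>z. norm z = 1 \<Longrightarrow> f z = poly A z + cnj (poly B z)"
    using assms(1) unfolding trig_poly_def by blast
  obtain C D where 2: "\<And>z. norm z = 1 \<Longrightarrow> g z = poly C z + cnj (poly D z)"
    using assms(2) unfolding trig_poly_def by blast
  show ?thesis
    by (rule trig_polyI[of _ "A + C" "B + D"]) (simp add: 1 2)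
qed

lemma trig_poly_cmult:
  assumes "trig_poly f"
  shows "trig_poly (\<lambda>z. c * f z)"
proof -
  obtain A B where 1: "\<And>z. norm z = 1 \<Longrightarrow> f z = poly A z + cnj (poly B z)"
    using assms(1) unfolding trig_poly_def by blast
  show ?thesis
    by (rule trig_polyI[of _ "smult c A" "smult (cnj c) B"]) (simp add: 1 distrib_left)
qed

lemma trig_poly_cnj:
  assumes "trig_poly f"
  shows "trig_poly (\<lambda>z. cnj (f z))"
proof -
  obtain A B where 1: "\<And>z. norm z = 1 \<Longrightarrow> f z = poly A z + cnj (poly B z)"
    using assms(1) unfolding trig_poly_def by blast
  show ?thesis
    by (rule trig_polyI[of _ B A]) (simp add: 1)
qed

lemma norm_1_cnj_mult: "norm z = 1 \<Longrightarrow> z * cnj z = 1"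
  using complex_norm_square[of z] by simp

lemma trig_poly_shift:
  assumes "trig_poly f"
  shows "trig_poly (\<lambda>z. z * f z)"
proof -
  obtain A B where 1: "\<And>z. norm z = 1 \<Longrightarrow> f z = poly A z + cnj (poly B z)"
    using assms(1) unfolding trig_poly_def by blast
  obtain b C where B: "B = pCons b C" by (cases B)
  show ?thesis
  \<comment> \<open>Multiplication by z cancels one factor cnj z of each antianalytic monomial; only
    the constant term cnj b of that part crosses over and becomes cnj b * z.\<close>
  proof (rule trig_polyI[of _ "pCons 0 A + [:0, cnj b:]" C])
    fix z :: complex assume z: "norm z = 1"
    have "z * (cnj z * cnj (poly C z)) = cnj (poly C z)"
      using norm_1_cnj_mult[OF z] by (simp flip: mult.assoc)
    then show "z * f z = poly (pCons 0 A + [:0, cnj b:]) z + cnj (poly C z)"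
      by (simp add: 1 z B algebra_simps)
  qed
qed

lemma trig_poly_poly_mult: "trig_poly f \<Longrightarrow> trig_poly (\<lambda>z. poly A z * f z)"
proof (induction A arbitrary: f)
  case 0
  then show ?case using trig_poly_cmult[of f 0] by simp
next
  case (pCons a A)
  have "trig_poly (\<lambda>z. a * f z + poly A z * (z * f z))"
    by (intro trig_poly_add trig_poly_cmult pCons.IH trig_poly_shift pCons.prems)
  then show ?case by (simp add: algebra_simps)
qed

lemma trig_poly_mult:
  assumes "trig_poly f" "trig_poly g"
  shows "trig_poly (\<lambda>z. f z * g z)"
proof -
  obtain A B where 1: "\<And>z. norm z = 1 \<Longrightarrow> f z = poly A z + cnj (poly B z)"
    using assms(1) unfolding trig_poly_def by blast
  have "trig_poly (\<lambda>z. poly A z * g z + cnj (poly B z * cnj (g z)))"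
    by (intro trig_poly_add trig_poly_cnj trig_poly_poly_mult assms)
  then show ?thesis
    by (rule trig_poly_cong) (simp add: 1 distrib_right)
qed

text \<open>Connects the real Stone-Weierstrass theorem in the plane with approximation on the
  circle.\<close>

lemma trig_poly_of_real_polynomial_function:
  fixes g :: "complex \<Rightarrow> real"
  shows "real_polynomial_function g \<Longrightarrow> trig_poly (\<lambda>z. of_real (g z))"
proof (induction rule: real_polynomial_function.induct)
  case (linear g)
  interpret bounded_linear g by fact
  \<comment> \<open>Chosen so that the real-linear functional is g z = 2 Re (c z) = c z + cnj (c
    z).\<close>
  define c where "c = Complex (g 1 / 2) (- g \<i> / 2)"
  show ?case
  proof (rule trig_polyI[of _ "[:0, c:]" "[:0, c:]"])
    fix z
    have "z = Re z *\<^sub>R 1 + Im z *\<^sub>R \<i>"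
      by (simp add: complex_eq_iff)
    then have "g z = Re z * g 1 + Im z * g \<i>"
      using add scaleR by (metis real_scaleR_def)
    then show "complex_of_real (g z) = poly [:0, c:] z + cnj (poly [:0, c:] z)"
      by (simp add: complex_eq_iff c_def)
  qed
next
  case (const c)
  show ?case by (rule trig_polyI[of _ "[:of_real c:]" 0]) simp
qed (auto intro: trig_poly_add trig_poly_mult)

lemma continuous_on_poly_id [continuous_intros]:
  fixes A :: "complex poly" shows "continuous_on S (poly A)"
  using continuous_on_poly[OF continuous_on_id] .

lemma continuous_on_trig_poly:
  assumes "trig_poly f" shows "continuous_on (sphere 0 1) f"
proof -
  obtain A B where AB: "\<And>z. norm z = 1 \<Longrightarrow> f z = poly A z + cnj (poly B z)"
    using assms unfolding trig_poly_def by blast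
  have "continuous_on (sphere 0 1) (\<lambda>z. poly A z + cnj (poly B z))"
    by (intro continuous_intros)
  then show ?thesis
    by (rule continuous_on_eq) (simp add: AB)
qed

lemma trig_poly_uniform_approx:
  assumes "continuous_on (sphere 0 1) f" "0 < e"
  obtains t where "trig_poly t" "\<And>z. norm z = 1 \<Longrightarrow> norm (f z - t z) < e"
proof -
  obtain g where g: "real_polynomial_function g" "\<And>z. z \<in> sphere 0 1 \<Longrightarrow> \<bar>Re (f z) - g z\<bar> < e/2"
  proof (rule Stone_Weierstrass_real_polynomial_function[of "sphere (0::complex) 1" "\<lambda>z. Re (f z)" "e/2"])
    show "continuous_on (sphere 0 1) (\<lambda>z. Re (f z))"
      using assms(1) by (intro continuous_intros)
  qed (use assms(2) in auto)
  obtain h where h: "real_polynomial_function h" "\<And>z. z \<in> sphere 0 1 \<Longrightarrow> \<bar>Im (f z) - h z\<bar> < e/2"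
  proof (rule Stone_Weierstrass_real_polynomial_function[of "sphere (0::complex) 1" "\<lambda>z. Im (f z)" "e/2"])
    show "continuous_on (sphere 0 1) (\<lambda>z. Im (f z))"
      using assms(1) by (intro continuous_intros)
  qed (use assms(2) in auto)
  show ?thesis
  proof (rule that)
    show "trig_poly (\<lambda>z. of_real (g z) + \<i> * of_real (h z))"
      by (intro trig_poly_add trig_poly_cmult trig_poly_of_real_polynomial_function g h)
    fix z :: complex assume "norm z = 1"
    then have "\<bar>Re (f z) - g z\<bar> < e/2" "\<bar>Im (f z) - h z\<bar> < e/2" using g h by auto
    moreover have "norm (f z - (of_real (g z) + \<i> * of_real (h z))) \<le> \<bar>Re (f z) - g z\<bar> + \<bar>Im (f z) - h z\<bar>"
      using cmod_le[of "f z - (of_real (g z) + \<i> * of_real (h z))"] by simp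
    ultimately show "norm (f z - (of_real (g z) + \<i> * of_real (h z))) < e" by simp
  qed
qed

section \<open>Density of trigonometric polynomials in L^p\<close>

lemma p_moment_tendsto_0:
  assumes "\<And>n. (\<lambda>\<theta>. f n (cis \<theta>)) \<in> borel_measurable circ_meas" "0 < p"
    and "integrable circ_meas (\<lambda>\<theta>. G \<theta> powr p)"
    and "\<And>n. AE \<theta> in circ_meas. norm (f n (cis \<theta>)) \<le> G \<theta>"
    and "AE \<theta> in circ_meas. (\<lambda>n. f n (cis \<theta>)) \<longlonglongrightarrow> 0"
  shows "(\<lambda>n. p_moment p (f n)) \<longlonglongrightarrow> 0"
proof -
  have "(\<lambda>n. p_moment p (f n)) \<longlonglongrightarrow> (\<integral>\<theta>. 0 \<partial>circ_meas)"
    unfolding p_moment_def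
  proof (rule integral_dominated_convergence)
    show "integrable circ_meas (\<lambda>\<theta>. G \<theta> powr p)" by fact
    show "AE \<theta> in circ_meas. (\<lambda>n. norm (f n (cis \<theta>)) powr p) \<longlonglongrightarrow> 0"
      using assms(5)
    proof eventually_elim
      case (elim \<theta>)
      have "(\<lambda>n. norm (f n (cis \<theta>)) powr p) \<longlonglongrightarrow> 0 powr p"
        by (rule tendsto_powr') (use elim assms(2) in \<open>auto intro: tendsto_norm_zero\<close>)
      then show ?case by simp
    qed
    show "AE \<theta> in circ_meas. norm (norm (f n (cis \<theta>)) powr p) \<le> G \<theta> powr p" for n
      using assms(4)[of n] by eventually_elim (use assms(2) in \<open>auto intro: powr_mono2\<close>)
    show "(\<lambda>\<theta>. norm (f n (cis \<theta>)) powr p) \<in> borel_measurable circ_meas" for n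
      using assms(1)[of n] by measurable
  qed auto
  then show ?thesis by simp
qed

text \<open>Radial retraction onto the closed disc of radius \<open>M\<close>. It truncates a
  function without destroying continuity.\<close>

definition clamp_disc :: "real \<Rightarrow> complex \<Rightarrow> complex" where
  "clamp_disc M w = w / of_real (max 1 (norm w / M))"

lemma norm_clamp_disc: "0 < M \<Longrightarrow> norm (clamp_disc M w) \<le> M"
  unfolding clamp_disc_def norm_divide norm_of_real
  by (auto simp: max_def field_simps)

lemma clamp_disc_id: "0 < M \<Longrightarrow> norm w \<le> M \<Longrightarrow> clamp_disc M w = w"
  by (simp add: clamp_disc_def)

lemma continuous_on_clamp_disc: "0 < M \<Longrightarrow> continuous_on UNIV (clamp_disc M)"
proof -
  assume "0 < M"
  moreover have "max 1 x \<noteq> 0" for x :: real by linarith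
  ultimately show ?thesis
    unfolding clamp_disc_def by (intro continuous_intros ballI) auto
qed

lemma norm_diff_clamp_disc: "norm (w - clamp_disc M w) \<le> norm w"
proof -
  define m where "m = max 1 (norm w / M)"
  have m: "m \<ge> 1" by (simp add: m_def)
  have "w - clamp_disc M w = of_real (1 - 1/m) * w"
    by (simp add: clamp_disc_def m_def algebra_simps)
  then have "norm (w - clamp_disc M w) = \<bar>1 - 1/m\<bar> * norm w"
    by (simp only: norm_mult norm_of_real)
  also have "\<dots> \<le> 1 * norm w"
    using m by (intro mult_right_mono) (auto simp: abs_le_iff)
  finally show ?thesis by simp
qed

text \<open>A measurable function of the angle is an a.e. limit of continuous ones. These are
  transported to the circle by the argument and clamped to radius \<open>M\<close>, so that
  dominated convergence applies with a constant majorant.\<close>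

lemma continuous_dense_bounded:
  assumes meas: "(\<lambda>\<theta>. f (cis \<theta>)) \<in> borel_measurable circ_meas"
    and M: "0 < M" "\<And>z. norm (f z) \<le> M" and p: "0 < p" and e: "0 < e"
  obtains t where "continuous_on (sphere 0 1) t" "p_moment p (\<lambda>z. f z - t z) < e"
proof -
  have "(\<lambda>\<theta>. f (cis \<theta>)) measurable_on {0..2*pi}"
    using meas unfolding circ_meas_def by (subst measurable_on_iff_borel_measurable) auto
  then obtain N g where N: "negligible N" and g: "\<And>n. continuous_on UNIV (g n)"
    and lim: "\<And>x. x \<notin> N \<Longrightarrow> (\<lambda>n. g n x) \<longlonglongrightarrow> (if x \<in> {0..2*pi} then f (cis x) else 0)"
    unfolding measurable_on_def by blast
  \<comment> \<open>\<open>Arg2pi\<close> jumps at 1. The first factor vanishes at 1, which restores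
    continuity there, and tends to 1 at every other point.\<close>
  define t where "t n z = of_real (min 1 (real n * norm (z - 1))) * clamp_disc M (g n (Arg2pi z))" for n z
  have t_norm: "norm (t n z) \<le> real n * norm (z - 1) * M" "norm (t n z) \<le> M" for n z
  proof -
    have *: "norm (t n z) = min 1 (real n * norm (z - 1)) * norm (clamp_disc M (g n (Arg2pi z)))"
      unfolding t_def norm_mult norm_of_real by (simp add: abs_of_nonneg)
    show "norm (t n z) \<le> real n * norm (z - 1) * M"
      unfolding * by (intro mult_mono norm_clamp_disc M) auto
    have "norm (t n z) \<le> 1 * M"
      unfolding * by (intro mult_mono norm_clamp_disc M) auto
    then show "norm (t n z) \<le> M" by simp
  qed
  have t_cont: "continuous_on (sphere 0 1) (t n)" for n
  proof (rule continuous_at_imp_continuous_on, rule ballI)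
    fix z :: complex assume z: "z \<in> sphere 0 1"
    show "isCont (t n) z"
    proof (cases "z = 1")
      case True
      have "(\<lambda>w. t n w) \<midarrow>1\<rightarrow> 0"
      proof (rule Lim_null_comparison)
        show "\<forall>\<^sub>F w in at 1. norm (t n w) \<le> real n * norm (w - 1) * M"
          using t_norm by simp
        show "((\<lambda>w. real n * norm (w - 1) * M) \<longlongrightarrow> 0) (at (1::complex))"
          by (auto intro!: tendsto_eq_intros)
      qed
      moreover have "t n 1 = 0" by (simp add: t_def)
      ultimately show ?thesis unfolding isCont_def True by simp
    next
      case False
      have "z \<notin> \<real>\<^sub>\<ge>\<^sub>0"
      proof
        assume "z \<in> \<real>\<^sub>\<ge>\<^sub>0"
        then obtain r where "z = of_real r" "r \<ge> 0" by (auto elim: nonneg_Reals_cases)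
        with z False show False by auto
      qed
      then have A: "isCont Arg2pi z" by (rule continuous_at_Arg2pi)
      have "isCont (\<lambda>z. clamp_disc M (g n (Arg2pi z))) z"
        using A g[of n] continuous_on_clamp_disc[OF M(1)]
        by (intro isCont_o2[of z "\<lambda>z. g n (Arg2pi z)" "clamp_disc M"] isCont_o2[OF A])
          (auto simp: continuous_on_eq_continuous_at)
      then show ?thesis unfolding t_def by (intro continuous_intros)
    qed
  qed
  have "(\<lambda>n. p_moment p (\<lambda>z. f z - t n z)) \<longlonglongrightarrow> 0"
  proof (rule p_moment_tendsto_0[where G = "\<lambda>_. 2 * M"])
    show "(\<lambda>\<theta>. f (cis \<theta>) - t n (cis \<theta>)) \<in> borel_measurable circ_meas" for n
      using meas circ_measurable_continuous[OF t_cont[of n]] by measurable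
    show "integrable circ_meas (\<lambda>_. (2 * M) powr p)" by simp
    have "norm (f z - t n z) \<le> 2 * M" for n z
      using norm_triangle_ineq4[of "f z" "t n z"] M(2)[of z] t_norm(2)[of n z] by simp
    then show "AE \<theta> in circ_meas. norm (f (cis \<theta>) - t n (cis \<theta>)) \<le> 2 * M" for n by simp
    \<comment> \<open>The endpoints 0 and 2\<pi> both correspond to the point 1, where every
      \<open>t n\<close> is 0.\<close>
    have "AE \<theta> in lebesgue. \<theta> \<notin> insert 0 (insert (2*pi) N)"
      using N by (intro AE_not_in) (simp add: negligible_iff_null_sets[symmetric])
    then show "AE \<theta> in circ_meas. (\<lambda>n. f (cis \<theta>) - t n (cis \<theta>)) \<longlonglongrightarrow> 0"
      unfolding circ_AE_iff
    proof eventually_elim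
      case (elim \<theta>)
      show ?case
      proof
        assume th: "\<theta> \<in> {0..2*pi}"
        with elim have th': "0 < \<theta>" "\<theta> < 2*pi" "\<theta> \<notin> N" by auto
        have Arg: "Arg2pi (cis \<theta>) = \<theta>"
          using th' by (intro Arg2pi_unique[of 1]) (auto simp: cis_conv_exp)
        have "cis \<theta> \<noteq> 1"
          using Arg th' by (metis Arg2pi_of_real less_irrefl not_one_less_zero of_real_1)
        then have "norm (cis \<theta> - 1) > 0" by simp
        then have "eventually (\<lambda>n. real n * norm (cis \<theta> - 1) \<ge> 1) sequentially"
          by real_asymp
        then have 1: "(\<lambda>n. complex_of_real (min 1 (real n * norm (cis \<theta> - 1)))) \<longlonglongrightarrow> 1"
          by (intro tendsto_eventually) (auto elim!: eventually_mono simp: min_def)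
        have "(\<lambda>n. clamp_disc M (g n \<theta>)) \<longlonglongrightarrow> clamp_disc M (f (cis \<theta>))"
          using lim[OF th'(3)] th continuous_on_clamp_disc[OF M(1)]
          by (intro isCont_tendsto_compose[of _ "clamp_disc M"]) (auto simp: continuous_on_eq_continuous_at)
        then have "(\<lambda>n. t n (cis \<theta>)) \<longlonglongrightarrow> 1 * clamp_disc M (f (cis \<theta>))"
          unfolding t_def Arg by (intro tendsto_mult 1)
        then have "(\<lambda>n. t n (cis \<theta>)) \<longlonglongrightarrow> f (cis \<theta>)"
          using clamp_disc_id[OF M] by simp
        then show "(\<lambda>n. f (cis \<theta>) - t n (cis \<theta>)) \<longlonglongrightarrow> 0"
          using tendsto_diff[OF tendsto_const[of "f (cis \<theta>)"]] by fastforce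
      qed
    qed
  qed fact
  then have "eventually (\<lambda>n. p_moment p (\<lambda>z. f z - t n z) < e) sequentially"
    using e by (rule order_tendstoD)
  then obtain n where "p_moment p (\<lambda>z. f z - t n z) < e"
    by (auto simp: eventually_sequentially)
  with t_cont show ?thesis using that by blast
qed

text \<open>Truncation, approximation by a continuous function and uniform approximation by a
  trigonometric polynomial, in this order.\<close>

lemma trig_poly_dense:
  assumes f: "Lp p f" and p: "0 < p" and e: "0 < e"
  obtains t where "trig_poly t" "p_moment p (\<lambda>z. f z - t z) < e"
proof -
  define K where "K = (2::real) powr p"
  have K: "K > 0" by (simp add: K_def)
  have meas: "(\<lambda>\<theta>. f (cis \<theta>)) \<in> borel_measurable circ_meas" using f by (simp add: Lp_def)
  have clm: "(\<lambda>\<theta>. clamp_disc M (f (cis \<theta>))) \<in> borel_measurable circ_meas" if "0 < M" for M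
    using continuous_on_clamp_disc[OF that] meas by (rule borel_measurable_continuous_on)
  have "(\<lambda>n. p_moment p (\<lambda>z. f z - clamp_disc (real (Suc n)) (f z))) \<longlonglongrightarrow> 0"
  proof (rule p_moment_tendsto_0[where G = "\<lambda>\<theta>. norm (f (cis \<theta>))"])
    show "(\<lambda>\<theta>. f (cis \<theta>) - clamp_disc (real (Suc n)) (f (cis \<theta>))) \<in> borel_measurable circ_meas" for n
      using meas clm[of "real (Suc n)"] by measurable
    show "integrable circ_meas (\<lambda>\<theta>. norm (f (cis \<theta>)) powr p)" using f by (simp add: Lp_def)
    have "(\<lambda>n. f z - clamp_disc (real (Suc n)) (f z)) \<longlonglongrightarrow> 0" for z
    proof (rule tendsto_eventually)
      have "eventually (\<lambda>n. norm (f z) \<le> real (Suc n)) sequentially" by real_asymp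
      then show "eventually (\<lambda>n. f z - clamp_disc (real (Suc n)) (f z) = 0) sequentially"
        by eventually_elim (simp add: clamp_disc_id)
    qed
    then show "AE \<theta> in circ_meas. (\<lambda>n. f (cis \<theta>) - clamp_disc (real (Suc n)) (f (cis \<theta>))) \<longlonglongrightarrow> 0"
      by simp
  qed (use p norm_diff_clamp_disc in auto)
  then have "eventually (\<lambda>n. p_moment p (\<lambda>z. f z - clamp_disc (real (Suc n)) (f z)) < e / (2*K)) sequentially"
    using e K by (intro order_tendstoD) auto
  then obtain n where n: "p_moment p (\<lambda>z. f z - clamp_disc (real (Suc n)) (f z)) < e / (2*K)"
    by (auto simp: eventually_sequentially)
  define g where "g = (\<lambda>z. clamp_disc (real (Suc n)) (f z))"
  have g: "(\<lambda>\<theta>. g (cis \<theta>)) \<in> borel_measurable circ_meas" using clm[of "real (Suc n)"] by (simp add: g_def)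
  \<comment> \<open>The quasi-triangle inequality is applied twice and costs a factor K each time,
    so the two inner errors must be at most e/(4 K^2) and the outer one e/(2 K).\<close>
  obtain h where h: "continuous_on (sphere 0 1) h" "p_moment p (\<lambda>z. g z - h z) < e / (4*K*K)"
    by (rule continuous_dense_bounded[OF g, where M = "real (Suc n)" and p = p and e = "e / (4*K*K)"])
      (use p e K norm_clamp_disc in \<open>auto simp: g_def simp del: of_nat_Suc\<close>)
  \<comment> \<open>A uniform error d has p-th moment at most 2\<pi> d^p, which equals e/(4 K^2) for
    this d.\<close>
  define d where "d = (e / (8*pi*K*K)) powr (1/p)"
  have d: "d > 0" using e K by (simp add: d_def)
  have dp: "d powr p = e / (8*pi*K*K)" using e K p by (simp add: d_def powr_powr)
  obtain t where t: "trig_poly t" "\<And>z. norm z = 1 \<Longrightarrow> norm (h z - t z) < d"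
    using trig_poly_uniform_approx[OF h(1) d] by blast
  have tc: "continuous_on (sphere 0 1) t" using t(1) by (rule continuous_on_trig_poly)
  have Lph: "Lp p h" and Lpt: "Lp p t" using h(1) tc p Lp_continuous by auto
  have Lpg: "Lp p g"
  proof (rule Lp_dominated[OF Lp_continuous[OF continuous_on_const[of _ 1] p] g p])
    show "AE \<theta> in circ_meas. norm (g (cis \<theta>)) \<le> real (Suc n) * norm (1::complex)"
      using norm_clamp_disc[of "real (Suc n)"] by (simp add: g_def del: of_nat_Suc)
  qed
  have "p_moment p (\<lambda>z. h z - t z) \<le> p_moment p (\<lambda>z. of_real d)"
    using p d t(2) by (intro p_moment_mono Lp_diff Lph Lpt Lp_continuous) (auto intro!: less_imp_le)
  also have "\<dots> = 2 * pi * d powr p"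
    using d by (simp add: p_moment_def)
  finally have ht: "p_moment p (\<lambda>z. h z - t z) \<le> e / (4*K*K)"
    using dp by simp
  have "p_moment p (\<lambda>z. (g z - h z) + (h z - t z)) \<le> K * (p_moment p (\<lambda>z. g z - h z) + p_moment p (\<lambda>z. h z - t z))"
    unfolding K_def by (intro p_moment_add Lp_diff Lpg Lph Lpt p)
  also have "\<dots> < K * (e / (4*K*K) + e / (4*K*K))"
    using h(2) ht K by (intro mult_strict_left_mono add_less_le_mono)
  also have "\<dots> = e / (2*K)" using K by (simp add: field_simps)
  finally have gt: "p_moment p (\<lambda>z. g z - t z) < e / (2*K)" by simp
  have "p_moment p (\<lambda>z. (f z - g z) + (g z - t z)) \<le> K * (p_moment p (\<lambda>z. f z - g z) + p_moment p (\<lambda>z. g z - t z))"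
    unfolding K_def by (intro p_moment_add Lp_diff Lpg f Lpt p)
  also have "\<dots> < K * (e / (2*K) + e / (2*K))"
    using n gt K unfolding g_def by (intro mult_strict_left_mono add_strict_mono)
  also have "\<dots> = e" using K by (simp add: field_simps)
  finally have "p_moment p (\<lambda>z. f z - t z) < e" by simp
  then show ?thesis using that t(1) by blast
qed

section \<open>Uniqueness theorem for Fourier coefficients\<close>

lemma fourier_coeff_shift_cnj: "fourier_coeff (\<lambda>z. cnj z * f z) n = fourier_coeff f (n + 1)"
proof -
  have "fourier_coeff f (n + 1) = fourier_coeff (\<lambda>z. z * (cnj z * f z)) (n + 1)"
    by (rule fourier_coeff_cong) (simp add: norm_1_cnj_mult flip: mult.assoc)
  then show ?thesis by (simp add: fourier_coeff_shift)
qed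

lemma integrable_continuous_mult:
  fixes f m :: "complex \<Rightarrow> complex"
  assumes "integrable circ_meas (\<lambda>\<theta>. f (cis \<theta>))" "continuous_on (sphere 0 1) m"
  shows "integrable circ_meas (\<lambda>\<theta>. m (cis \<theta>) * f (cis \<theta>))"
proof -
  have "Lp 1 f" using assms(1) by (simp add: Lp_def)
  then have "Lp 1 (\<lambda>z. m z * f z)" by (intro Lp_continuous_mult assms) auto
  then show ?thesis using Lp_integrable by fastforce
qed

text \<open>Induction with \<open>f\<close> arbitrary: the factor z split off by
  \<open>pCons\<close> is moved onto \<open>f\<close>, where it merely shifts the vanishing
  coefficients.\<close>

lemma integral_mult_poly_eq_0:
  assumes "integrable circ_meas (\<lambda>\<theta>. f (cis \<theta>))" "\<And>n. fourier_coeff f n = 0"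
  shows "(\<integral>\<theta>. poly A (cis \<theta>) * f (cis \<theta>) \<partial>circ_meas) = 0"
  using assms
proof (induction A arbitrary: f)
  case 0
  then show ?case by simp
next
  case (pCons a A)
  have 1: "integrable circ_meas (\<lambda>\<theta>. cis \<theta> * f (cis \<theta>))"
    using pCons.prems(1) integrable_continuous_mult[of f "\<lambda>z. z"] by auto
  have 2: "(\<integral>\<theta>. poly A (cis \<theta>) * (cis \<theta> * f (cis \<theta>)) \<partial>circ_meas) = 0"
    by (rule pCons.IH[where f = "\<lambda>z. z * f z"]) (use 1 pCons.prems(2) in \<open>auto simp: fourier_coeff_shift\<close>)
  have 3: "integrable circ_meas (\<lambda>\<theta>. poly A (cis \<theta>) * (cis \<theta> * f (cis \<theta>)))"
    using integrable_continuous_mult[of "\<lambda>z. z * f z" "poly A"] 1 by (auto intro!: continuous_intros)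
  have "(\<integral>\<theta>. f (cis \<theta>) \<partial>circ_meas) = 0"
    using pCons.prems(2)[of 0] by (simp add: fourier_coeff_def)
  then have "(\<integral>\<theta>. a * f (cis \<theta>) + poly A (cis \<theta>) * (cis \<theta> * f (cis \<theta>)) \<partial>circ_meas) = 0"
    using 2 3 pCons.prems(1) by simp
  then show ?case by (simp add: algebra_simps)
qed

lemma integral_mult_cnj_poly_eq_0:
  assumes "integrable circ_meas (\<lambda>\<theta>. f (cis \<theta>))" "\<And>n. fourier_coeff f n = 0"
  shows "(\<integral>\<theta>. cnj (poly A (cis \<theta>)) * f (cis \<theta>) \<partial>circ_meas) = 0"
  using assms
proof (induction A arbitrary: f)
  case 0
  then show ?case by simp
next
  case (pCons a A)
  have 1: "integrable circ_meas (\<lambda>\<theta>. cnj (cis \<theta>) * f (cis \<theta>))"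
    using integrable_continuous_mult[OF pCons.prems(1), of cnj] by (auto intro!: continuous_intros)
  have 2: "(\<integral>\<theta>. cnj (poly A (cis \<theta>)) * (cnj (cis \<theta>) * f (cis \<theta>)) \<partial>circ_meas) = 0"
    by (rule pCons.IH[where f = "\<lambda>z. cnj z * f z"])
      (use 1 pCons.prems(2) in \<open>auto simp: fourier_coeff_shift_cnj\<close>)
  have 3: "integrable circ_meas (\<lambda>\<theta>. cnj (poly A (cis \<theta>)) * (cnj (cis \<theta>) * f (cis \<theta>)))"
    using integrable_continuous_mult[of "\<lambda>z. cnj z * f z" "\<lambda>z. cnj (poly A z)"] 1
    by (auto intro!: continuous_intros)
  have "(\<integral>\<theta>. f (cis \<theta>) \<partial>circ_meas) = 0"
    using pCons.prems(2)[of 0] by (simp add: fourier_coeff_def)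
  then have "(\<integral>\<theta>. cnj a * f (cis \<theta>) + cnj (poly A (cis \<theta>)) * (cnj (cis \<theta>) * f (cis \<theta>)) \<partial>circ_meas) = 0"
    using 2 3 pCons.prems(1) by simp
  then show ?case by (simp add: algebra_simps)
qed

lemma integral_mult_trig_poly_eq_0:
  assumes "integrable circ_meas (\<lambda>\<theta>. f (cis \<theta>))" "\<And>n. fourier_coeff f n = 0" "trig_poly t"
  shows "(\<integral>\<theta>. t (cis \<theta>) * f (cis \<theta>) \<partial>circ_meas) = 0"
proof -
  obtain A B where AB: "\<And>z. norm z = 1 \<Longrightarrow> t z = poly A z + cnj (poly B z)"
    using assms(3) unfolding trig_poly_def by blast
  have "integrable circ_meas (\<lambda>\<theta>. poly A (cis \<theta>) * f (cis \<theta>))"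
    "integrable circ_meas (\<lambda>\<theta>. cnj (poly B (cis \<theta>)) * f (cis \<theta>))"
    using integrable_continuous_mult[OF assms(1), of "poly A"]
      integrable_continuous_mult[OF assms(1), of "\<lambda>z. cnj (poly B z)"] by (auto intro!: continuous_intros)
  then show ?thesis
    using integral_mult_poly_eq_0[OF assms(1,2), of A] integral_mult_cnj_poly_eq_0[OF assms(1,2), of B]
    by (simp add: AB distrib_right)
qed

text \<open>Used in place of Hoelder's inequality: Young's inequality for s f and g/s. The free
  weight s makes one of the two terms small at the expense of the other.\<close>

lemma Young_integral:
  assumes "Lp p f" "Lp q g" "1 < p" "1 < q" "1/p + 1/q = 1" "0 < s"
  shows "integrable circ_meas (\<lambda>\<theta>. f (cis \<theta>) * g (cis \<theta>))"
    and "(\<integral>\<theta>. norm (f (cis \<theta>) * g (cis \<theta>)) \<partial>circ_meas) \<le> s powr p * p_moment p f + s powr (- q) * p_moment q g"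
proof -
  have [measurable]: "(\<lambda>\<theta>. f (cis \<theta>)) \<in> borel_measurable circ_meas"
    "(\<lambda>\<theta>. g (cis \<theta>)) \<in> borel_measurable circ_meas"
    using assms by (auto simp: Lp_def)
  have bound: "norm (f z * g z) \<le> s powr p * norm (f z) powr p + s powr (- q) * norm (g z) powr q" for z
  proof -
    have "norm (f z * g z) = (s * norm (f z)) * (norm (g z) / s)"
      using assms by (simp add: norm_mult)
    also have "\<dots> \<le> (s * norm (f z)) powr p + (norm (g z) / s) powr q"
      using assms by (intro mult_le_powr_add_powr) auto
    also have "\<dots> = s powr p * norm (f z) powr p + s powr (- q) * norm (g z) powr q"
      using assms by (simp add: powr_mult powr_divide powr_minus_divide)
    finally show ?thesis .
  qed
  have int: "integrable circ_meas (\<lambda>\<theta>. s powr p * norm (f (cis \<theta>)) powr p + s powr (- q) * norm (g (cis \<theta>)) powr q)"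
    using assms by (auto simp: Lp_def)
  show *: "integrable circ_meas (\<lambda>\<theta>. f (cis \<theta>) * g (cis \<theta>))"
  proof (rule Bochner_Integration.integrable_bound[OF int])
    show "AE \<theta> in circ_meas. norm (f (cis \<theta>) * g (cis \<theta>))
      \<le> norm (s powr p * norm (f (cis \<theta>)) powr p + s powr (- q) * norm (g (cis \<theta>)) powr q)"
      using bound by (intro AE_I2) (metis abs_ge_self order_trans real_norm_def)
  qed measurable
  have "(\<integral>\<theta>. norm (f (cis \<theta>) * g (cis \<theta>)) \<partial>circ_meas) \<le>
    (\<integral>\<theta>. s powr p * norm (f (cis \<theta>)) powr p + s powr (- q) * norm (g (cis \<theta>)) powr q \<partial>circ_meas)"
    using * int bound by (intro integral_mono) auto
  also have "\<dots> = s powr p * p_moment p f + s powr (- q) * p_moment q g"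
    unfolding p_moment_def using assms by (simp add: Lp_def)
  finally show "(\<integral>\<theta>. norm (f (cis \<theta>) * g (cis \<theta>)) \<partial>circ_meas) \<le> s powr p * p_moment p f + s powr (- q) * p_moment q g" .
qed

lemma conjugate_exponent:
  fixes p :: real assumes "1 < p"
  obtains q where "1 < q" "1/p + 1/q = 1"
  by (rule that[of "p / (p - 1)"]) (use assms in \<open>auto simp: field_simps\<close>)

text \<open>\<open>f\<close> is tested against cnj (sgn f), which turns the pairing into the
  integral of |f|. This bounded function is a limit in L^q of trigonometric polynomials, all
  orthogonal to \<open>f\<close>.\<close>

lemma fourier_coeff_unique_0:
  assumes f: "Lp p f" and p: "1 < p" and 0: "\<And>n. fourier_coeff f n = 0"
  shows "circ_ae_eq f (\<lambda>_. 0)"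
proof -
  obtain q where q: "1 < q" "1/p + 1/q = 1" using conjugate_exponent[OF p] .
  have int: "integrable circ_meas (\<lambda>\<theta>. f (cis \<theta>))" using Lp_integrable[OF f] p by simp
  have [measurable]: "(\<lambda>\<theta>. f (cis \<theta>)) \<in> borel_measurable circ_meas" using f by (simp add: Lp_def)
  define g where "g = (\<lambda>z. cnj (sgn (f z)))"
  have gf: "g z * f z = of_real (norm (f z))" for z
  proof -
    have "cnj (f z) * f z = of_real (norm (f z)) * of_real (norm (f z))"
      by (metis complex_norm_square mult.commute of_real_mult power2_eq_square)
    then show ?thesis by (cases "f z = 0") (auto simp: g_def sgn_div_norm scaleR_conv_of_real divide_simps)
  qed
  have gm: "(\<lambda>\<theta>. g (cis \<theta>)) \<in> borel_measurable circ_meas"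
  proof -
    have [measurable]: "cnj \<in> borel_measurable borel"
      by (intro borel_measurable_continuous_onI continuous_intros)
    show ?thesis unfolding g_def sgn_div_norm by measurable
  qed
  have g: "Lp q g"
  proof (rule Lp_dominated[OF Lp_continuous[OF continuous_on_const[of _ 1]] gm])
    show "AE \<theta> in circ_meas. norm (g (cis \<theta>)) \<le> 1 * norm (1::complex)"
      by (auto simp: g_def norm_sgn)
  qed (use q in auto)
  have "(\<integral>\<theta>. norm (f (cis \<theta>)) \<partial>circ_meas) \<le> 0 + e" if e: "e > 0" for e
  proof -
    \<comment> \<open>The weight is fixed first so that the term with f contributes at most e/2; the
      accuracy of t is then adapted to s. The summand 1 avoids division by 0.\<close>
    define s where "s = (e / (2 * (p_moment p f + 1))) powr (1/p)"
    have pm: "p_moment p f + 1 > 0" using p_moment_nonneg[of p f] by simp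
    have s: "s > 0" using e pm by (simp add: s_def)
    have "s powr p = e / (2 * (p_moment p f + 1))" using e pm p by (simp add: s_def powr_powr)
    moreover have "e / (2 * (p_moment p f + 1)) * p_moment p f \<le> e / 2"
      using pm e by (simp add: field_simps)
    ultimately have s1: "s powr p * p_moment p f \<le> e/2" by simp
    obtain t where t: "trig_poly t" "p_moment q (\<lambda>z. g z - t z) < e / 2 * s powr q"
      using trig_poly_dense[OF g, of "e / 2 * s powr q"] q e s by auto
    have Lpt: "Lp q t" using Lp_continuous[OF continuous_on_trig_poly[OF t(1)]] q by auto
    have "(\<integral>\<theta>. norm (f (cis \<theta>)) \<partial>circ_meas) = norm (\<integral>\<theta>. complex_of_real (norm (f (cis \<theta>))) \<partial>circ_meas)"
      by (simp add: integral_nonneg)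
    also have "(\<integral>\<theta>. complex_of_real (norm (f (cis \<theta>))) \<partial>circ_meas)
        = (\<integral>\<theta>. f (cis \<theta>) * (g (cis \<theta>) - t (cis \<theta>)) + t (cis \<theta>) * f (cis \<theta>) \<partial>circ_meas)"
      by (intro Bochner_Integration.integral_cong) (auto simp: algebra_simps gf[symmetric])
    also have "\<dots> = (\<integral>\<theta>. f (cis \<theta>) * (g (cis \<theta>) - t (cis \<theta>)) \<partial>circ_meas)"
      using integral_mult_trig_poly_eq_0[OF int 0 t(1)]
        integrable_continuous_mult[OF int continuous_on_trig_poly[OF t(1)]]
        Young_integral(1)[OF f Lp_diff[OF g Lpt] p q s] q by simp
    also have "norm \<dots> \<le> (\<integral>\<theta>. norm (f (cis \<theta>) * (g (cis \<theta>) - t (cis \<theta>))) \<partial>circ_meas)"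
      by (rule integral_norm_bound)
    also have "\<dots> \<le> s powr p * p_moment p f + s powr (- q) * p_moment q (\<lambda>z. g z - t z)"
      using Young_integral(2)[OF f Lp_diff[OF g Lpt] p q s] q by simp
    also have "\<dots> \<le> e/2 + s powr (- q) * (e / 2 * s powr q)"
      using s1 t(2) by (intro add_mono mult_left_mono) auto
    also have "\<dots> = e" using s by (simp add: powr_minus field_simps)
    finally show ?thesis by simp
  qed
  then have "(\<integral>\<theta>. norm (f (cis \<theta>)) \<partial>circ_meas) \<le> 0"
    by (rule field_le_epsilon)
  then have "(\<integral>\<theta>. norm (f (cis \<theta>)) \<partial>circ_meas) = 0"
    by (intro antisym Bochner_Integration.integral_nonneg) auto
  then show ?thesis using circ_integral_0_iff[OF int] by simp
qed

section \<open>The theorem of M. Riesz\<close>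

lemma circ_mean_value:
  fixes f :: "complex \<Rightarrow> complex"
  assumes cont: "continuous_on (cball 0 1) f" and hol: "f holomorphic_on ball 0 1"
  shows "(\<integral>\<theta>. f (cis \<theta>) \<partial>circ_meas) = 2 * pi * f 0"
proof -
  have "((\<lambda>u. f u / (u - 0)) has_contour_integral (2 * of_real pi * \<i> * f 0)) (circlepath 0 1)"
    by (rule Cauchy_integral_circlepath[OF cont hol]) auto
  then have "((\<lambda>t. f (cis t) / cis t * \<i> * cis t) has_integral (2 * of_real pi * \<i> * f 0)) {0..2*pi}"
    unfolding circlepath_def by (subst (asm) has_contour_integral_part_circlepath_iff) auto
  then have "((\<lambda>t. \<i> * f (cis t)) has_integral (\<i> * (2 * of_real pi * f 0))) {0..2*pi}"
    by (simp add: mult_ac)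
  from has_integral_mult_right[OF this, of "- \<i>"]
  have "((\<lambda>t. f (cis t)) has_integral (2 * of_real pi * f 0)) {0..2*pi}"
    by (simp flip: mult.assoc)
  moreover have "continuous_on {0..2*pi} (\<lambda>\<theta>. f (cis \<theta>))"
    by (intro continuous_on_compose2[OF cont]) (auto intro!: continuous_intros)
  then have "integrable (lebesgue_on {0..2*pi}) (\<lambda>\<theta>. f (cis \<theta>))"
    by (rule continuous_imp_integrable_real)
  ultimately show ?thesis
    unfolding circ_meas_def by (subst lebesgue_integral_eq_integral) (auto simp: integral_unique)
qed

lemma integral_poly_circ: "(\<integral>\<theta>. poly A (cis \<theta>) \<partial>circ_meas) = 2 * pi * poly A 0"
  by (rule circ_mean_value) (auto intro!: continuous_intros holomorphic_intros)

lemma integral_cnj_poly_circ: "(\<integral>\<theta>. cnj (poly A (cis \<theta>)) \<partial>circ_meas) = 2 * pi * cnj (poly A 0)"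
  using integral_poly_circ[of A] by (simp add: Bochner_Integration.integral_cnj)

text \<open>For n < 0 the character is the analytic monomial z^(-n), so the integrand is a
  polynomial vanishing at 0, and its mean is 0.\<close>

lemma fourier_coeff_poly_neg:
  assumes "n < 0"
  shows "fourier_coeff (poly A) n = 0"
proof -
  define m where "m = nat (- n)"
  have m: "n = - int m" "m > 0" using assms by (auto simp: m_def)
  have "poly A (cis \<theta>) * cis (- (of_int n * \<theta>)) = poly (monom 1 m * A) (cis \<theta>)" for \<theta>
    by (simp add: m poly_monom Complex.DeMoivre)
  then have "(\<integral>\<theta>. poly A (cis \<theta>) * cis (- (of_int n * \<theta>)) \<partial>circ_meas) = 2 * pi * poly (monom 1 m * A) 0"
    using integral_poly_circ[of "monom 1 m * A"] by presburger
  then show ?thesis using m by (simp add: fourier_coeff_def poly_monom)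
qed

lemma fourier_coeff_cnj_poly_nonneg:
  assumes "0 \<le> n" "poly A 0 = 0"
  shows "fourier_coeff (\<lambda>z. cnj (poly A z)) n = 0"
proof -
  define m where "m = nat n"
  have m: "n = int m" using assms by (auto simp: m_def)
  have "cnj (poly A (cis \<theta>)) * cis (- (of_int n * \<theta>)) = cnj (poly (monom 1 m * A) (cis \<theta>))" for \<theta>
    by (simp add: m poly_monom Complex.DeMoivre cis_cnj)
  then have "(\<integral>\<theta>. cnj (poly A (cis \<theta>)) * cis (- (of_int n * \<theta>)) \<partial>circ_meas) = 2 * pi * cnj (poly (monom 1 m * A) 0)"
    using integral_cnj_poly_circ[of "monom 1 m * A"] by presburger
  then show ?thesis using assms by (simp add: fourier_coeff_def)
qed

text \<open>This works because \<open>cos (p \<pi>/2) < 0\<close> for \<open>1 < p \<le> 2\<close>.\<close>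

lemma cos_powr_bound:
  fixes p :: real
  assumes "1 < p" "p \<le> 2"
  obtains A B where "0 \<le> A" "0 \<le> B" "\<And>x. \<bar>x\<bar> < pi/2 \<Longrightarrow> 1 \<le> A * cos x powr p - B * cos (p * x)"
proof -
  define c where "c = - cos (p * (pi/2))"
  have "cos (p * (pi/2)) < 0"
  proof -
    have "cos (pi - p * (pi/2)) > 0"
    proof (rule cos_gt_zero_pi)
      have "p * (pi/2) \<le> 2 * (pi/2)" using assms by (intro mult_right_mono) auto
      then show "- (pi/2) < pi - p * (pi/2)" using pi_gt_zero by linarith
      have "1 * (pi/2) < p * (pi/2)" using assms by (intro mult_strict_right_mono) auto
      then show "pi - p * (pi/2) < pi/2" by linarith
    qed
    then show ?thesis by (simp add: cos_diff)
  qed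
  then have c: "c > 0" by (simp add: c_def)
  have "isCont (\<lambda>x. cos (p * x)) (pi/2)" by (intro continuous_intros)
  then obtain d where d: "d > 0" "\<And>x. dist x (pi/2) < d \<Longrightarrow> dist (cos (p * x)) (cos (p * (pi/2))) < c/2"
    using c unfolding continuous_at_eps_delta by (metis half_gt_zero)
  define e where "e = min d (pi/2)"
  have e: "0 < e" "e \<le> d" "e \<le> pi/2" using d by (auto simp: e_def)
  define s where "s = sin e"
  have s: "s > 0" unfolding s_def by (rule sin_gt_zero) (use e in auto)
  \<comment> \<open>Near \<plusminus>\<pi>/2 one has cos (p x) < -c/2, so this B alone gives the
    value 1. On the remaining interval cos x \<ge> s, and A is large enough there to outweigh B as
    well.\<close>
  define B where "B = 2 / c"
  define A where "A = (1 + B) / s powr p"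
  have B: "B > 0" using c by (simp add: B_def)
  have A: "A > 0" using B s by (simp add: A_def)
  show ?thesis
  proof (rule that[of A B])
    fix x :: real assume x: "\<bar>x\<bar> < pi/2"
    have cosabs: "cos (p * \<bar>x\<bar>) = cos (p * x)" "cos \<bar>x\<bar> = cos x"
      by (auto simp: abs_if)
    show "1 \<le> A * cos x powr p - B * cos (p * x)"
    proof (cases "\<bar>x\<bar> > pi/2 - e")
      case True
      then have "dist (cos (p * \<bar>x\<bar>)) (cos (p * (pi/2))) < c/2"
        using x e by (intro d) (auto simp: dist_real_def)
      then have "cos (p * x) < - c/2" unfolding cosabs c_def dist_real_def by linarith
      then have "B * cos (p * x) \<le> B * (- c/2)" using B by (intro mult_left_mono) auto
      also have "\<dots> = -1" using c by (simp add: B_def)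
      finally have "B * cos (p * x) \<le> - 1" .
      moreover have "0 \<le> A * cos x powr p" using A by simp
      ultimately show ?thesis by linarith
    next
      case False
      have "s = cos (pi/2 - e)" by (simp add: s_def cos_diff)
      also have "\<dots> \<le> cos \<bar>x\<bar>" using False x e by (intro cos_monotone_0_pi_le) auto
      finally have "s \<le> cos x" by (simp add: cosabs)
      then have "s powr p \<le> cos x powr p" using s assms by (intro powr_mono2) auto
      then have "A * s powr p \<le> A * cos x powr p" using A by simp
      then have "1 + B \<le> A * cos x powr p" using s by (simp add: A_def)
      moreover have "B * cos (p * x) \<le> B" using B by (simp add: mult_left_le)
      ultimately show ?thesis by linarith
    qed
  qed (use A B in auto)
qed

text \<open>All terms are homogeneous of degree p in |w|, so only the argument of w matters, and it
  lies in (-\<pi>/2, \<pi>/2).\<close>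

lemma norm_powr_le_Re_powr:
  fixes p :: real
  assumes "1 < p" "p \<le> 2"
  obtains A B where "0 \<le> A" "0 \<le> B"
    "\<And>w. 0 < Re w \<Longrightarrow> norm w powr p \<le> A * Re w powr p - B * Re (w powr of_real p)"
proof -
  obtain A B where AB: "0 \<le> A" "0 \<le> B" "\<And>x. \<bar>x\<bar> < pi/2 \<Longrightarrow> 1 \<le> A * cos x powr p - B * cos (p * x)"
    using cos_powr_bound[OF assms] by blast
  show ?thesis
  proof (rule that[OF AB(1,2)])
    fix w assume w: "0 < Re w"
    then have w0: "w \<noteq> 0" by auto
    define x where "x = Im (Ln w)"
    define r where "r = norm w"
    have r: "r > 0" using w0 by (simp add: r_def)
    have x: "\<bar>x\<bar> < pi/2" using Re_Ln_pos_lt[OF w0] w by (simp add: x_def)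
    have "Re (exp (Ln w)) = exp (Re (Ln w)) * cos x"
      unfolding x_def by (rule Re_exp)
    then have Re: "Re w = r * cos x" using w0 by (simp add: r_def)
    have cx: "cos x > 0" using x by (intro cos_gt_zero_pi) auto
    have "Re (w powr of_real p) = exp (p * ln r) * cos (p * x)"
      using w0 by (simp add: powr_def Re_exp r_def x_def)
    also have "exp (p * ln r) = r powr p" using r by (simp add: powr_def)
    finally have Rp: "Re (w powr of_real p) = r powr p * cos (p * x)" .
    have "r powr p * 1 \<le> r powr p * (A * cos x powr p - B * cos (p * x))"
      using AB(3)[OF x] by (intro mult_left_mono) auto
    also have "\<dots> = A * Re w powr p - B * Re (w powr of_real p)"
      unfolding Re Rp using r cx by (simp add: powr_mult algebra_simps)
    finally show "norm w powr p \<le> A * Re w powr p - B * Re (w powr of_real p)" by (simp add: r_def)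
  qed
qed

text \<open>Minimum principle for the harmonic function Re G. It keeps G off the branch cut, so that
  G^p is holomorphic on the whole disc.\<close>

lemma Re_pos_on_disc:
  assumes "\<And>z. norm z = 1 \<Longrightarrow> 0 < Re (poly G z)" "norm z \<le> 1"
  shows "0 < Re (poly G z)"
proof -
  have cont: "continuous_on (sphere 0 1) (\<lambda>z. Re (poly G z))" by (intro continuous_intros)
  obtain x where x: "x \<in> sphere (0::complex) 1" "\<forall>y\<in>sphere 0 1. Re (poly G x) \<le> Re (poly G y)"
    using continuous_attains_inf[OF compact_sphere _ cont] by auto
  have "Re (- poly G z) \<le> - Re (poly G x)"
  proof (rule maximum_real_frontier[where S = "cball 0 1" and f = "\<lambda>z. - poly G z"])
    show "(\<lambda>z. - poly G z) holomorphic_on interior (cball 0 1)" by (intro holomorphic_intros)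
    show "continuous_on (closure (cball 0 1)) (\<lambda>z. - poly G z)" by (intro continuous_intros)
    show "Re (- poly G y) \<le> - Re (poly G x)" if "y \<in> frontier (cball 0 1)" for y
      using x(2) that by (simp add: frontier_cball)
  qed (use assms in auto)
  moreover have "Re (poly G x) > 0" using x(1) assms(1) by simp
  ultimately show ?thesis by simp
qed

lemma Lp_poly: "0 < p \<Longrightarrow> Lp p (poly A)"
  by (intro Lp_continuous continuous_intros)

lemma Lp_Re_poly: "0 < p \<Longrightarrow> Lp p (\<lambda>z. of_real (Re (poly A z)))"
  by (intro Lp_continuous continuous_intros)

lemma Riesz_positive:
  fixes p :: real
  assumes "1 < p" "p \<le> 2"
  obtains C where "0 \<le> C" "\<And>G. (\<And>z. norm z = 1 \<Longrightarrow> 0 < Re (poly G z)) \<Longrightarrow> Im (poly G 0) = 0 \<Longrightarrow>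
    p_moment p (poly G) \<le> C * p_moment p (\<lambda>z. of_real (Re (poly G z)))"
proof -
  obtain A B where AB: "0 \<le> A" "0 \<le> B"
    "\<And>w. 0 < Re w \<Longrightarrow> norm w powr p \<le> A * Re w powr p - B * Re (w powr of_real p)"
    using norm_powr_le_Re_powr[OF assms] by blast
  show ?thesis
  proof (rule that[OF AB(1)])
    fix G :: "complex poly"
    assume G: "\<And>z. norm z = 1 \<Longrightarrow> 0 < Re (poly G z)" and G0: "Im (poly G 0) = 0"
    have pos: "0 < Re (poly G z)" if "norm z \<le> 1" for z
      using Re_pos_on_disc[OF G that] .
    have nn: "poly G z \<notin> \<real>\<^sub>\<le>\<^sub>0" if "norm z \<le> 1" for z
      using pos[OF that] by (auto simp: complex_nonpos_Reals_iff)
    define F where "F = (\<lambda>z. poly G z powr of_real p)"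
    have hol: "F holomorphic_on ball 0 1"
      unfolding F_def by (intro holomorphic_intros) (use nn in auto)
    have "isCont F z" if "norm z \<le> 1" for z
      unfolding F_def using nn[OF that]
      by (intro isCont_powr_complex continuous_intros) auto
    then have cont: "continuous_on (cball 0 1) F"
      by (intro continuous_at_imp_continuous_on) auto
    have "poly G 0 = of_real (Re (poly G 0))" using G0 by (simp add: complex_eq_iff)
    then have "F 0 = of_real (Re (poly G 0) powr p)"
      unfolding F_def using pos[of 0] by (metis norm_zero powr_of_real less_imp_le zero_le_one)
    then have Re0: "0 \<le> Re (F 0)" by simp
    have cont': "continuous_on (sphere 0 1) F" by (rule continuous_on_subset[OF cont]) auto
    have int: "integrable circ_meas (\<lambda>\<theta>. F (cis \<theta>))"
      using Lp_integrable[OF Lp_continuous[OF cont', of 1]] by simp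
    have "(\<integral>\<theta>. Re (F (cis \<theta>)) \<partial>circ_meas) = Re (\<integral>\<theta>. F (cis \<theta>) \<partial>circ_meas)"
      using int by simp
    also have "\<dots> = 2 * pi * Re (F 0)"
      unfolding circ_mean_value[OF cont hol] by simp
    finally have mean: "(\<integral>\<theta>. Re (F (cis \<theta>)) \<partial>circ_meas) \<ge> 0" using Re0 by simp
    have i1: "integrable circ_meas (\<lambda>\<theta>. norm (poly G (cis \<theta>)) powr p)"
      using Lp_poly[of p G] assms by (simp add: Lp_def)
    have i2: "integrable circ_meas (\<lambda>\<theta>. norm (complex_of_real (Re (poly G (cis \<theta>)))) powr p)"
      using Lp_Re_poly[of p G] assms unfolding Lp_def by auto
    have "p_moment p (poly G) \<le>
      (\<integral>\<theta>. A * norm (complex_of_real (Re (poly G (cis \<theta>)))) powr p - B * Re (F (cis \<theta>)) \<partial>circ_meas)"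
      unfolding p_moment_def
    proof (rule integral_mono[OF i1])
      show "integrable circ_meas (\<lambda>\<theta>. A * norm (complex_of_real (Re (poly G (cis \<theta>)))) powr p - B * Re (F (cis \<theta>)))"
        using i2 int by simp
      show "norm (poly G (cis \<theta>)) powr p \<le>
        A * norm (complex_of_real (Re (poly G (cis \<theta>)))) powr p - B * Re (F (cis \<theta>))" for \<theta>
        using AB(3)[of "poly G (cis \<theta>)"] G[of "cis \<theta>"] by (simp add: F_def abs_of_pos)
    qed
    also have "\<dots> = A * p_moment p (\<lambda>z. of_real (Re (poly G z))) - B * (\<integral>\<theta>. Re (F (cis \<theta>)) \<partial>circ_meas)"
      unfolding p_moment_def using i2 int by simp
    also have "\<dots> \<le> A * p_moment p (\<lambda>z. of_real (Re (poly G z)))"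
      using mean AB(2) by simp
    finally show "p_moment p (poly G) \<le> A * p_moment p (\<lambda>z. of_real (Re (poly G z)))" .
  qed
qed

lemma le_if_le_add_powr:
  fixes x y K p :: real
  assumes "0 \<le> K" "0 < p" "\<And>e. 0 < e \<Longrightarrow> x \<le> y + K * e powr p"
  shows "x \<le> y"
proof (rule field_le_epsilon)
  fix d :: real assume d: "0 < d"
  define e where "e = (d / (K + 1)) powr (1/p)"
  have "e > 0" using d assms by (simp add: e_def)
  have "e powr p = d / (K + 1)" using d assms by (simp add: e_def powr_powr)
  moreover have "K * (d / (K + 1)) \<le> d" using assms(1) d by (simp add: field_simps)
  ultimately have "K * e powr p \<le> d" by simp
  with assms(3)[OF \<open>e > 0\<close>] show "x \<le> y + d" by simp
qed

text \<open>On the circle A + cnj B and A + B have the same real part, so a real trigonometric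
  polynomial is the real part of a polynomial. Subtracting an imaginary constant normalises it at
  0.\<close>

lemma Re_poly_uniform_approx:
  fixes u :: "complex \<Rightarrow> real"
  assumes "continuous_on (sphere 0 1) u" "0 < e"
  obtains G where "Im (poly G 0) = 0" "\<And>z. norm z = 1 \<Longrightarrow> \<bar>Re (poly G z) - u z\<bar> < e"
proof -
  have "continuous_on (sphere 0 1) (\<lambda>z. complex_of_real (u z))" using assms(1) by (intro continuous_intros)
  then obtain t where t: "trig_poly t" "\<And>z. norm z = 1 \<Longrightarrow> norm (of_real (u z) - t z) < e"
    using trig_poly_uniform_approx assms(2) by blast
  obtain A B where AB: "\<And>z. norm z = 1 \<Longrightarrow> t z = poly A z + cnj (poly B z)"
    using t(1) unfolding trig_poly_def by blast
  define G where "G = A + B - [:\<i> * of_real (Im (poly (A + B) 0)):]"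
  show ?thesis
  proof (rule that[of G])
    show "Im (poly G 0) = 0" by (simp add: G_def)
    fix z :: complex assume z: "norm z = 1"
    have "Re (poly G z) = Re (t z)" using AB[OF z] by (simp add: G_def)
    then have "\<bar>Re (poly G z) - u z\<bar> = \<bar>Re (of_real (u z) - t z)\<bar>" by simp
    also have "\<dots> \<le> norm (of_real (u z) - t z)" by (rule abs_Re_le_cmod)
    finally show "\<bar>Re (poly G z) - u z\<bar> < e" using t(2)[OF z] by simp
  qed
qed

text \<open>The polynomial is written as a difference of two polynomials with positive real part, one of
  which approximates the positive part of \<open>Re q\<close>.\<close>

lemma Riesz_real_part:
  fixes p :: real
  assumes "1 < p" "p \<le> 2"
  obtains C where "0 \<le> C" "\<And>q. Im (poly q 0) = 0 \<Longrightarrow>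
    p_moment p (poly q) \<le> C * p_moment p (\<lambda>z. of_real (Re (poly q z)))"
proof -
  obtain C where C: "0 \<le> C" "\<And>G. (\<And>z. norm z = 1 \<Longrightarrow> 0 < Re (poly G z)) \<Longrightarrow> Im (poly G 0) = 0 \<Longrightarrow>
    p_moment p (poly G) \<le> C * p_moment p (\<lambda>z. of_real (Re (poly G z)))"
    using Riesz_positive[OF assms] by blast
  have p: "0 < p" using assms by simp
  define T where "T = (2::real) powr p"
  have T: "T > 0" by (simp add: T_def)
  show ?thesis
  proof (rule that[of "T * C * 2 * T"])
    fix q :: "complex poly" assume q0: "Im (poly q 0) = 0"
    define u where "u = (\<lambda>z. Re (poly q z))"
    show "p_moment p (poly q) \<le> T * C * 2 * T * p_moment p (\<lambda>z. of_real (Re (poly q z)))"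
    proof (rule le_if_le_add_powr[where K = "T * C * 2 * T * (2 * pi * 3 powr p)"])
      fix e :: real assume e: "0 < e"
      \<comment> \<open>With approximation error e, the offset 2 e leaves Re G and Re (G - q) at
        least e, while both stay below |u| + 3 e.\<close>
      have "continuous_on (sphere 0 1) (\<lambda>z. max 0 (u z) + 2 * e)"
        unfolding u_def by (intro continuous_intros)
      then obtain G where G: "Im (poly G 0) = 0"
        "\<And>z. norm z = 1 \<Longrightarrow> \<bar>Re (poly G z) - (max 0 (u z) + 2 * e)\<bar> < e"
        using Re_poly_uniform_approx[OF _ e] by blast
      define H where "H = G - q"
      have Gb: "0 < Re (poly G z)" "Re (poly G z) \<le> \<bar>u z\<bar> + 3 * e" if "norm z = 1" for z
        using G(2)[OF that] e by linarith+
      have Hb: "0 < Re (poly H z)" "Re (poly H z) \<le> \<bar>u z\<bar> + 3 * e" if "norm z = 1" for z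
      proof -
        have "Re (poly H z) = Re (poly G z) - u z" by (simp add: H_def u_def)
        then show "0 < Re (poly H z)" "Re (poly H z) \<le> \<bar>u z\<bar> + 3 * e" using G(2)[OF that] e by linarith+
      qed
      have Lpu: "Lp p (\<lambda>z. of_real \<bar>u z\<bar>)" "Lp p (\<lambda>z. of_real (u z))" "Lp p (\<lambda>z. of_real (3 * e))"
        using p unfolding u_def by (auto intro!: Lp_continuous continuous_intros)
      have sum: "p_moment p (\<lambda>z. of_real (\<bar>u z\<bar> + 3 * e)) \<le> T * (p_moment p (\<lambda>z. of_real (u z)) + 2 * pi * 3 powr p * e powr p)"
        (is "?S \<le> _")
      proof -
        have "?S = p_moment p (\<lambda>z. of_real \<bar>u z\<bar> + of_real (3 * e))" by simp
        also have "\<dots> \<le> T * (p_moment p (\<lambda>z. of_real \<bar>u z\<bar>) + p_moment p (\<lambda>z. of_real (3 * e)))"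
          unfolding T_def by (intro p_moment_add Lpu p)
        also have "p_moment p (\<lambda>z. of_real \<bar>u z\<bar>) = p_moment p (\<lambda>z. of_real (u z))"
          by (simp add: p_moment_def)
        also have "p_moment p (\<lambda>z. of_real (3 * e)) = 2 * pi * 3 powr p * e powr p"
          using e by (simp add: p_moment_def powr_mult norm_mult)
        finally show ?thesis .
      qed
      have bound: "p_moment p (\<lambda>z. of_real (Re (poly R z))) \<le> ?S"
        if "\<And>z. norm z = 1 \<Longrightarrow> 0 < Re (poly R z)" "\<And>z. norm z = 1 \<Longrightarrow> Re (poly R z) \<le> \<bar>u z\<bar> + 3 * e" for R
      proof (rule p_moment_mono[OF Lp_Re_poly[OF p] _ p])
        show "Lp p (\<lambda>z. of_real (\<bar>u z\<bar> + 3 * e))"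
          using Lp_add[OF Lpu(1,3) p] by simp
        show "AE \<theta> in circ_meas. norm (complex_of_real (Re (poly R (cis \<theta>)))) \<le> norm (complex_of_real (\<bar>u (cis \<theta>)\<bar> + 3 * e))"
        proof (rule AE_I2)
          fix \<theta> show "norm (complex_of_real (Re (poly R (cis \<theta>)))) \<le> norm (complex_of_real (\<bar>u (cis \<theta>)\<bar> + 3 * e))"
            using that(1)[of "cis \<theta>"] that(2)[of "cis \<theta>"] e unfolding norm_of_real by simp
        qed
      qed
      have "p_moment p (poly q) = p_moment p (\<lambda>z. poly G z - poly H z)"
        by (simp add: H_def)
      also have "\<dots> \<le> T * (p_moment p (poly G) + p_moment p (poly H))"
        unfolding T_def by (intro p_moment_diff Lp_poly p)
      also have "\<dots> \<le> T * (C * p_moment p (\<lambda>z. of_real (Re (poly G z))) + C * p_moment p (\<lambda>z. of_real (Re (poly H z))))"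
        using T by (intro mult_left_mono add_mono C Gb Hb) (use G(1) q0 in \<open>auto simp: H_def\<close>)
      also have "\<dots> \<le> T * (C * ?S + C * ?S)"
        using T C(1) by (intro mult_left_mono add_mono bound Gb Hb) auto
      also have "\<dots> = T * C * 2 * ?S" by (simp add: algebra_simps)
      also have "\<dots> \<le> T * C * 2 * (T * (p_moment p (\<lambda>z. of_real (u z)) + 2 * pi * 3 powr p * e powr p))"
        using sum T C(1) by (intro mult_left_mono) auto
      also have "\<dots> = T * C * 2 * T * p_moment p (\<lambda>z. of_real (Re (poly q z))) + T * C * 2 * T * (2 * pi * 3 powr p) * e powr p"
        by (simp add: u_def algebra_simps)
      finally show "p_moment p (poly q) \<le> \<dots>" .
    qed (use T C p in auto)
  qed (use T C in auto)
qed

lemma fourier_coeff_powr_le: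
  assumes "Lp p f" "1 \<le> p"
  shows "2 * pi * norm (fourier_coeff f n) powr p \<le> 2 powr p * p_moment p f"
proof (cases "fourier_coeff f n = 0")
  case True
  then show ?thesis by (simp add: p_moment_nonneg)
next
  case False
  \<comment> \<open>With half the coefficient as \<delta> in \<open>fourier_coeff_small\<close>, the
    term 2\<pi> \<delta> is absorbed by one half of the left side.\<close>
  define c where "c = norm (fourier_coeff f n) / 2"
  have c: "c > 0" using False by (simp add: c_def)
  have "2*pi * (2*c) \<le> 2*pi*c + c powr (1 - p) * p_moment p f"
    using fourier_coeff_small[OF assms c, of n] by (simp add: c_def)
  then have "2*pi*c \<le> c powr (1 - p) * p_moment p f" by simp
  then have "2*pi*c * c powr (p - 1) \<le> c powr (1 - p) * p_moment p f * c powr (p - 1)"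
    by (intro mult_right_mono) auto
  also have "\<dots> = (c powr (1 - p) * c powr (p - 1)) * p_moment p f" by (simp only: mult_ac)
  also have "c powr (1 - p) * c powr (p - 1) = 1" using c by (simp flip: powr_add)
  finally have "2*pi * c powr p \<le> p_moment p f"
    using c by (simp add: powr_mult_base mult.assoc)
  moreover have "norm (fourier_coeff f n) powr p = 2 powr p * c powr p"
    using c by (simp add: c_def flip: powr_mult)
  ultimately show ?thesis by (simp add: mult_left_mono mult.left_commute)
qed

text \<open>For f = A + cnj B, the polynomials A + B and i (B - A) have the real parts Re f and Im
  f, and the first plus i times the second is 2 A. The real-part estimate is applied to each of
  them.\<close>

lemma Riesz_trig_le2:
  fixes p :: real
  assumes "1 < p" "p \<le> 2"
  obtains C where "0 \<le> C" "\<And>A B. poly B 0 = 0 \<Longrightarrow>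
    p_moment p (poly A) \<le> C * p_moment p (\<lambda>z. poly A z + cnj (poly B z))"
proof -
  obtain C where C: "0 \<le> C" "\<And>q. Im (poly q 0) = 0 \<Longrightarrow>
    p_moment p (poly q) \<le> C * p_moment p (\<lambda>z. of_real (Re (poly q z)))"
    using Riesz_real_part[OF assms] by blast
  have p: "0 < p" using assms by simp
  define T where "T = (2::real) powr p"
  have T: "T > 0" by (simp add: T_def)
  show ?thesis
  proof (rule that[of "T * (T * (C + T) + T * (C + T))"])
    show "0 \<le> T * (T * (C + T) + T * (C + T))" using T C by auto
    fix A B :: "complex poly" assume B0: "poly B 0 = 0"
    define f where "f = (\<lambda>z. poly A z + cnj (poly B z))"
    have fc: "continuous_on (sphere 0 1) f" unfolding f_def by (intro continuous_intros)
    have Lpf: "Lp p f" by (rule Lp_continuous[OF fc p])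
    have "(\<integral>\<theta>. f (cis \<theta>) \<partial>circ_meas) = 2 * pi * poly A 0"
    proof -
      have "integrable circ_meas (\<lambda>\<theta>. poly A (cis \<theta>))"
        using Lp_integrable[OF Lp_poly[of 1 A]] by simp
      moreover have "integrable circ_meas (\<lambda>\<theta>. cnj (poly B (cis \<theta>)))"
        using Lp_integrable[OF Lp_continuous[of "\<lambda>z. cnj (poly B z)" 1]] by (auto intro!: continuous_intros)
      ultimately show ?thesis
        unfolding f_def using integral_poly_circ[of A] integral_cnj_poly_circ[of B] B0 by simp
    qed
    then have "fourier_coeff f 0 = poly A 0" by (simp add: fourier_coeff_def)
    then have A0: "2 * pi * norm (poly A 0) powr p \<le> T * p_moment p f"
      using fourier_coeff_powr_le[OF Lpf, of 0] assms by (simp add: T_def)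
    have bound: "p_moment p (poly q) \<le> T * (C + T) * p_moment p f"
      if re: "\<And>z. \<bar>Re (poly q z)\<bar> \<le> norm (f z)" and im: "\<bar>Im (poly q 0)\<bar> \<le> norm (poly A 0)" for q
    proof -
      \<comment> \<open>The real-part estimate requires a real value at 0. Removing the imaginary
        constant leaves the real part unchanged, and the constant is bounded by |A(0)|, the modulus
        of the zeroth coefficient of f.\<close>
      define r where "r = q - [:\<i> * of_real (Im (poly q 0)):]"
      have "p_moment p (poly q) = p_moment p (\<lambda>z. poly r z + \<i> * of_real (Im (poly q 0)))"
        by (simp add: r_def)
      also have "\<dots> \<le> T * (p_moment p (poly r) + p_moment p (\<lambda>z. \<i> * of_real (Im (poly q 0))))"
        unfolding T_def by (intro p_moment_add Lp_poly Lp_continuous p continuous_intros)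
      also have "\<dots> \<le> T * (C * p_moment p f + T * p_moment p f)"
      proof (intro mult_left_mono add_mono)
        have "p_moment p (poly r) \<le> C * p_moment p (\<lambda>z. of_real (Re (poly r z)))"
          by (rule C) (simp add: r_def)
        also have "\<dots> \<le> C * p_moment p f"
          using re by (intro mult_left_mono C p_moment_mono Lp_Re_poly Lpf p) (auto simp: r_def)
        finally show "p_moment p (poly r) \<le> C * p_moment p f" .
        have "p_moment p (\<lambda>z. \<i> * of_real (Im (poly q 0))) = 2 * pi * \<bar>Im (poly q 0)\<bar> powr p"
          by (simp add: p_moment_def norm_mult)
        also have "\<dots> \<le> 2 * pi * norm (poly A 0) powr p"
          using im p by (intro mult_left_mono powr_mono2) auto
        finally show "p_moment p (\<lambda>z. \<i> * of_real (Im (poly q 0))) \<le> T * p_moment p f" using A0 by simp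
      qed (use T in auto)
      finally show ?thesis by (simp add: algebra_simps)
    qed
    define q1 where "q1 = A + B"
    define q2 where "q2 = smult \<i> (B - A)"
    have b1: "p_moment p (poly q1) \<le> T * (C + T) * p_moment p f"
    proof (rule bound)
      show "\<bar>Re (poly q1 z)\<bar> \<le> norm (f z)" for z
        using abs_Re_le_cmod[of "f z"] by (simp add: q1_def f_def)
      show "\<bar>Im (poly q1 0)\<bar> \<le> norm (poly A 0)"
        using abs_Im_le_cmod[of "poly A 0"] B0 by (simp add: q1_def)
    qed
    have b2: "p_moment p (poly q2) \<le> T * (C + T) * p_moment p f"
    proof (rule bound)
      show "\<bar>Re (poly q2 z)\<bar> \<le> norm (f z)" for z
        using abs_Im_le_cmod[of "f z"] by (simp add: q2_def f_def abs_minus_commute)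
      show "\<bar>Im (poly q2 0)\<bar> \<le> norm (poly A 0)"
        using abs_Re_le_cmod[of "poly A 0"] B0 by (simp add: q2_def)
    qed
    have "p_moment p (poly A) \<le> p_moment p (\<lambda>z. 2 * poly A z)"
      by (intro p_moment_mono Lp_cmult Lp_poly p) (auto simp: norm_mult)
    also have "(\<lambda>z. 2 * poly A z) = (\<lambda>z. poly q1 z + \<i> * poly q2 z)"
      by (simp add: q1_def q2_def algebra_simps flip: mult.assoc)
    also have "p_moment p \<dots> \<le> T * (p_moment p (poly q1) + p_moment p (\<lambda>z. \<i> * poly q2 z))"
      unfolding T_def by (intro p_moment_add Lp_cmult Lp_poly p)
    also have "p_moment p (\<lambda>z. \<i> * poly q2 z) = p_moment p (poly q2)"
      by (simp add: p_moment_cmult)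
    also have "T * (p_moment p (poly q1) + p_moment p (poly q2)) \<le>
      T * (T * (C + T) * p_moment p f + T * (C + T) * p_moment p f)"
      using T b1 b2 by (intro mult_left_mono add_mono) auto
    finally show "p_moment p (poly A) \<le> T * (T * (C + T) + T * (C + T)) * p_moment p (\<lambda>z. poly A z + cnj (poly B z))"
      by (simp add: f_def algebra_simps)
  qed
qed

lemma le_if_le_add_mult:
  fixes x y K :: real
  assumes "0 \<le> K" "\<And>e. 0 < e \<Longrightarrow> e \<le> 1 \<Longrightarrow> x \<le> y + K * e"
  shows "x \<le> y"
proof (rule field_le_epsilon)
  fix d :: real assume d: "0 < d"
  define e where "e = min 1 (d / (K + 1))"
  have "0 < e" "e \<le> 1" using d assms(1) by (auto simp: e_def)
  then have "x \<le> y + K * e" by (rule assms(2))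
  also have "K * e \<le> K * (d / (K + 1))" using assms(1) by (intro mult_left_mono) (auto simp: e_def)
  also have "\<dots> \<le> d" using assms(1) d by (simp add: field_simps)
  finally show "x \<le> y + d" by simp
qed

text \<open>Duality: \<open>h = P f\<close> is tested against trigonometric approximations of \<open>k = h |h|\<^sup>p\<^sup>-\<^sup>2\<close>. The parameter \<open>s\<close>
  in Young's inequality is chosen so large that the \<open>p\<close>-th moment of \<open>h\<close> reappears with factor \<open>1/2\<close>.\<close>

lemma Riesz_trig_gt2:
  fixes p :: real
  assumes p2: "2 < p"
  obtains C where "0 \<le> C" "\<And>A B. poly B 0 = 0 \<Longrightarrow>
    p_moment p (poly A) \<le> C * p_moment p (\<lambda>z. poly A z + cnj (poly B z))"
proof -
  have p1: "1 < p" using p2 by simp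
  have p: "0 < p" using p2 by simp
  obtain r where r1: "1 < r" and pr: "1/p + 1/r = 1" using conjugate_exponent[OF p1] .
  have pr': "p + r = p * r" using pr p r1 by (simp add: field_simps)
  have r2: "r \<le> 2"
  proof (rule ccontr)
    assume "\<not> r \<le> 2"
    then have "1/r < 1/2" "1/p < 1/2" using p2 by (auto simp: field_simps)
    then show False using pr by simp
  qed
  have r: "0 < r" using r1 by simp
  have pr1: "(p - 1) * r = p" using pr' by (simp add: algebra_simps)
  obtain C where C: "0 \<le> C" "\<And>A B. poly B 0 = 0 \<Longrightarrow>
    p_moment r (poly A) \<le> C * p_moment r (\<lambda>z. poly A z + cnj (poly B z))"
    using Riesz_trig_le2[OF r1 r2] by blast
  define T where "T = (2::real) powr r"
  have T: "T > 0" by (simp add: T_def)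
  define s where "s = (2 * C * T + 1) powr (1/r)"
  have base: "2 * C * T + 1 > 0" using C T by (simp add: add_nonneg_pos)
  have s: "s > 0" using base by (simp add: s_def)
  have "s powr r = 2 * C * T + 1" using base r by (simp add: s_def powr_powr)
  then have sr: "s powr (- r) = 1 / (2 * C * T + 1)" by (simp add: powr_minus_divide)
  have half: "s powr (- r) * C * T \<le> 1/2"
    using base by (simp add: sr field_simps)
  show ?thesis
  proof (rule that[of "2 * s powr p"])
    fix A B :: "complex poly" assume B0: "poly B 0 = 0"
    define f where "f = (\<lambda>z. poly A z + cnj (poly B z))"
    have fc: "continuous_on (sphere 0 1) f" unfolding f_def by (intro continuous_intros)
    have Lpf: "Lp p f" by (rule Lp_continuous[OF fc p])
    define h where "h = poly A"
    have hc: "continuous_on (sphere 0 1) h" unfolding h_def by (intro continuous_intros)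
    \<comment> \<open>Since p > 2 the exponent is positive, so k is continuous even at the zeros of
      h and can be approximated uniformly.\<close>
    define k where "k = (\<lambda>z. h z * of_real (norm (h z) powr (p - 2)))"
    have "continuous_on (sphere 0 1) (\<lambda>z. norm (h z) powr (p - 2))"
      using p2 hc by (intro continuous_on_powr' continuous_intros) auto
    then have kc: "continuous_on (sphere 0 1) k"
      unfolding k_def by (intro continuous_on_mult continuous_on_of_real hc)
    have nk: "norm (k z) = norm (h z) powr (p - 1)" for z
      using powr_mult_base[of "norm (h z)" "p - 2"] by (simp add: k_def norm_mult)
    have nkr: "norm (k z) powr r = norm (h z) powr p" for z
      by (simp add: nk powr_powr pr1)
    have hk: "h z * cnj (k z) = of_real (norm (h z) powr p)" for z
    proof -
      have "h z * cnj (k z) = (h z * cnj (h z)) * of_real (norm (h z) powr (p - 2))"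
        by (simp add: k_def)
      also have "h z * cnj (h z) = of_real (norm (h z) * norm (h z))"
        using complex_norm_square[of "h z"] by (simp add: power2_eq_square)
      also have "of_real (norm (h z) * norm (h z)) * of_real (norm (h z) powr (p - 2)) = complex_of_real (norm (h z) powr p)"
        using powr_mult_base[of "norm (h z)" "p - 2"] powr_mult_base[of "norm (h z)" "p - 1"]
        by (simp only: of_real_mult[symmetric] mult.assoc) simp
      finally show ?thesis .
    qed
    define I where "I = (\<integral>\<theta>. norm (h (cis \<theta>)) \<partial>circ_meas)"
    have I: "I \<ge> 0" by (simp add: I_def)
    have Lph: "Lp 1 h" using Lp_continuous[OF hc, of 1] by simp
    have main: "p_moment p h \<le> s powr p * p_moment p f + 1/2 * p_moment p h"
    proof (rule le_if_le_add_mult[where K = "s powr (- r) * C * T * (2 * pi) + I"])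
      show "0 \<le> s powr (- r) * C * T * (2 * pi) + I" using C T I by simp
      fix e :: real assume e: "0 < e" "e \<le> 1"
      obtain t where t: "trig_poly t" "\<And>z. norm z = 1 \<Longrightarrow> norm (k z - t z) < e"
        using trig_poly_uniform_approx[OF kc e(1)] by blast
      obtain G D where D0: "poly D 0 = 0" and GD: "\<And>z. norm z = 1 \<Longrightarrow> t z = poly G z + cnj (poly D z)"
        using trig_poly_normalE[OF t(1)] by blast
      have tc: "continuous_on (sphere 0 1) t" by (rule continuous_on_trig_poly[OF t(1)])
      have I1: "integrable circ_meas (\<lambda>\<theta>. m (cis \<theta>))" if "continuous_on (sphere 0 1) m" for m :: "complex \<Rightarrow> complex"
        using Lp_integrable[OF Lp_continuous[OF that, of 1]] by simp
      \<comment> \<open>\<open>e1\<close> and \<open>e2\<close> express that the projection is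
        self-adjoint. The analytic h does not see the antianalytic part of t, because A D vanishes
        at 0; replacing h by f adds only cnj (B G), which has mean 0 because B(0) = 0.\<close>
      have e1: "(\<integral>\<theta>. h (cis \<theta>) * cnj (t (cis \<theta>)) \<partial>circ_meas) = (\<integral>\<theta>. h (cis \<theta>) * cnj (poly G (cis \<theta>)) \<partial>circ_meas)"
      proof -
        have "(\<integral>\<theta>. h (cis \<theta>) * cnj (t (cis \<theta>)) \<partial>circ_meas) =
          (\<integral>\<theta>. h (cis \<theta>) * cnj (poly G (cis \<theta>)) + poly (A * D) (cis \<theta>) \<partial>circ_meas)"
          by (simp add: GD h_def algebra_simps)
        also have "\<dots> = (\<integral>\<theta>. h (cis \<theta>) * cnj (poly G (cis \<theta>)) \<partial>circ_meas) + (\<integral>\<theta>. poly (A * D) (cis \<theta>) \<partial>circ_meas)"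
          by (intro Bochner_Integration.integral_add I1[of "poly (A * D)"] I1[of "\<lambda>z. h z * cnj (poly G z)"] continuous_intros hc)
        finally show ?thesis using D0 by (simp only: integral_poly_circ) simp
      qed
      have e2: "(\<integral>\<theta>. f (cis \<theta>) * cnj (poly G (cis \<theta>)) \<partial>circ_meas) = (\<integral>\<theta>. h (cis \<theta>) * cnj (poly G (cis \<theta>)) \<partial>circ_meas)"
      proof -
        have "(\<integral>\<theta>. f (cis \<theta>) * cnj (poly G (cis \<theta>)) \<partial>circ_meas) =
          (\<integral>\<theta>. h (cis \<theta>) * cnj (poly G (cis \<theta>)) + cnj (poly (B * G) (cis \<theta>)) \<partial>circ_meas)"
          by (simp add: f_def h_def algebra_simps)
        also have "\<dots> = (\<integral>\<theta>. h (cis \<theta>) * cnj (poly G (cis \<theta>)) \<partial>circ_meas) + (\<integral>\<theta>. cnj (poly (B * G) (cis \<theta>)) \<partial>circ_meas)"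
          by (intro Bochner_Integration.integral_add I1[of "\<lambda>z. cnj (poly (B * G) z)"] I1[of "\<lambda>z. h z * cnj (poly G z)"] continuous_intros hc)
        finally show ?thesis using B0 by (simp only: integral_cnj_poly_circ) simp
      qed
      have Lr: "Lp r (\<lambda>z. cnj (poly G z))" using r by (intro Lp_continuous continuous_intros) auto
      have Gt: "p_moment r (\<lambda>z. cnj (poly G z)) \<le> C * p_moment r t"
      proof -
        have "p_moment r (\<lambda>z. cnj (poly G z)) = p_moment r (poly G)" by (simp add: p_moment_def)
        also have "\<dots> \<le> C * p_moment r (\<lambda>z. poly G z + cnj (poly D z))" by (rule C(2)[OF D0])
        also have "p_moment r (\<lambda>z. poly G z + cnj (poly D z)) = p_moment r t" by (simp add: p_moment_def GD)
        finally show ?thesis .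
      qed
      have tk: "p_moment r t \<le> T * (p_moment p h + 2 * pi * e)"
      proof -
        have "p_moment r t = p_moment r (\<lambda>z. k z - (k z - t z))" by simp
        also have "\<dots> \<le> T * (p_moment r k + p_moment r (\<lambda>z. k z - t z))"
          unfolding T_def by (intro p_moment_diff Lp_diff Lp_continuous kc tc r)
        also have "p_moment r k = p_moment p h" by (simp add: p_moment_def nkr)
        also have "p_moment r (\<lambda>z. k z - t z) \<le> p_moment r (\<lambda>z. of_real e)"
          using e t(2) by (intro p_moment_mono Lp_diff Lp_continuous kc tc r) (auto intro!: less_imp_le)
        also have "\<dots> = 2 * pi * e powr r" using e by (simp add: p_moment_def)
        also have "e powr r \<le> e powr 1" using e r1 by (intro powr_mono') auto
        finally show ?thesis using T e by simp
      qed
      have "of_real (p_moment p h) = (\<integral>\<theta>. complex_of_real (norm (h (cis \<theta>)) powr p) \<partial>circ_meas)"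
        by (simp add: p_moment_def)
      also have "\<dots> = (\<integral>\<theta>. h (cis \<theta>) * cnj (t (cis \<theta>)) + h (cis \<theta>) * cnj (k (cis \<theta>) - t (cis \<theta>)) \<partial>circ_meas)"
        by (simp add: hk[symmetric] algebra_simps)
      also have "\<dots> = (\<integral>\<theta>. h (cis \<theta>) * cnj (t (cis \<theta>)) \<partial>circ_meas) + (\<integral>\<theta>. h (cis \<theta>) * cnj (k (cis \<theta>) - t (cis \<theta>)) \<partial>circ_meas)"
        by (intro Bochner_Integration.integral_add I1[of "\<lambda>z. h z * cnj (t z)"] I1[of "\<lambda>z. h z * cnj (k z - t z)"] continuous_intros hc tc kc)
      also have "(\<integral>\<theta>. h (cis \<theta>) * cnj (t (cis \<theta>)) \<partial>circ_meas) = (\<integral>\<theta>. f (cis \<theta>) * cnj (poly G (cis \<theta>)) \<partial>circ_meas)"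
        by (simp only: e1 e2)
      finally have "norm (complex_of_real (p_moment p h)) \<le> norm (\<integral>\<theta>. f (cis \<theta>) * cnj (poly G (cis \<theta>)) \<partial>circ_meas)
        + norm (\<integral>\<theta>. h (cis \<theta>) * cnj (k (cis \<theta>) - t (cis \<theta>)) \<partial>circ_meas)"
        by (simp only: norm_triangle_ineq)
      then have "p_moment p h \<le> norm (\<integral>\<theta>. f (cis \<theta>) * cnj (poly G (cis \<theta>)) \<partial>circ_meas)
        + norm (\<integral>\<theta>. h (cis \<theta>) * cnj (k (cis \<theta>) - t (cis \<theta>)) \<partial>circ_meas)"
        using p_moment_nonneg[of p h] by simp
      also have "\<dots> \<le> (s powr p * p_moment p f + s powr (- r) * (C * (T * (p_moment p h + 2 * pi * e)))) + I * e"
      proof (rule add_mono)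
        have "norm (\<integral>\<theta>. f (cis \<theta>) * cnj (poly G (cis \<theta>)) \<partial>circ_meas) \<le> (\<integral>\<theta>. norm (f (cis \<theta>) * cnj (poly G (cis \<theta>))) \<partial>circ_meas)"
          by (rule integral_norm_bound)
        also have "\<dots> \<le> s powr p * p_moment p f + s powr (- r) * p_moment r (\<lambda>z. cnj (poly G z))"
          by (rule Young_integral(2)[OF Lpf Lr p1 r1 pr s])
        also have "\<dots> \<le> s powr p * p_moment p f + s powr (- r) * (C * (T * (p_moment p h + 2 * pi * e)))"
          using order_trans[OF Gt mult_left_mono[OF tk C(1)]] by (intro add_left_mono mult_left_mono) auto
        finally show "norm (\<integral>\<theta>. f (cis \<theta>) * cnj (poly G (cis \<theta>)) \<partial>circ_meas) \<le>
          s powr p * p_moment p f + s powr (- r) * (C * (T * (p_moment p h + 2 * pi * e)))" .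
        have "norm (\<integral>\<theta>. h (cis \<theta>) * cnj (k (cis \<theta>) - t (cis \<theta>)) \<partial>circ_meas) \<le> (\<integral>\<theta>. norm (h (cis \<theta>) * cnj (k (cis \<theta>) - t (cis \<theta>))) \<partial>circ_meas)"
          by (rule integral_norm_bound)
        also have "\<dots> \<le> (\<integral>\<theta>. norm (h (cis \<theta>)) * e \<partial>circ_meas)"
        proof (rule integral_mono)
          show "integrable circ_meas (\<lambda>\<theta>. norm (h (cis \<theta>) * cnj (k (cis \<theta>) - t (cis \<theta>))))"
            by (intro integrable_norm I1[of "\<lambda>z. h z * cnj (k z - t z)"] continuous_intros hc tc kc)
          show "integrable circ_meas (\<lambda>\<theta>. norm (h (cis \<theta>)) * e)"
            using I1[OF hc] by simp
          show "norm (h (cis \<theta>) * cnj (k (cis \<theta>) - t (cis \<theta>))) \<le> norm (h (cis \<theta>)) * e" for \<theta>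
            using t(2)[of "cis \<theta>"] unfolding norm_mult complex_mod_cnj by (intro mult_left_mono) auto
        qed
        finally show "norm (\<integral>\<theta>. h (cis \<theta>) * cnj (k (cis \<theta>) - t (cis \<theta>)) \<partial>circ_meas) \<le> I * e"
          by (simp add: I_def)
      qed
      also have "\<dots> = s powr p * p_moment p f + (s powr (- r) * C * T) * p_moment p h + (s powr (- r) * C * T * (2 * pi) + I) * e"
        by (simp add: algebra_simps)
      also have "\<dots> \<le> s powr p * p_moment p f + 1/2 * p_moment p h + (s powr (- r) * C * T * (2 * pi) + I) * e"
        using half p_moment_nonneg[of p h] by (intro add_mono mult_right_mono order_refl)
      finally show "p_moment p h \<le> s powr p * p_moment p f + 1/2 * p_moment p h + (s powr (- r) * C * T * (2 * pi) + I) * e" .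
    qed
    then show "p_moment p (poly A) \<le> 2 * s powr p * p_moment p (\<lambda>z. poly A z + cnj (poly B z))"
      by (simp add: f_def h_def)
  qed simp
qed

lemma Riesz_trig:
  fixes p :: real
  assumes "1 < p"
  obtains C where "0 \<le> C" "\<And>A B. poly B 0 = 0 \<Longrightarrow>
    p_moment p (poly A) \<le> C * p_moment p (\<lambda>z. poly A z + cnj (poly B z))"
proof (cases "p \<le> 2")
  case True
  then show ?thesis using Riesz_trig_le2[OF assms] that by blast
next
  case False
  then have "2 < p" by simp
  then show ?thesis using Riesz_trig_gt2 that by blast
qed

section \<open>Extension of the Riesz projection from polynomials to L^p\<close>

lemma p_moment_Fatou:
  assumes f: "\<And>n. Lp p (f n)" and p: "0 < p"
    and g: "(\<lambda>\<theta>. g (cis \<theta>)) \<in> borel_measurable circ_meas"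
    and lim: "AE \<theta> in circ_meas. (\<lambda>n. f n (cis \<theta>)) \<longlonglongrightarrow> g (cis \<theta>)"
    and M: "0 \<le> M" "eventually (\<lambda>n. p_moment p (f n) \<le> M) sequentially"
  shows "Lp p g" "p_moment p g \<le> M"
proof -
  note [measurable] = g Lp_measurable[OF f]
  have "(\<integral>\<^sup>+\<theta>. ennreal (norm (g (cis \<theta>)) powr p) \<partial>circ_meas) =
    (\<integral>\<^sup>+\<theta>. liminf (\<lambda>n. ennreal (norm (f n (cis \<theta>)) powr p)) \<partial>circ_meas)"
  proof (rule nn_integral_cong_AE)
    show "AE \<theta> in circ_meas. ennreal (norm (g (cis \<theta>)) powr p) = liminf (\<lambda>n. ennreal (norm (f n (cis \<theta>)) powr p))"
      using lim
    proof eventually_elim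
      case (elim \<theta>)
      have "(\<lambda>n. norm (f n (cis \<theta>)) powr p) \<longlonglongrightarrow> norm (g (cis \<theta>)) powr p"
        using elim p by (intro tendsto_powr' tendsto_norm) auto
      then have "(\<lambda>n. ennreal (norm (f n (cis \<theta>)) powr p)) \<longlonglongrightarrow> ennreal (norm (g (cis \<theta>)) powr p)"
        by (rule tendsto_ennrealI)
      then show ?case by (intro lim_imp_Liminf[symmetric]) auto
    qed
  qed
  also have "\<dots> \<le> liminf (\<lambda>n. \<integral>\<^sup>+\<theta>. ennreal (norm (f n (cis \<theta>)) powr p) \<partial>circ_meas)"
    by (rule nn_integral_liminf) measurable
  also have "(\<lambda>n. \<integral>\<^sup>+\<theta>. ennreal (norm (f n (cis \<theta>)) powr p) \<partial>circ_meas) = (\<lambda>n. ennreal (p_moment p (f n)))"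
    unfolding p_moment_def using Lp_integrable_powr[OF f] by (intro ext nn_integral_eq_integral) auto
  \<comment> \<open>Passing to the limsup makes a bound that holds only eventually
    sufficient.\<close>
  also have "liminf \<dots> \<le> limsup (\<lambda>n. ennreal (p_moment p (f n)))"
    by (rule Liminf_le_Limsup) simp
  also have "\<dots> \<le> ennreal M"
    by (rule Limsup_bounded, rule eventually_mono[OF M(2)]) (rule ennreal_leI)
  finally have le: "(\<integral>\<^sup>+\<theta>. ennreal (norm (g (cis \<theta>)) powr p) \<partial>circ_meas) \<le> ennreal M" .
  have int: "integrable circ_meas (\<lambda>\<theta>. norm (g (cis \<theta>)) powr p)"
  proof (rule integrableI_bounded)
    show "(\<integral>\<^sup>+\<theta>. ennreal (norm (norm (g (cis \<theta>)) powr p)) \<partial>circ_meas) < \<infinity>"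
      using le by (simp add: le_less_trans[OF _ ennreal_less_top])
  qed measurable
  then show "Lp p g" using g by (simp add: Lp_def)
  have "ennreal (p_moment p g) \<le> ennreal M"
    using le nn_integral_eq_integral[OF int] by (simp add: p_moment_def)
  then show "p_moment p g \<le> M" using M(1) by simp
qed

text \<open>By monotone convergence the sum of the norms has finite integral, hence is finite almost
  everywhere.\<close>

lemma AE_summable_if_integrals_summable:
  fixes f :: "nat \<Rightarrow> 'a \<Rightarrow> complex"
  assumes int: "\<And>i. integrable M (f i)" and sum: "summable (\<lambda>i. \<integral>x. norm (f i x) \<partial>M)"
  shows "AE x in M. summable (\<lambda>i. norm (f i x))"
proof -
  have [measurable]: "f i \<in> borel_measurable M" for i using int by auto
  have "(\<integral>\<^sup>+x. (\<Sum>i. ennreal (norm (f i x))) \<partial>M) = (\<Sum>i. \<integral>\<^sup>+x. ennreal (norm (f i x)) \<partial>M)"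
    by (rule nn_integral_suminf) measurable
  also have "\<dots> = (\<Sum>i. ennreal (\<integral>x. norm (f i x) \<partial>M))"
    using int by (intro arg_cong[where f = suminf] ext nn_integral_eq_integral) auto
  also have "\<dots> = ennreal (\<Sum>i. \<integral>x. norm (f i x) \<partial>M)"
    by (rule suminf_ennreal2[OF _ sum]) simp
  finally have "(\<integral>\<^sup>+x. (\<Sum>i. ennreal (norm (f i x))) \<partial>M) \<noteq> \<infinity>" by simp
  then have "AE x in M. (\<Sum>i. ennreal (norm (f i x))) \<noteq> \<infinity>"
    by (intro nn_integral_PInf_AE) measurable
  then show ?thesis
    by eventually_elim (auto intro: summable_suminf_not_top)
qed

text \<open>The projection is built as the a.e. limit of the analytic parts of rapidly converging
  trigonometric approximations. The polynomial estimate makes consecutive differences summable in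
  L^1; Fatou's lemma carries the moment bound to the limit and dominated convergence carries the
  coefficients.\<close>

theorem Riesz_projection_exists:
  fixes p :: real
  assumes p1: "1 < p"
  obtains K where "0 \<le> K" "\<And>f. Lp p f \<Longrightarrow>
    \<exists>g. Hp p g \<and> (\<forall>n\<ge>0. fourier_coeff g n = fourier_coeff f n) \<and> p_moment p g \<le> K * p_moment p f"
proof -
  have p: "0 < p" using p1 by simp
  obtain C where C: "0 \<le> C" "\<And>A B. poly B 0 = 0 \<Longrightarrow>
    p_moment p (poly A) \<le> C * p_moment p (\<lambda>z. poly A z + cnj (poly B z))"
    using Riesz_trig[OF p1] by blast
  define T where "T = (2::real) powr p"
  have T: "T > 0" by (simp add: T_def)
  show ?thesis
  proof (rule that[of "C * T"])
    show "0 \<le> C * T" using C T by simp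
    fix f assume f: "Lp p f"
    \<comment> \<open>A p-th moment of order d^p forces an L^1 norm of order d, by taking \<delta> =
      d in \<open>norm_integral_le_p_moment\<close>. Geometric decay therefore gives
      summability.\<close>
    define d where "d n = (1/2::real) ^ n" for n
    have d: "d n > 0" for n by (simp add: d_def)
    have "\<exists>t. trig_poly t \<and> p_moment p (\<lambda>z. f z - t z) < d n powr p" for n
      by (rule trig_poly_dense[OF f p, of "d n powr p"]) (use d[of n] in auto)
    then obtain t where t: "\<And>n. trig_poly (t n)" "\<And>n. p_moment p (\<lambda>z. f z - t n z) < d n powr p"
      by metis
    have "\<exists>A B. poly B 0 = 0 \<and> (\<forall>z. norm z = 1 \<longrightarrow> t n z = poly A z + cnj (poly B z))" for n
      using trig_poly_normalE[OF t(1)[of n]] by metis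
    then obtain A B where B0: "\<And>n. poly (B n) 0 = 0"
      and AB: "\<And>n z. norm z = 1 \<Longrightarrow> t n z = poly (A n) z + cnj (poly (B n) z)" by metis
    have Lpt: "Lp p (t n)" for n by (rule Lp_continuous[OF continuous_on_trig_poly[OF t(1)] p])
    have LpA: "Lp p (poly (A n))" for n by (rule Lp_poly[OF p])
    have pmA: "p_moment p (poly (A n)) \<le> C * T * (p_moment p f + d n powr p)" for n
    proof -
      have "p_moment p (poly (A n)) \<le> C * p_moment p (\<lambda>z. poly (A n) z + cnj (poly (B n) z))"
        by (rule C(2)[OF B0])
      also have "p_moment p (\<lambda>z. poly (A n) z + cnj (poly (B n) z)) = p_moment p (\<lambda>z. f z - (f z - t n z))"
        by (simp add: p_moment_def AB)
      also have "\<dots> \<le> T * (p_moment p f + p_moment p (\<lambda>z. f z - t n z))"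
        unfolding T_def by (intro p_moment_diff Lp_diff f Lpt p)
      also have "\<dots> \<le> T * (p_moment p f + d n powr p)"
        using T t(2)[of n] by (intro mult_left_mono add_mono) auto
      finally show ?thesis using C(1) by (simp add: mult_left_mono mult.assoc)
    qed
    define D where "D n = (\<lambda>z. poly (A (Suc n)) z - poly (A n) z)" for n
    have LpD: "Lp p (D n)" for n unfolding D_def by (intro Lp_diff LpA p)
    have pmD: "p_moment p (D n) \<le> C * T * 2 * d n powr p" for n
    proof -
      have "p_moment p (D n) = p_moment p (poly (A (Suc n) - A n))" by (simp add: D_def p_moment_def)
      also have "\<dots> \<le> C * p_moment p (\<lambda>z. poly (A (Suc n) - A n) z + cnj (poly (B (Suc n) - B n) z))"
        by (rule C(2)) (simp add: B0)
      also have "p_moment p (\<lambda>z. poly (A (Suc n) - A n) z + cnj (poly (B (Suc n) - B n) z))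
        = p_moment p (\<lambda>z. (f z - t n z) - (f z - t (Suc n) z))"
        by (simp add: p_moment_def AB algebra_simps)
      also have "\<dots> \<le> T * (p_moment p (\<lambda>z. f z - t n z) + p_moment p (\<lambda>z. f z - t (Suc n) z))"
        unfolding T_def by (intro p_moment_diff Lp_diff f Lpt p)
      also have "\<dots> \<le> T * (d n powr p + d n powr p)"
      proof -
        have "d (Suc n) powr p \<le> d n powr p" using p by (intro powr_mono2) (auto simp: d_def)
        then show ?thesis using T t(2)[of n] t(2)[of "Suc n"] by (intro mult_left_mono add_mono) auto
      qed
      finally show ?thesis using C(1) by (simp add: mult_left_mono mult.assoc)
    qed
    have intA: "integrable circ_meas (\<lambda>\<theta>. poly (A n) (cis \<theta>))" for n
      using Lp_integrable[OF LpA] p1 by simp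
    have intD: "integrable circ_meas (\<lambda>\<theta>. D n (cis \<theta>))" for n
      using Lp_integrable[OF LpD] p1 by simp
    have D1: "(\<integral>\<theta>. norm (D n (cis \<theta>)) \<partial>circ_meas) \<le> (2 * pi + C * T * 2) * d n" for n
    proof -
      have "(\<integral>\<theta>. norm (D n (cis \<theta>)) \<partial>circ_meas) \<le> 2 * pi * d n + d n powr (1 - p) * p_moment p (D n)"
        by (rule norm_integral_le_p_moment[OF LpD]) (use p1 d in auto)
      also have "\<dots> \<le> 2 * pi * d n + d n powr (1 - p) * (C * T * 2 * d n powr p)"
        using pmD by (intro add_left_mono mult_left_mono) auto
      also have "\<dots> = 2 * pi * d n + C * T * 2 * (d n powr (1 - p) * d n powr p)" by simp
      also have "d n powr (1 - p) * d n powr p = d n" using d[of n] by (simp flip: powr_add)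
      finally show ?thesis by (simp add: algebra_simps)
    qed
    have sumD: "summable (\<lambda>n. \<integral>\<theta>. norm (D n (cis \<theta>)) \<partial>circ_meas)"
    proof (rule summable_comparison_test_ev)
      show "\<forall>\<^sub>F n in sequentially. norm (\<integral>\<theta>. norm (D n (cis \<theta>)) \<partial>circ_meas) \<le> (2 * pi + C * T * 2) * d n"
        using D1 by simp
      show "summable (\<lambda>n. (2 * pi + C * T * 2) * d n)"
        unfolding d_def by (intro summable_mult summable_geometric) simp
    qed
    have AEsum: "AE \<theta> in circ_meas. summable (\<lambda>n. norm (D n (cis \<theta>)))"
      by (rule AE_summable_if_integrals_summable[OF intD sumD])
    \<comment> \<open>Common integrable majorant of all \<open>poly (A n)\<close>.\<close>
    define w where "w \<theta> = norm (poly (A 0) (cis \<theta>)) + (\<Sum>n. norm (D n (cis \<theta>)))" for \<theta>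
    have intw: "integrable circ_meas w"
      unfolding w_def
      using intA intD AEsum sumD by (intro Bochner_Integration.integrable_add integrable_norm integrable_suminf) auto
    have tele: "poly (A n) z = poly (A 0) z + (\<Sum>i<n. D i z)" for n z
      by (induction n) (auto simp: D_def)
    define g where "g = (\<lambda>z. lim (\<lambda>n. poly (A n) z))"
    have gm: "(\<lambda>\<theta>. g (cis \<theta>)) \<in> borel_measurable circ_meas"
      unfolding g_def using Lp_measurable[OF LpA] by (intro borel_measurable_lim_metric)
    have glim: "AE \<theta> in circ_meas. (\<lambda>n. poly (A n) (cis \<theta>)) \<longlonglongrightarrow> g (cis \<theta>)"
      using AEsum
    proof eventually_elim
      case (elim \<theta>)
      then have "(\<lambda>n. \<Sum>i<n. D i (cis \<theta>)) \<longlonglongrightarrow> (\<Sum>i. D i (cis \<theta>))"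
        by (rule summable_LIMSEQ[OF summable_norm_cancel])
      then have "(\<lambda>n. poly (A 0) (cis \<theta>) + (\<Sum>i<n. D i (cis \<theta>))) \<longlonglongrightarrow> poly (A 0) (cis \<theta>) + (\<Sum>i. D i (cis \<theta>))"
        by (intro tendsto_intros)
      then have "convergent (\<lambda>n. poly (A n) (cis \<theta>))"
        unfolding tele[symmetric] by (rule convergentI)
      then show ?case by (simp add: g_def convergent_LIMSEQ_iff)
    qed
    have gdom: "AE \<theta> in circ_meas. norm (poly (A n) (cis \<theta>)) \<le> w \<theta>" for n
      using AEsum
    proof eventually_elim
      case (elim \<theta>)
      have "norm (poly (A n) (cis \<theta>)) \<le> norm (poly (A 0) (cis \<theta>)) + norm (\<Sum>i<n. D i (cis \<theta>))"
        unfolding tele[of n] by (rule norm_triangle_ineq)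
      also have "norm (\<Sum>i<n. D i (cis \<theta>)) \<le> (\<Sum>i<n. norm (D i (cis \<theta>)))" by (rule norm_sum)
      also have "\<dots> \<le> (\<Sum>i. norm (D i (cis \<theta>)))" using elim by (intro sum_le_suminf) auto
      finally show ?case by (simp add: w_def)
    qed
    have d0: "(\<lambda>n. d n powr p) \<longlonglongrightarrow> 0"
    proof -
      have "(\<lambda>n. d n powr p) \<longlonglongrightarrow> 0 powr p"
        unfolding d_def using p by (intro tendsto_powr' LIMSEQ_power_zero) auto
      then show ?thesis by simp
    qed
    have M: "Lp p g \<and> p_moment p g \<le> C * T * p_moment p f + e" if e: "e > 0" for e
    proof -
      have "(\<lambda>n. C * T * (p_moment p f + d n powr p)) \<longlonglongrightarrow> C * T * (p_moment p f + 0)"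
        by (intro tendsto_intros d0)
      then have "eventually (\<lambda>n. C * T * (p_moment p f + d n powr p) < C * T * p_moment p f + e) sequentially"
        by (rule order_tendstoD) (use e in simp)
      then have ev: "eventually (\<lambda>n. p_moment p (poly (A n)) \<le> C * T * p_moment p f + e) sequentially"
        by eventually_elim (use pmA in \<open>meson less_imp_le order_trans\<close>)
      have "0 \<le> C * T * p_moment p f + e" using C T e p_moment_nonneg[of p f] by simp
      then show ?thesis using p_moment_Fatou[OF LpA p gm glim _ ev] by blast
    qed
    have Lpg: "Lp p g" using M[of 1] by simp
    have pmg: "p_moment p g \<le> C * T * p_moment p f" by (rule field_le_epsilon) (use M in blast)
    have gcoeff: "(\<lambda>n. fourier_coeff (poly (A n)) k) \<longlonglongrightarrow> fourier_coeff g k" for k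
      unfolding fourier_coeff_def
    proof (intro tendsto_divide tendsto_const integral_dominated_convergence)
      show "integrable circ_meas w" by (rule intw)
      show "(\<lambda>\<theta>. g (cis \<theta>) * cis (- (of_int k * \<theta>))) \<in> borel_measurable circ_meas"
        using fourier_integrable[OF Lp_integrable[OF Lpg], of k] p1 by auto
      show "(\<lambda>\<theta>. poly (A i) (cis \<theta>) * cis (- (of_int k * \<theta>))) \<in> borel_measurable circ_meas" for i
        using fourier_integrable[OF intA, of i k] by auto
      show "AE \<theta> in circ_meas. (\<lambda>i. poly (A i) (cis \<theta>) * cis (- (of_int k * \<theta>))) \<longlonglongrightarrow> g (cis \<theta>) * cis (- (of_int k * \<theta>))"
        using glim by eventually_elim (intro tendsto_intros)
      show "AE \<theta> in circ_meas. norm (poly (A i) (cis \<theta>) * cis (- (of_int k * \<theta>))) \<le> w \<theta>" for i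
        using gdom[of i] by (simp add: norm_mult)
    qed simp
    have "fourier_coeff g k = 0" if "k < 0" for k
      using gcoeff[of k] fourier_coeff_poly_neg[OF that] by (simp add: LIMSEQ_const_iff)
    moreover have "fourier_coeff g k = fourier_coeff f k" if k: "k \<ge> 0" for k
    proof (rule LIMSEQ_unique[OF gcoeff])
      have fint: "integrable circ_meas (\<lambda>\<theta>. f (cis \<theta>))" using Lp_integrable[OF f] p1 by simp
      have tint: "integrable circ_meas (\<lambda>\<theta>. t n (cis \<theta>))" for n using Lp_integrable[OF Lpt] p1 by simp
      have eq: "fourier_coeff (poly (A n)) k = fourier_coeff (t n) k" for n
      proof -
        have Bint: "integrable circ_meas (\<lambda>\<theta>. cnj (poly (B n) (cis \<theta>)))"
          using Lp_integrable[OF Lp_continuous[of "\<lambda>z. cnj (poly (B n) z)" 1]] by (auto intro!: continuous_intros)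
        have "fourier_coeff (t n) k = fourier_coeff (\<lambda>z. poly (A n) z + cnj (poly (B n) z)) k"
          by (rule fourier_coeff_cong) (rule AB)
        also have "\<dots> = fourier_coeff (poly (A n)) k + fourier_coeff (\<lambda>z. cnj (poly (B n) z)) k"
          by (rule fourier_coeff_add[OF intA Bint])
        finally show ?thesis using fourier_coeff_cnj_poly_nonneg[OF k B0] by simp
      qed
      have "(\<lambda>n. fourier_coeff f k - fourier_coeff (poly (A n)) k) \<longlonglongrightarrow> 0"
      proof (rule Lim_null_comparison)
        show "\<forall>\<^sub>F n in sequentially. norm (fourier_coeff f k - fourier_coeff (poly (A n)) k) \<le> (1 + 1 / (2 * pi)) * d n"
        proof (rule always_eventually, rule allI)
          fix n
          have "2*pi * norm (fourier_coeff (\<lambda>z. f z - t n z) k) \<le> 2*pi*d n + d n powr (1 - p) * p_moment p (\<lambda>z. f z - t n z)"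
            by (rule fourier_coeff_small[OF Lp_diff[OF f Lpt p]]) (use p1 d in auto)
          also have "\<dots> \<le> 2*pi*d n + d n powr (1 - p) * d n powr p"
            using t(2)[of n] by (intro add_left_mono mult_left_mono) auto
          also have "d n powr (1 - p) * d n powr p = d n" using d[of n] by (simp flip: powr_add)
          also have "2 * pi * d n + d n = 2 * pi * ((1 + 1 / (2 * pi)) * d n)" by (simp add: field_simps)
          finally have "norm (fourier_coeff (\<lambda>z. f z - t n z) k) \<le> (1 + 1 / (2 * pi)) * d n"
            by (rule mult_left_le_imp_le) simp
          then show "norm (fourier_coeff f k - fourier_coeff (poly (A n)) k) \<le> (1 + 1 / (2 * pi)) * d n"
            unfolding eq fourier_coeff_diff[OF fint tint] .
        qed
        have "(\<lambda>n. (1 + 1 / (2 * pi)) * d n) \<longlonglongrightarrow> (1 + 1 / (2 * pi)) * 0"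
          unfolding d_def by (intro tendsto_intros LIMSEQ_power_zero) auto
        then show "(\<lambda>n. (1 + 1 / (2 * pi)) * d n) \<longlonglongrightarrow> 0" by simp
      qed
      from tendsto_diff[OF tendsto_const[of "fourier_coeff f k"] this]
      show "(\<lambda>n. fourier_coeff (poly (A n)) k) \<longlonglongrightarrow> fourier_coeff f k" by simp
    qed
    ultimately have "Hp p g \<and> (\<forall>n\<ge>0. fourier_coeff g n = fourier_coeff f n) \<and> p_moment p g \<le> C * T * p_moment p f"
      using Lpg pmg by (simp add: Hp_def)
    then show "\<exists>g. Hp p g \<and> (\<forall>n\<ge>0. fourier_coeff g n = fourier_coeff f n) \<and> p_moment p g \<le> C * T * p_moment p f"
      by blast
  qed
qed

section \<open>Composition with \<open>\<alpha>\<close>\<close>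

lemma integrable_circ_iff:
  fixes F :: "real \<Rightarrow> 'b::euclidean_space"
  shows "integrable circ_meas F \<longleftrightarrow> F absolutely_integrable_on {0..2*pi}"
  by (simp add: circ_meas_def integrable_restrict_space set_integrable_def)

lemma integral_circ_eq:
  fixes F :: "real \<Rightarrow> 'b::euclidean_space"
  shows "integrable circ_meas F \<Longrightarrow> (\<integral>\<theta>. F \<theta> \<partial>circ_meas) = integral {0..2*pi} F"
  unfolding circ_meas_def by (rule lebesgue_integral_eq_integral) auto

text \<open>The lifted image of the circle under \<alpha> is an interval of length 2\<pi> that need
  not start at a multiple of 2\<pi>. It fits into two periods, which costs only a factor 2.\<close>

lemma two_periods:
  fixes F :: "real \<Rightarrow> 'b::euclidean_space"
  assumes F: "F absolutely_integrable_on {0..2*pi}" and per: "\<And>x. F (x - 2*pi) = F x"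
  shows "F absolutely_integrable_on {-(2*pi)..2*pi}"
    and "integral {-(2*pi)..2*pi} F = 2 *\<^sub>R integral {0..2*pi} F"
proof -
  let ?g = "\<lambda>x::real. x - 2*pi"
  have img: "?g ` {0..2*pi} = {-(2*pi)..0}"
    by (auto simp: image_iff intro: bexI[of _ "_ + 2*pi"])
  have "(\<lambda>x. \<bar>1::real\<bar> *\<^sub>R F (?g x)) absolutely_integrable_on {0..2*pi} \<and>
    integral {0..2*pi} (\<lambda>x. \<bar>1::real\<bar> *\<^sub>R F (?g x)) = integral {0..2*pi} F
    \<longleftrightarrow> F absolutely_integrable_on ?g ` {0..2*pi} \<and> integral (?g ` {0..2*pi}) F = integral {0..2*pi} F"
    by (rule has_absolute_integral_change_of_variables_real)
      (auto intro!: derivative_eq_intros inj_onI)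
  then have 1: "F absolutely_integrable_on {-(2*pi)..0}" "integral {-(2*pi)..0} F = integral {0..2*pi} F"
    using F unfolding img by (simp_all add: per)
  have "F absolutely_integrable_on {-(2*pi)..0} \<union> {0..2*pi}"
    by (rule set_integrable_Un[OF 1(1) F]) auto
  moreover have "{-(2*pi)..0} \<union> {0..2*pi} = {-(2*pi)..2*pi}"
    using pi_gt_zero by (intro ivl_disj_un_two_touch) auto
  ultimately show 2: "F absolutely_integrable_on {-(2*pi)..2*pi}" by simp
  have "F integrable_on {-(2*pi)..2*pi}"
    using 2 by (rule set_lebesgue_integral_eq_integral(1))
  then show "integral {-(2*pi)..2*pi} F = 2 *\<^sub>R integral {0..2*pi} F"
    using Henstock_Kurzweil_Integration.integral_combine[of "-(2*pi)" 0 "2*pi" F] 1(2) by (simp add: scaleR_2)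
qed

text \<open>v / cnj v has twice the argument of v. This converts the factorisation of \<alpha> into
  a differentiable angle.\<close>

lemma cis_Im_Ln: "v \<noteq> 0 \<Longrightarrow> cis (2 * Im (Ln v)) = v / cnj v"
proof -
  assume v: "v \<noteq> 0"
  have 1: "v = of_real (norm v) * cis (Im (Ln v))"
    using v by (metis exp_Ln exp_eq_polar exp_ln norm_exp_eq_Re zero_less_norm_iff Re_Ln)
  then have "cnj v = of_real (norm v) * cis (- Im (Ln v))"
    by (metis cis_cnj complex_cnj_complex_of_real complex_cnj_mult)
  then have "v / cnj v = cis (Im (Ln v)) / cis (- Im (Ln v))"
    using 1 v by (metis mult_divide_mult_cancel_left norm_eq_zero of_real_eq_0_iff)
  also have "\<dots> = cis (2 * Im (Ln v))" by (simp add: cis_divide)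
  finally show ?thesis by simp
qed

context
  fixes \<beta> :: complex
  assumes \<beta>: "cmod \<beta> > 1"
begin

lemma beta_nonzero: "\<beta> \<noteq> 0" "cnj \<beta> \<noteq> 0"
  using \<beta> by auto

lemma Re_one_minus_div_pos: "norm z \<le> 1 \<Longrightarrow> 0 < Re (1 - z / \<beta>)"
proof -
  assume "norm z \<le> 1"
  then have "norm (z / \<beta>) < 1" using \<beta> by (simp add: norm_divide divide_simps)
  moreover have "Re (z / \<beta>) \<le> norm (z / \<beta>)" by (rule complex_Re_le_cmod)
  ultimately show ?thesis by simp
qed

lemma denom_nonzero: "norm z = 1 \<Longrightarrow> cnj \<beta> * z - 1 \<noteq> 0"
proof
  assume z: "norm z = 1" and "cnj \<beta> * z - 1 = 0"
  then have "norm (cnj \<beta> * z) = 1" by simp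
  then show False using z \<beta> by (simp add: norm_mult)
qed

text \<open>Separates \<alpha> into a constant, the reflection cnj z and a quotient v / cnj v with v
  = 1 - z/\<beta>. As v stays in the right half-plane, its argument is a smooth function.\<close>

lemma alpha_factor:
  assumes z: "norm z = 1"
  shows "alpha \<beta> z = - (\<beta> / cnj \<beta>) * cnj z * ((1 - z / \<beta>) / cnj (1 - z / \<beta>))"
proof -
  have zz: "z * cnj z = 1" using z by (rule norm_1_cnj_mult)
  have z0: "z \<noteq> 0" using z by auto
  then have cz: "cnj z = 1 / z" using zz by (simp add: field_simps)
  have d: "cnj \<beta> * z - 1 \<noteq> 0" using denom_nonzero[OF z] .
  have e: "cnj (1 - z / \<beta>) = (cnj \<beta> * z - 1) / (cnj \<beta> * z)"
    using beta_nonzero z0 by (simp add: cz field_simps)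
  have e': "1 - z / \<beta> = (\<beta> - z) / \<beta>"
    using beta_nonzero by (simp add: field_simps)
  have "- (\<beta> / cnj \<beta>) * cnj z * ((1 - z / \<beta>) / cnj (1 - z / \<beta>))
      = - (\<beta> / cnj \<beta>) * (1 / z) * ((\<beta> - z) / \<beta> * (cnj \<beta> * z / (cnj \<beta> * z - 1)))"
    unfolding e unfolding e' cz by simp
  also have "\<dots> = (z - \<beta>) / (cnj \<beta> * z - 1)"
    using beta_nonzero z0 d by (simp add: field_simps)
  finally show ?thesis by (simp add: alpha_def)
qed

lemma norm_alpha: "norm z = 1 \<Longrightarrow> norm (alpha \<beta> z) = 1"
proof -
  assume z: "norm z = 1"
  have "1 - z / \<beta> \<noteq> 0" using Re_one_minus_div_pos[of z] z by auto
  then show ?thesis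
    using z beta_nonzero unfolding alpha_factor[OF z] by (simp add: norm_mult norm_divide del: complex_cnj_diff)
qed

text \<open>A smooth lift of \<alpha> to angles. The constants are chosen so that its value at 0 is
  \<open>Arg2pi (alpha \<beta> 1)\<close>, which lies in [0, 2\<pi>).\<close>

definition alpha_angle :: "real \<Rightarrow> real" where
  "alpha_angle \<theta> = Arg2pi (alpha \<beta> 1) - 2 * Im (Ln (1 - 1 / \<beta>)) - \<theta> + 2 * Im (Ln (1 - cis \<theta> / \<beta>))"

lemma cis_alpha_angle: "cis (alpha_angle \<theta>) = alpha \<beta> (cis \<theta>)"
proof -
  have v: "1 - cis x / \<beta> \<noteq> 0" for x using Re_one_minus_div_pos[of "cis x"] by auto
  have v1: "1 - 1 / \<beta> \<noteq> 0" using v[of 0] by simp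
  have 1: "cis (Arg2pi (alpha \<beta> 1)) = alpha \<beta> 1"
    using norm_alpha[of 1] complex_norm_eq_1_exp[of "alpha \<beta> 1"] by (simp add: cis_conv_exp)
  have "cis (alpha_angle \<theta>) = cis (Arg2pi (alpha \<beta> 1)) * cis (2 * Im (Ln (1 - cis \<theta> / \<beta>))) * cis (- \<theta>) / cis (2 * Im (Ln (1 - 1 / \<beta>)))"
    by (simp add: alpha_angle_def cis_mult cis_divide algebra_simps)
  also have "\<dots> = alpha \<beta> 1 * ((1 - cis \<theta> / \<beta>) / cnj (1 - cis \<theta> / \<beta>)) * cis (- \<theta>) / ((1 - 1 / \<beta>) / cnj (1 - 1 / \<beta>))"
    by (simp only: 1 cis_Im_Ln[OF v] cis_Im_Ln[OF v1])
  also have "\<dots> = - (\<beta> / cnj \<beta>) * cis (- \<theta>) * ((1 - cis \<theta> / \<beta>) / cnj (1 - cis \<theta> / \<beta>))"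
  proof -
    have "(K * q) * a * b / q = K * b * a" if "q \<noteq> 0" for K q a b :: complex
      using that by simp
    moreover have "alpha \<beta> 1 = - (\<beta> / cnj \<beta>) * ((1 - 1 / \<beta>) / cnj (1 - 1 / \<beta>))"
      using alpha_factor[of 1] by simp
    moreover have "(1 - 1 / \<beta>) / cnj (1 - 1 / \<beta>) \<noteq> 0"
      using v1 by (metis complex_cnj_zero_iff divide_eq_0_iff)
    ultimately show ?thesis by (simp only:)
  qed
  also have "\<dots> = alpha \<beta> (cis \<theta>)"
    by (simp add: alpha_factor cis_cnj)
  finally show ?thesis .
qed

definition alpha_angle_deriv :: "real \<Rightarrow> real" where
  "alpha_angle_deriv \<theta> = - 1 + 2 * Im (- (\<i> * cis \<theta> / \<beta>) * inverse (1 - cis \<theta> / \<beta>))"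

lemma has_derivative_alpha_angle:
  "(alpha_angle has_field_derivative alpha_angle_deriv \<theta>) (at \<theta> within S)"
proof -
  have v: "1 - cis \<theta> / \<beta> \<notin> \<real>\<^sub>\<le>\<^sub>0"
    using Re_one_minus_div_pos[of "cis \<theta>"] by (auto simp: complex_nonpos_Reals_iff)
  have "((\<lambda>x. 1 - cis x / \<beta>) has_vector_derivative - (\<i> * cis \<theta> / \<beta>)) (at \<theta>)"
    unfolding has_vector_derivative_def
    by (rule derivative_eq_intros refl)+ (auto simp: scaleR_conv_of_real beta_nonzero)
  moreover have "(Ln has_field_derivative inverse (1 - cis \<theta> / \<beta>)) (at (1 - cis \<theta> / \<beta>))"
    using v by (rule has_field_derivative_Ln)
  ultimately have "((Ln \<circ> (\<lambda>x. 1 - cis x / \<beta>)) has_vector_derivative - (\<i> * cis \<theta> / \<beta>) * inverse (1 - cis \<theta> / \<beta>)) (at \<theta>)"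
    by (rule field_vector_diff_chain_at)
  then have "((\<lambda>x. Im (Ln (1 - cis x / \<beta>))) has_vector_derivative Im (- (\<i> * cis \<theta> / \<beta>) * inverse (1 - cis \<theta> / \<beta>))) (at \<theta>)"
    using bounded_linear.has_vector_derivative[OF bounded_linear_Im] by (fastforce simp: o_def)
  then have *: "((\<lambda>x. Im (Ln (1 - cis x / \<beta>))) has_field_derivative Im (- (\<i> * cis \<theta> / \<beta>) * inverse (1 - cis \<theta> / \<beta>))) (at \<theta>)"
    by (simp add: has_real_derivative_iff_has_vector_derivative)
  have "(alpha_angle has_field_derivative alpha_angle_deriv \<theta>) (at \<theta>)"
    unfolding alpha_angle_def[abs_def] alpha_angle_deriv_def
    by (rule derivative_eq_intros * refl)+ simp
  then show ?thesis by (rule has_field_derivative_at_within)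
qed

text \<open>With w = cis \<theta> / \<beta>, the derivative is minus the Poisson kernel (1 - |w|^2)
  / |1 - w|^2, and |w| < 1.\<close>

lemma alpha_angle_deriv_neg: "alpha_angle_deriv \<theta> < 0"
proof -
  define w where "w = cis \<theta> / \<beta>"
  have w: "norm w < 1" using \<beta> by (simp add: w_def norm_divide divide_simps)
  have w1: "1 - w \<noteq> 0" using w by auto
  have "alpha_angle_deriv \<theta> = - 1 + 2 * Im (- (\<i> * w / (1 - w)))"
    by (simp add: alpha_angle_deriv_def w_def divide_inverse mult.assoc)
  also have "\<dots> = - Re ((1 + w) / (1 - w))"
  proof -
    have "(1 + w) / (1 - w) = 1 + 2 * (w / (1 - w))" using w1 by (simp add: field_simps)
    moreover have "Re (1 + 2 * x) = 1 + 2 * Re x" for x by simp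
    ultimately have "Re ((1 + w) / (1 - w)) = 1 + 2 * Re (w / (1 - w))" by (simp only:)
    moreover have "Im (- (\<i> * w / (1 - w))) = - Re (w / (1 - w))"
    proof -
      have "Im (- (\<i> * x)) = - Re x" for x by simp
      then show ?thesis by (simp only: times_divide_eq_right[symmetric])
    qed
    ultimately show ?thesis by simp
  qed
  also have "Re ((1 + w) / (1 - w)) = (1 - (norm w)\<^sup>2) / (norm (1 - w))\<^sup>2"
  proof -
    have "(1 + w) / (1 - w) = (1 + w) * cnj (1 - w) / of_real ((norm (1 - w))\<^sup>2)"
      using complex_div_cnj[of "1 + w" "1 - w"] by (simp only: of_real_power)
    moreover have "Re ((1 + w) * cnj (1 - w)) = 1 - (norm w)\<^sup>2"
      unfolding cmod_power2 by (simp add: algebra_simps power2_eq_square)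
    ultimately show ?thesis by (simp only: Re_divide_of_real)
  qed
  also have "- \<dots> < 0"
  proof -
    have "(norm w)\<^sup>2 < 1" using w by (simp add: power_less_one_iff abs_square_less_1)
    then show ?thesis using w1 by simp
  qed
  finally show ?thesis .
qed

lemma alpha_angle_strict_antimono: "x < y \<Longrightarrow> alpha_angle y < alpha_angle x"
  by (rule DERIV_neg_imp_decreasing) (use has_derivative_alpha_angle alpha_angle_deriv_neg in blast)+

lemma continuous_on_alpha_angle_deriv: "continuous_on S alpha_angle_deriv"
proof -
  have "1 - cis x / \<beta> \<noteq> 0" for x using Re_one_minus_div_pos[of "cis x"] by auto
  then show ?thesis
    unfolding alpha_angle_deriv_def[abs_def] using beta_nonzero by (intro continuous_intros) auto
qed

text \<open>The logarithmic term is periodic, so the lift decreases by exactly 2\<pi> over one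
  period, starting from a value in [0, 2\<pi>).\<close>

lemma alpha_angle_image: "alpha_angle ` {0..2*pi} \<subseteq> {-(2*pi)..2*pi}"
proof
  fix y assume "y \<in> alpha_angle ` {0..2*pi}"
  then obtain x where x: "x \<in> {0..2*pi}" "y = alpha_angle x" by auto
  have "alpha_angle x \<le> alpha_angle 0"
    using alpha_angle_strict_antimono[of 0 x] x by (cases "x = 0") auto
  moreover have "alpha_angle (2*pi) \<le> alpha_angle x"
    using alpha_angle_strict_antimono[of x "2*pi"] x by (cases "x = 2*pi") auto
  moreover have "alpha_angle (2*pi) = alpha_angle 0 - 2*pi" by (simp add: alpha_angle_def)
  moreover have "0 \<le> alpha_angle 0" "alpha_angle 0 < 2*pi"
    using Arg2pi[of "alpha \<beta> 1"] by (auto simp: alpha_angle_def)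
  ultimately show "y \<in> {-(2*pi)..2*pi}" using x by auto
qed

text \<open>Change of variables along the lift. Its derivative is bounded away from 0 by
  compactness, with bound m, and the image lies in two periods; this gives the constant 2/m.\<close>

lemma comp_alpha_L1:
  obtains C where "0 \<le> C"
    "\<And>f :: complex \<Rightarrow> complex. integrable circ_meas (\<lambda>\<theta>. f (cis \<theta>)) \<Longrightarrow>
      integrable circ_meas (\<lambda>\<theta>. f (alpha \<beta> (cis \<theta>))) \<and>
      (\<integral>\<theta>. norm (f (alpha \<beta> (cis \<theta>))) \<partial>circ_meas) \<le> C * (\<integral>\<theta>. norm (f (cis \<theta>)) \<partial>circ_meas)"
proof -
  let ?S = "{0..2*pi}"
  obtain x where x: "x \<in> ?S" "\<forall>y\<in>?S. \<bar>alpha_angle_deriv x\<bar> \<le> \<bar>alpha_angle_deriv y\<bar>"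
    using continuous_attains_inf[of ?S "\<lambda>x. \<bar>alpha_angle_deriv x\<bar>"]
      continuous_on_rabs[OF continuous_on_alpha_angle_deriv[of ?S]] by auto
  define m where "m = \<bar>alpha_angle_deriv x\<bar>"
  have m: "m > 0" using alpha_angle_deriv_neg[of x] by (simp add: m_def)
  have mle: "m \<le> \<bar>alpha_angle_deriv y\<bar>" if "y \<in> ?S" for y using x that by (simp add: m_def)
  have inj: "inj_on alpha_angle ?S"
    by (rule inj_onI) (metis alpha_angle_strict_antimono less_irrefl linorder_neqE_linordered_idom)
  have ac: "continuous_on ?S alpha_angle"
    using has_derivative_alpha_angle by (meson DERIV_continuous continuous_on_eq_continuous_within)
  have img: "alpha_angle ` ?S \<in> sets lebesgue"
    using compact_continuous_image[OF ac] compact_Icc by (simp add: lmeasurable_compact fmeasurableD)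
  show ?thesis
  proof (rule that[of "2 / m"])
    show "0 \<le> 2 / m" using m by simp
    fix f :: "complex \<Rightarrow> complex" assume int: "integrable circ_meas (\<lambda>\<theta>. f (cis \<theta>))"
    define F where "F = (\<lambda>\<theta>. f (cis \<theta>))"
    have per: "F (x - 2*pi) = F x" for x by (simp add: F_def cis_divide[symmetric])
    have Fi: "F absolutely_integrable_on ?S" using int by (simp add: F_def integrable_circ_iff)
    have nFi: "(\<lambda>x. norm (F x)) absolutely_integrable_on ?S"
      using absolutely_integrable_norm[OF Fi] by (simp add: o_def)
    note per2 = two_periods[OF Fi per] and nper2 = two_periods[OF nFi, unfolded per, OF refl]
    have Fimg: "F absolutely_integrable_on alpha_angle ` ?S"
      by (rule set_integrable_subset[OF per2(1) img alpha_angle_image])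
    have nFimg: "(\<lambda>x. norm (F x)) absolutely_integrable_on alpha_angle ` ?S"
      by (rule set_integrable_subset[OF nper2(1) img alpha_angle_image])
    have G: "(\<lambda>x. \<bar>alpha_angle_deriv x\<bar> *\<^sub>R F (alpha_angle x)) absolutely_integrable_on ?S"
      using Fimg absolutely_integrable_change_of_variables_real[OF _ has_derivative_alpha_angle inj, of F] by auto
    have nG: "(\<lambda>x. \<bar>alpha_angle_deriv x\<bar> *\<^sub>R norm (F (alpha_angle x))) absolutely_integrable_on ?S \<and>
      integral ?S (\<lambda>x. \<bar>alpha_angle_deriv x\<bar> *\<^sub>R norm (F (alpha_angle x))) = integral (alpha_angle ` ?S) (\<lambda>x. norm (F x))"
      using nFimg has_absolute_integral_change_of_variables_real[OF _ has_derivative_alpha_angle inj,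
          of "\<lambda>x. norm (F x)" "integral (alpha_angle ` ?S) (\<lambda>x. norm (F x))"] by auto
    have Gi: "integrable circ_meas (\<lambda>x. \<bar>alpha_angle_deriv x\<bar> *\<^sub>R F (alpha_angle x))"
      using G by (simp add: integrable_circ_iff)
    have nGi: "integrable circ_meas (\<lambda>x. \<bar>alpha_angle_deriv x\<bar> * norm (F (alpha_angle x)))"
      using nG by (simp add: integrable_circ_iff)
    have eq: "F (alpha_angle x) = f (alpha \<beta> (cis x))" for x
      by (simp add: F_def cis_alpha_angle)
    have dm: "alpha_angle_deriv \<in> borel_measurable circ_meas"
      unfolding circ_meas_def
      by (intro continuous_imp_measurable_on_sets_lebesgue continuous_on_alpha_angle_deriv) auto
    \<comment> \<open>Composing a Lebesgue measurable function with a continuous one need not be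
      measurable. The weighted composition is measurable by the change of variables, and the weight
      has no zeros.\<close>
    have "(\<lambda>x. (1 / \<bar>alpha_angle_deriv x\<bar>) *\<^sub>R (\<bar>alpha_angle_deriv x\<bar> *\<^sub>R F (alpha_angle x))) \<in> borel_measurable circ_meas"
      using dm borel_measurable_integrable[OF Gi] by measurable
    moreover have "(1 / \<bar>alpha_angle_deriv x\<bar>) *\<^sub>R (\<bar>alpha_angle_deriv x\<bar> *\<^sub>R F (alpha_angle x)) = F (alpha_angle x)" for x
      using alpha_angle_deriv_neg[of x] by simp
    ultimately have Fm: "(\<lambda>x. F (alpha_angle x)) \<in> borel_measurable circ_meas" by simp
    have nle: "norm (F (alpha_angle x)) \<le> 1 / m * (\<bar>alpha_angle_deriv x\<bar> * norm (F (alpha_angle x)))" if "x \<in> ?S" for x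
    proof -
      have "m * norm (F (alpha_angle x)) \<le> \<bar>alpha_angle_deriv x\<bar> * norm (F (alpha_angle x))"
        using mle[OF that] by (rule mult_right_mono) simp
      then show ?thesis using m by (simp add: field_simps)
    qed
    have Fi': "integrable circ_meas (\<lambda>x. F (alpha_angle x))"
    proof (rule Bochner_Integration.integrable_bound)
      show "integrable circ_meas (\<lambda>x. 1 / m * (\<bar>alpha_angle_deriv x\<bar> * norm (F (alpha_angle x))))"
        using nGi by simp
      show "AE x in circ_meas. norm (F (alpha_angle x)) \<le> norm (1 / m * (\<bar>alpha_angle_deriv x\<bar> * norm (F (alpha_angle x))))"
      proof (rule AE_I2)
        fix x assume "x \<in> space circ_meas"
        then have "x \<in> ?S" by simp
        from nle[OF this] show "norm (F (alpha_angle x)) \<le> norm (1 / m * (\<bar>alpha_angle_deriv x\<bar> * norm (F (alpha_angle x))))"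
          unfolding real_norm_def by (meson abs_ge_self order_trans)
      qed
    qed (rule Fm)
    have "(\<integral>x. norm (F (alpha_angle x)) \<partial>circ_meas) \<le> (\<integral>x. 1 / m * (\<bar>alpha_angle_deriv x\<bar> * norm (F (alpha_angle x))) \<partial>circ_meas)"
      using nle Fi' nGi by (intro integral_mono) auto
    also have "\<dots> = 1 / m * (\<integral>x. \<bar>alpha_angle_deriv x\<bar> * norm (F (alpha_angle x)) \<partial>circ_meas)" by simp
    also have "(\<integral>x. \<bar>alpha_angle_deriv x\<bar> * norm (F (alpha_angle x)) \<partial>circ_meas) = integral (alpha_angle ` ?S) (\<lambda>x. norm (F x))"
      using nG integral_circ_eq[OF nGi] by simp
    also have "\<dots> \<le> integral {-(2*pi)..2*pi} (\<lambda>x. norm (F x))"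
      by (rule integral_subset_le[OF alpha_angle_image])
        (use nFimg nper2(1) set_lebesgue_integral_eq_integral(1) in auto)
    also have "\<dots> = 2 * (\<integral>x. norm (F x) \<partial>circ_meas)"
      using nper2(2) integral_circ_eq[of "\<lambda>x. norm (F x)"] nFi by (simp add: integrable_circ_iff)
    finally have "(\<integral>x. norm (F (alpha_angle x)) \<partial>circ_meas) \<le> 2 / m * (\<integral>x. norm (F x) \<partial>circ_meas)"
      using m by (simp add: divide_right_mono)
    with Fi' show "integrable circ_meas (\<lambda>\<theta>. f (alpha \<beta> (cis \<theta>))) \<and>
      (\<integral>\<theta>. norm (f (alpha \<beta> (cis \<theta>))) \<partial>circ_meas) \<le> 2 / m * (\<integral>\<theta>. norm (f (cis \<theta>)) \<partial>circ_meas)"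
      by (simp add: eq) (simp add: F_def)
  qed
qed

text \<open>The L^1 statement is used twice: for \<open>f\<close> to obtain measurability, and for
  |f|^p to obtain the moment bound.\<close>

lemma comp_alpha_Lp:
  assumes "1 \<le> p"
  obtains C where "0 \<le> C" "\<And>f. Lp p f \<Longrightarrow> Lp p (\<lambda>z. f (alpha \<beta> z)) \<and>
    p_moment p (\<lambda>z. f (alpha \<beta> z)) \<le> C * p_moment p f"
proof -
  obtain C where C: "0 \<le> C"
    "\<And>f :: complex \<Rightarrow> complex. integrable circ_meas (\<lambda>\<theta>. f (cis \<theta>)) \<Longrightarrow>
      integrable circ_meas (\<lambda>\<theta>. f (alpha \<beta> (cis \<theta>))) \<and>
      (\<integral>\<theta>. norm (f (alpha \<beta> (cis \<theta>))) \<partial>circ_meas) \<le> C * (\<integral>\<theta>. norm (f (cis \<theta>)) \<partial>circ_meas)"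
    using comp_alpha_L1 by blast
  show ?thesis
  proof (rule that[OF C(1)])
    fix f assume f: "Lp p f"
    have m: "(\<lambda>\<theta>. f (alpha \<beta> (cis \<theta>))) \<in> borel_measurable circ_meas"
      using C(2)[OF Lp_integrable[OF f assms]] by (auto dest: borel_measurable_integrable)
    have "integrable circ_meas (\<lambda>\<theta>. complex_of_real (norm (f (cis \<theta>)) powr p))"
      using Lp_integrable_powr[OF f] by simp
    from C(2)[of "\<lambda>z. complex_of_real (norm (f z) powr p)", OF this]
    have "integrable circ_meas (\<lambda>\<theta>. complex_of_real (norm (f (alpha \<beta> (cis \<theta>))) powr p))"
      and "p_moment p (\<lambda>z. f (alpha \<beta> z)) \<le> C * p_moment p f"
      by (simp_all add: p_moment_def)
    moreover from integrable_Re[OF this(1)]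
    have "integrable circ_meas (\<lambda>\<theta>. norm (f (alpha \<beta> (cis \<theta>))) powr p)" by simp
    ultimately show "Lp p (\<lambda>z. f (alpha \<beta> z)) \<and> p_moment p (\<lambda>z. f (alpha \<beta> z)) \<le> C * p_moment p f"
      using m by (simp add: Lp_def)
  qed
qed

end

section \<open>Hardy spaces and the operators\<close>

lemma fourier_coeff_cnj_poly_pos:
  assumes "0 < n"
  shows "fourier_coeff (\<lambda>z. cnj (poly A z)) n = 0"
proof -
  have "fourier_coeff (\<lambda>z. cnj z * cnj (poly A z)) (n - 1) = 0"
    using fourier_coeff_cnj_poly_nonneg[of "n - 1" "pCons 0 A"] assms by simp
  then show ?thesis by (simp add: fourier_coeff_shift_cnj)
qed

lemma fourier_coeff_const: "fourier_coeff (\<lambda>_. c) n = (if n = 0 then c else 0)"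
proof -
  consider "n < 0" | "n = 0" | "n > 0" by linarith
  then show ?thesis
  proof cases
    case 1
    moreover have "fourier_coeff (\<lambda>_. c) n = fourier_coeff (poly [:c:]) n"
      by (rule fourier_coeff_cong) simp
    ultimately show ?thesis using fourier_coeff_poly_neg[of n "[:c:]"] by simp
  next
    case 2
    then show ?thesis by (simp add: fourier_coeff_def scaleR_conv_of_real)
  next
    case 3
    then show ?thesis using fourier_coeff_cnj_poly_pos[of n "[:cnj c:]"] by simp
  qed
qed

lemma fourier_coeff_poly_finite:
  obtains N where "\<And>k. int N \<le> k \<Longrightarrow> fourier_coeff (poly A) k = 0"
proof -
  have "\<exists>N. \<forall>k\<ge>int N. fourier_coeff (poly A) k = 0"
  proof (induction A)
    case 0
    then show ?case by (auto simp: fourier_coeff_def)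
  next
    case (pCons a A)
    then obtain N where N: "\<And>k. int N \<le> k \<Longrightarrow> fourier_coeff (poly A) k = 0" by auto
    have "continuous_on (sphere 0 1) (\<lambda>z. z * poly A z)" by (intro continuous_intros)
    from Lp_integrable[OF Lp_continuous[OF this, of 1]]
    have i: "integrable circ_meas (\<lambda>\<theta>. cis \<theta> * poly A (cis \<theta>))" by simp
    have "fourier_coeff (poly (pCons a A)) k = 0" if "int (Suc N) \<le> k" for k
    proof -
      have "fourier_coeff (poly (pCons a A)) k = fourier_coeff (\<lambda>z. a + z * poly A z) k"
        by (rule fourier_coeff_cong) simp
      also have "\<dots> = fourier_coeff (\<lambda>_. a) k + fourier_coeff (\<lambda>z. z * poly A z) k"
        by (rule fourier_coeff_add) (use i in auto)
      finally show ?thesis using that N[of "k - 1"] by (simp add: fourier_coeff_const fourier_coeff_shift)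
    qed
    then show ?case by blast
  qed
  then show ?thesis using that by blast
qed

lemma Hp_Lp: "Hp p f \<Longrightarrow> Lp p f"
  by (simp add: Hp_def)

lemma Hp_integrable: "Hp p f \<Longrightarrow> 1 < p \<Longrightarrow> integrable circ_meas (\<lambda>\<theta>. f (cis \<theta>))"
  using Lp_integrable[OF Hp_Lp] by simp

lemma Hp_add: "Hp p f \<Longrightarrow> Hp p g \<Longrightarrow> 1 < p \<Longrightarrow> Hp p (\<lambda>z. f z + g z)"
  using Hp_integrable[of p f] Hp_integrable[of p g]
  by (auto simp: Hp_def fourier_coeff_add intro: Lp_add)

lemma Hp_cmult: "Hp p f \<Longrightarrow> 1 < p \<Longrightarrow> Hp p (\<lambda>z. c * f z)"
  by (auto simp: Hp_def fourier_coeff_cmult intro: Lp_cmult)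

lemma Hp_const: "1 < p \<Longrightarrow> Hp p (\<lambda>_. c)"
  by (simp add: Hp_def fourier_coeff_const Lp_continuous)

lemma fourier_coeff_unique:
  assumes "Lp p f" "Lp p g" "1 < p" "\<And>n. fourier_coeff f n = fourier_coeff g n"
  shows "circ_ae_eq f g"
proof -
  have p: "0 < p" "1 \<le> p" using assms by auto
  have "circ_ae_eq (\<lambda>z. f z - g z) (\<lambda>_. 0)"
  proof (rule fourier_coeff_unique_0[OF Lp_diff[OF assms(1,2) p(1)] assms(3)])
    show "fourier_coeff (\<lambda>z. f z - g z) n = 0" for n
      using fourier_coeff_diff[OF Lp_integrable[OF assms(1) p(2)] Lp_integrable[OF assms(2) p(2)]] assms(4) by simp
  qed
  then show ?thesis by (simp add: circ_ae_eq_def)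
qed

text \<open>If A + cnj B is close to g in L^p, then the projection of the error is g - A, which is
  small by the Riesz bound.\<close>

lemma Hp_poly_dense:
  assumes g: "Hp p g" and p1: "1 < p" and e: "0 < e"
  obtains A where "p_moment p (\<lambda>z. g z - poly A z) < e"
proof -
  have p: "0 < p" using p1 by simp
  have Lpg: "Lp p g" using g by (rule Hp_Lp)
  obtain K where K: "0 \<le> K" "\<And>f. Lp p f \<Longrightarrow>
    \<exists>g. Hp p g \<and> (\<forall>n\<ge>0. fourier_coeff g n = fourier_coeff f n) \<and> p_moment p g \<le> K * p_moment p f"
    using Riesz_projection_exists[OF p1] by blast
  \<comment> \<open>K + 1 instead of K covers K = 0 and makes the final inequality strict.\<close>
  obtain t where t: "trig_poly t" "p_moment p (\<lambda>z. g z - t z) < e / (K + 1)"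
    using trig_poly_dense[OF Lpg p, of "e / (K + 1)"] e K(1) by auto
  obtain A B where B0: "poly B 0 = 0" and AB: "\<And>z. norm z = 1 \<Longrightarrow> t z = poly A z + cnj (poly B z)"
    using trig_poly_normalE[OF t(1)] by blast
  have Lpt: "Lp p t" by (rule Lp_continuous[OF continuous_on_trig_poly[OF t(1)] p])
  obtain h where h: "Hp p h" "\<And>n. n \<ge> 0 \<Longrightarrow> fourier_coeff h n = fourier_coeff (\<lambda>z. g z - t z) n"
    "p_moment p h \<le> K * p_moment p (\<lambda>z. g z - t z)"
    using K(2)[OF Lp_diff[OF Lpg Lpt p]] by blast
  have LpB: "Lp p (\<lambda>z. cnj (poly B z))" using p by (intro Lp_continuous continuous_intros)
  have int: "integrable circ_meas (\<lambda>\<theta>. u (cis \<theta>))" if "Lp p u" for u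
    using Lp_integrable[OF that] p1 by simp
  have ae: "circ_ae_eq h (\<lambda>z. g z - poly A z)"
  proof (rule fourier_coeff_unique[OF Hp_Lp[OF h(1)] Lp_diff[OF Lpg Lp_poly[OF p] p] p1])
    fix n
    have eq: "fourier_coeff (\<lambda>z. g z - poly A z) n = fourier_coeff g n - fourier_coeff (poly A) n"
      by (rule fourier_coeff_diff[OF int int]) (use Lpg Lp_poly[OF p] in auto)
    show "fourier_coeff h n = fourier_coeff (\<lambda>z. g z - poly A z) n"
    proof (cases "n < 0")
      case True
      then show ?thesis using eq g h(1) fourier_coeff_poly_neg[of n A] by (simp add: Hp_def)
    next
      case False
      have "fourier_coeff t n = fourier_coeff (\<lambda>z. poly A z + cnj (poly B z)) n"
        by (rule fourier_coeff_cong) (rule AB)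
      also have "\<dots> = fourier_coeff (poly A) n + fourier_coeff (\<lambda>z. cnj (poly B z)) n"
        by (rule fourier_coeff_add[OF int int]) (use LpB Lp_poly[OF p] in auto)
      also have "\<dots> = fourier_coeff (poly A) n"
        using fourier_coeff_cnj_poly_nonneg[of n B] B0 False by simp
      finally show ?thesis
        using eq False h(2)[of n] fourier_coeff_diff[OF int[OF Lpg] int[OF Lpt], of n] by simp
    qed
  qed
  have "p_moment p (\<lambda>z. g z - poly A z) = p_moment p h"
    using p_moment_cong_AE[OF ae Hp_Lp[OF h(1)] p] by simp
  also have "\<dots> \<le> K * p_moment p (\<lambda>z. g z - t z)" by (rule h(3))
  also have "\<dots> \<le> K * (e / (K + 1))" using t(2) K(1) by (intro mult_left_mono) auto
  also have "\<dots> < e" using e K(1) by (simp add: field_simps)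
  finally show ?thesis by (rule that)
qed

lemma Lp_norm_less:
  assumes "0 < p" "0 < e" "p_moment p f < 2 * pi * e powr p"
  shows "Lp_norm p f < e"
proof -
  have "p_moment p f / (2 * pi) < e powr p" using assms by (simp add: field_simps)
  then have "(p_moment p f / (2 * pi)) powr (1 / p) < (e powr p) powr (1 / p)"
    using assms(1) p_moment_nonneg[of p f] by (intro powr_less_mono2) auto
  also have "\<dots> = e" using assms by (simp add: powr_powr)
  finally show ?thesis by (simp add: Lp_norm_def p_moment_def)
qed

lemma rieszP_Hp:
  assumes "Lp p f" "1 < p"
  shows "Hp p (rieszP p f)" "\<And>n. 0 \<le> n \<Longrightarrow> fourier_coeff (rieszP p f) n = fourier_coeff f n"
proof -
  have "\<exists>g. Hp p g \<and> (\<forall>n\<ge>0. fourier_coeff g n = fourier_coeff f n)"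
    using Riesz_projection_exists[OF assms(2)] assms(1) by metis
  from someI_ex[OF this]
  show "Hp p (rieszP p f)" "\<And>n. 0 \<le> n \<Longrightarrow> fourier_coeff (rieszP p f) n = fourier_coeff f n"
    unfolding rieszP_def by blast+
qed

section \<open>Multiplication and division by \<chi> in terms of Fourier coefficients\<close>

context
  fixes \<beta> :: complex and p :: real
  assumes \<beta>: "cmod \<beta> > 1" and p1: "1 < p"
begin

lemma p_pos: "0 < p" "1 \<le> p"
  using p1 by auto

lemma Lp_int: "Lp p f \<Longrightarrow> integrable circ_meas (\<lambda>\<theta>. f (cis \<theta>))"
  using Lp_integrable p1 by fastforce

text \<open>This value of \<lambda>^2 is what makes \<chi> \<circ> \<alpha> the reciprocal of
  \<chi>.\<close>

lemma lam_square: "lam \<beta> * lam \<beta> = 1 - \<beta> * cnj \<beta>"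
proof -
  have "(cmod \<beta>)\<^sup>2 - 1 \<ge> 0" using \<beta> by simp
  then have "complex_of_real (sqrt ((cmod \<beta>)\<^sup>2 - 1)) * complex_of_real (sqrt ((cmod \<beta>)\<^sup>2 - 1)) = of_real ((cmod \<beta>)\<^sup>2 - 1)"
    by (metis of_real_mult real_sqrt_mult_self abs_of_nonneg)
  then have "lam \<beta> * lam \<beta> = - (of_real ((cmod \<beta>)\<^sup>2 - 1))"
    by (simp add: lam_def algebra_simps)
  then show ?thesis using complex_norm_square[of \<beta>] by simp
qed

lemma lam_nonzero: "lam \<beta> \<noteq> 0"
proof -
  have "(cmod \<beta>)\<^sup>2 - 1 > 0" using \<beta> by simp
  then show ?thesis by (simp add: lam_def)
qed

lemma chi_circ: "norm z = 1 \<Longrightarrow> chi \<beta> z = (cnj \<beta> * z - 1) / lam \<beta>"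
  using denom_nonzero[OF \<beta>, of z] lam_nonzero by (auto simp: chi_def alpha_minus_def)

lemma chi_nonzero: "norm z = 1 \<Longrightarrow> chi \<beta> z \<noteq> 0"
  using denom_nonzero[OF \<beta>, of z] lam_nonzero by (simp add: chi_circ)

lemma chi_alpha: "norm z = 1 \<Longrightarrow> chi \<beta> (alpha \<beta> z) = 1 / chi \<beta> z"
proof -
  assume z: "norm z = 1"
  have d: "cnj \<beta> * z - 1 \<noteq> 0" using denom_nonzero[OF \<beta> z] .
  have "cnj \<beta> * alpha \<beta> z - 1 = lam \<beta> * lam \<beta> / (cnj \<beta> * z - 1)"
    unfolding lam_square alpha_def using d by (simp add: field_simps)
  then have "(cnj \<beta> * alpha \<beta> z - 1) / lam \<beta> = lam \<beta> / (cnj \<beta> * z - 1)"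
    using lam_nonzero by simp
  then show ?thesis
    using chi_circ[OF z] chi_circ[OF norm_alpha[OF \<beta> z]] by simp
qed

text \<open>\<alpha> is affine in 1/\<chi>, so composing a polynomial with \<alpha> amounts to
  repeated division by \<chi>.\<close>

lemma alpha_chi: "norm z = 1 \<Longrightarrow> alpha \<beta> z = 1 / cnj \<beta> + lam \<beta> / cnj \<beta> * (1 / chi \<beta> z)"
proof -
  assume z: "norm z = 1"
  have d: "cnj \<beta> * z - 1 \<noteq> 0" using denom_nonzero[OF \<beta> z] .
  have b: "cnj \<beta> \<noteq> 0" using \<beta> by auto
  have "1 / cnj \<beta> + lam \<beta> / cnj \<beta> * (1 / chi \<beta> z) = 1 / cnj \<beta> + (lam \<beta> * lam \<beta>) / (cnj \<beta> * (cnj \<beta> * z - 1))"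
    by (simp add: chi_circ[OF z])
  also have "\<dots> = alpha \<beta> z"
    unfolding lam_square alpha_def using d b by (simp add: field_simps)
  finally show ?thesis by simp
qed

lemma continuous_on_chi: "continuous_on (sphere 0 1) (chi \<beta>)"
proof -
  have "continuous_on (sphere 0 1) (\<lambda>z. (cnj \<beta> * z - 1) / lam \<beta>)"
    using lam_nonzero by (intro continuous_intros) auto
  then show ?thesis by (rule continuous_on_eq) (simp add: chi_circ)
qed

lemma continuous_on_inverse_chi: "continuous_on (sphere 0 1) (\<lambda>z. 1 / chi \<beta> z)"
  using chi_nonzero by (intro continuous_intros continuous_on_chi) auto

lemma Lp_chi_mult: "Lp p f \<Longrightarrow> Lp p (\<lambda>z. chi \<beta> z * f z)"
  by (rule Lp_continuous_mult[OF _ continuous_on_chi p_pos(1)])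

lemma Lp_div_chi: "Lp p f \<Longrightarrow> Lp p (\<lambda>z. f z / chi \<beta> z)"
  using Lp_continuous_mult[OF _ continuous_on_inverse_chi p_pos(1), of f] by simp

lemma fourier_coeff_chi_mult:
  assumes f: "Lp p f"
  shows "fourier_coeff (\<lambda>z. chi \<beta> z * f z) k = (cnj \<beta> * fourier_coeff f (k - 1) - fourier_coeff f k) / lam \<beta>"
proof -
  have zf: "Lp p (\<lambda>z. z * f z)" by (rule Lp_continuous_mult[OF f _ p_pos(1)]) (intro continuous_intros)
  have "fourier_coeff (\<lambda>z. chi \<beta> z * f z) k = fourier_coeff (\<lambda>z. cnj \<beta> / lam \<beta> * (z * f z) - 1 / lam \<beta> * f z) k"
    by (rule fourier_coeff_cong) (simp add: chi_circ diff_divide_distrib left_diff_distrib)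
  also have "\<dots> = fourier_coeff (\<lambda>z. cnj \<beta> / lam \<beta> * (z * f z)) k - fourier_coeff (\<lambda>z. 1 / lam \<beta> * f z) k"
    by (intro fourier_coeff_diff Lp_int[OF Lp_cmult[OF zf p_pos(1)]] Lp_int[OF Lp_cmult[OF f p_pos(1)]])
  also have "\<dots> = (cnj \<beta> * fourier_coeff f (k - 1) - fourier_coeff f k) / lam \<beta>"
    unfolding fourier_coeff_cmult fourier_coeff_shift by (simp add: diff_divide_distrib)
  finally show ?thesis .
qed

text \<open>The formula for multiplication by \<chi>, read for f/\<chi>. It is a first-order
  recursion, so one value of the coefficients of f/\<chi> determines all others.\<close>

lemma fourier_coeff_div_chi:
  assumes f: "Lp p f"
  shows "cnj \<beta> * fourier_coeff (\<lambda>z. f z / chi \<beta> z) (k - 1) - fourier_coeff (\<lambda>z. f z / chi \<beta> z) k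
    = lam \<beta> * fourier_coeff f k"
proof -
  have "fourier_coeff f k = fourier_coeff (\<lambda>z. chi \<beta> z * (f z / chi \<beta> z)) k"
    by (rule fourier_coeff_cong) (simp add: chi_nonzero)
  then show ?thesis
    using fourier_coeff_chi_mult[OF Lp_div_chi[OF f], of k] lam_nonzero by simp
qed

text \<open>Above the support the coefficients of \<open>f/\<chi>\<close> would grow like powers of \<open>\<beta>\<close>, so boundedness kills them.\<close>

lemma fourier_coeff_div_chi_eq_0:
  assumes f: "Lp p f" and supp: "\<And>k. k > N \<Longrightarrow> fourier_coeff f k = 0" and k: "k \<ge> N"
  shows "fourier_coeff (\<lambda>z. f z / chi \<beta> z) k = 0"
proof -
  define u where "u = fourier_coeff (\<lambda>z. f z / chi \<beta> z)"
  define M where "M = (\<integral>\<theta>. norm (f (cis \<theta>) / chi \<beta> (cis \<theta>)) \<partial>circ_meas) / (2 * pi)"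
  have bound: "norm (u k) \<le> M" for k
    using norm_fourier_coeff_le[of "\<lambda>z. f z / chi \<beta> z" k] by (simp add: u_def M_def field_simps)
  have step: "u (N + int j) = cnj \<beta> ^ j * u N" for j
  proof (induction j)
    case (Suc j)
    have "cnj \<beta> * u (N + int (Suc j) - 1) - u (N + int (Suc j)) = 0"
      using fourier_coeff_div_chi[OF f, of "N + int (Suc j)"] supp[of "N + int (Suc j)"] by (simp add: u_def)
    then have "u (N + int (Suc j)) = cnj \<beta> * u (N + int j)" by simp
    then show ?case using Suc by simp
  qed simp
  \<comment> \<open>The recursion is already homogeneous from N to N + 1, so the index N itself is
    included: division by \<chi> lowers the top of the support by at least one.\<close>
  have "u N = 0"
  proof (rule ccontr)
    assume "u N \<noteq> 0"
    then have pos: "norm (u N) > 0" by simp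
    obtain j where "M / norm (u N) < cmod \<beta> ^ j" using real_arch_pow[OF \<beta>] by blast
    then have "M < norm (u (N + int j))" using pos by (simp add: step norm_mult norm_power field_simps)
    then show False using bound[of "N + int j"] by simp
  qed
  then show ?thesis using step[of "nat (k - N)"] k by (simp add: u_def)
qed

lemma Hp_chi_mult: "Hp p f \<Longrightarrow> Hp p (\<lambda>z. chi \<beta> z * f z)"
  using fourier_coeff_chi_mult[of f] Lp_chi_mult[of f] by (simp add: Hp_def)

text \<open>\<open>\<chi>\<close> has a single simple zero in the disc; \<open>c\<close> is the value of \<open>f\<close> there.\<close>

lemma Hp_div_chi:
  assumes f: "Hp p f"
  obtains c where "Hp p (\<lambda>z. (f z - c) / chi \<beta> z)"
proof -
  have Lpf: "Lp p f" using f by (rule Hp_Lp)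
  have Lp1: "Lp p (\<lambda>_. 1)" by (rule Hp_Lp[OF Hp_const[OF p1]])
  have b: "cnj \<beta> \<noteq> 0" using \<beta> by auto
  define u where "u = fourier_coeff (\<lambda>z. f z / chi \<beta> z)"
  define v where "v = fourier_coeff (\<lambda>z. 1 / chi \<beta> z)"
  have v0: "v 0 = 0"
    unfolding v_def by (rule fourier_coeff_div_chi_eq_0[OF Lp1, of 0]) (auto simp: fourier_coeff_const)
  then have v1: "v (- 1) = lam \<beta> / cnj \<beta>"
    using fourier_coeff_div_chi[OF Lp1, of 0] b by (simp add: v_def fourier_coeff_const field_simps)
  \<comment> \<open>This makes the coefficients of f/\<chi> and c/\<chi> agree at -1. Below -1 both
    obey the same homogeneous recursion and hence agree throughout.\<close>
  define c where "c = u (- 1) / v (- 1)"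
  have uc: "u (- 1) = c * v (- 1)" using v1 b lam_nonzero by (simp add: c_def)
  have uv: "u (- 1 - int j) = c * v (- 1 - int j)" for j
  proof (induction j)
    case (Suc j)
    define k where "k = - 1 - int j"
    have k: "k < 0" "- 1 - int (Suc j) = k - 1" by (auto simp: k_def)
    have "cnj \<beta> * u (k - 1) = u k"
      using fourier_coeff_div_chi[OF Lpf, of k] f k by (simp add: u_def Hp_def)
    moreover have "cnj \<beta> * v (k - 1) = v k"
      using fourier_coeff_div_chi[OF Lp1, of k] k by (simp add: v_def fourier_coeff_const)
    ultimately have "cnj \<beta> * u (k - 1) = cnj \<beta> * (c * v (k - 1))"
      using Suc unfolding k_def by (simp add: mult.left_commute)
    then show ?case using b unfolding k(2) by simp
  qed (use uc in simp)
  show ?thesis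
  proof (rule that[of c])
    have eq: "(\<lambda>z. (f z - c) / chi \<beta> z) = (\<lambda>z. f z / chi \<beta> z - c * (1 / chi \<beta> z))"
      by (simp add: diff_divide_distrib)
    have L1: "Lp p (\<lambda>z. f z / chi \<beta> z)" "Lp p (\<lambda>z. c * (1 / chi \<beta> z))"
      using Lp_div_chi[OF Lpf] Lp_cmult[OF Lp_div_chi[OF Lp1] p_pos(1)] by auto
    have "fourier_coeff (\<lambda>z. f z / chi \<beta> z - c * (1 / chi \<beta> z)) k = 0" if "k < 0" for k
    proof -
      have "fourier_coeff (\<lambda>z. f z / chi \<beta> z - c * (1 / chi \<beta> z)) k = u k - c * v k"
        unfolding fourier_coeff_diff[OF Lp_int[OF L1(1)] Lp_int[OF L1(2)]] fourier_coeff_cmult u_def v_def ..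
      then show ?thesis using uv[of "nat (- 1 - k)"] that by simp
    qed
    then show "Hp p (\<lambda>z. (f z - c) / chi \<beta> z)"
      unfolding eq Hp_def using Lp_diff[OF L1 p_pos(1)] by blast
  qed
qed

section \<open>Composition of \<open>Hp\<close> functions with \<alpha>\<close>

lemma Lp_comp_alpha: "Lp p f \<Longrightarrow> Lp p (\<lambda>z. f (alpha \<beta> z))"
  using comp_alpha_Lp[OF \<beta> p_pos(2)] by metis

text \<open>Induction by Horner's scheme: each further factor \<alpha> = const + const/\<chi> cannot
  raise the top of the support above 0.\<close>

lemma fourier_coeff_poly_alpha:
  "k > 0 \<Longrightarrow> fourier_coeff (\<lambda>z. poly A (alpha \<beta> z)) k = 0"
proof (induction A arbitrary: k)
  case 0
  then show ?case by (simp add: fourier_coeff_def)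
next
  case (pCons a A)
  define f where "f = (\<lambda>z. poly A (alpha \<beta> z))"
  have f: "Lp p f" unfolding f_def by (rule Lp_comp_alpha[OF Lp_poly[OF p_pos(1)]])
  have f0: "fourier_coeff f k = 0" if "k > 0" for k using pCons.IH[OF that] by (simp add: f_def)
  have fx: "fourier_coeff (\<lambda>z. f z / chi \<beta> z) k = 0"
    by (rule fourier_coeff_div_chi_eq_0[OF f f0, of 0]) (use pCons.prems in auto)
  have "fourier_coeff (\<lambda>z. poly (pCons a A) (alpha \<beta> z)) k =
    fourier_coeff (\<lambda>z. a + (1 / cnj \<beta> * f z + lam \<beta> / cnj \<beta> * (f z / chi \<beta> z))) k"
    by (rule fourier_coeff_cong) (simp add: alpha_chi f_def algebra_simps)
  also have "\<dots> = fourier_coeff (\<lambda>_. a) k + fourier_coeff (\<lambda>z. 1 / cnj \<beta> * f z + lam \<beta> / cnj \<beta> * (f z / chi \<beta> z)) k"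
    by (intro fourier_coeff_add Lp_int Lp_add[OF Lp_cmult[OF f] Lp_cmult[OF Lp_div_chi[OF f]]]
        p_pos Hp_Lp[OF Hp_const[OF p1]])
  also have "fourier_coeff (\<lambda>z. 1 / cnj \<beta> * f z + lam \<beta> / cnj \<beta> * (f z / chi \<beta> z)) k =
    fourier_coeff (\<lambda>z. 1 / cnj \<beta> * f z) k + fourier_coeff (\<lambda>z. lam \<beta> / cnj \<beta> * (f z / chi \<beta> z)) k"
    by (rule fourier_coeff_add[OF Lp_int[OF Lp_cmult[OF f p_pos(1)]] Lp_int[OF Lp_cmult[OF Lp_div_chi[OF f] p_pos(1)]]])
  finally show ?case
    unfolding fourier_coeff_cmult fx f0[OF pCons.prems] using pCons.prems by (simp add: fourier_coeff_const)
qed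

text \<open>\<alpha> carries the exterior of the disc into the disc, so f \<circ> \<alpha> is
  antianalytic. The proof uses density of polynomials: a fixed coefficient and composition with
  \<alpha> are both continuous in the p-th moment.\<close>

lemma fourier_coeff_comp_alpha:
  assumes f: "Hp p f" and k: "k > 0"
  shows "fourier_coeff (\<lambda>z. f (alpha \<beta> z)) k = 0"
proof -
  have Lpf: "Lp p f" using f by (rule Hp_Lp)
  obtain C where C: "0 \<le> C" "\<And>f. Lp p f \<Longrightarrow> Lp p (\<lambda>z. f (alpha \<beta> z)) \<and>
    p_moment p (\<lambda>z. f (alpha \<beta> z)) \<le> C * p_moment p f"
    using comp_alpha_Lp[OF \<beta> p_pos(2)] by blast
  define c where "c = fourier_coeff (\<lambda>z. f (alpha \<beta> z)) k"
  have "2 * pi * norm c powr p \<le> 0"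
  proof (rule le_if_le_add_mult[where K = "2 powr p * C"])
    fix e :: real assume e: "0 < e"
    obtain A where A: "p_moment p (\<lambda>z. f z - poly A z) < e"
      using Hp_poly_dense[OF f p1 e] by blast
    have LpA: "Lp p (poly A)" by (rule Lp_poly[OF p_pos(1)])
    define g where "g = (\<lambda>z. f z - poly A z)"
    have g: "Lp p g" unfolding g_def by (rule Lp_diff[OF Lpf LpA p_pos(1)])
    have "fourier_coeff (\<lambda>z. g (alpha \<beta> z)) k = c - fourier_coeff (\<lambda>z. poly A (alpha \<beta> z)) k"
      unfolding c_def g_def
      by (rule fourier_coeff_diff[OF Lp_int[OF Lp_comp_alpha[OF Lpf]] Lp_int[OF Lp_comp_alpha[OF LpA]]])
    then have "2 * pi * norm c powr p \<le> 2 powr p * p_moment p (\<lambda>z. g (alpha \<beta> z))"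
      using fourier_coeff_powr_le[OF Lp_comp_alpha[OF g] p_pos(2), of k] fourier_coeff_poly_alpha[OF k] by simp
    also have "\<dots> \<le> 2 powr p * (C * p_moment p g)"
      using C(2)[OF g] by (intro mult_left_mono) auto
    also have "\<dots> \<le> 2 powr p * (C * e)"
      using A C(1) by (intro mult_left_mono) (auto simp: g_def)
    finally show "2 * pi * norm c powr p \<le> 0 + 2 powr p * C * e" by simp
  qed (use C in auto)
  then have "norm c powr p = 0"
    by (metis antisym mult_le_0_iff not_le pi_gt_zero powr_ge_zero zero_less_mult_iff zero_less_numeral)
  then show ?thesis by (simp add: c_def)
qed

text \<open>The exponent j counts what remains when the factor 1/\<chi> of \<open>J_alpha\<close>
  meets the extra factor \<chi>, 1 or 1/\<chi> in the Hankel symbol: 0, 1 or 2.\<close>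

definition alpha_sym :: "nat \<Rightarrow> complex \<Rightarrow> (complex \<Rightarrow> complex) \<Rightarrow> complex \<Rightarrow> complex" where
  "alpha_sym j \<epsilon> f z = f z + \<epsilon> * (f (alpha \<beta> z) / chi \<beta> z ^ j)"

lemma Lp_alpha_power: "Lp p f \<Longrightarrow> Lp p (\<lambda>z. f (alpha \<beta> z) / chi \<beta> z ^ j)"
proof (induction j)
  case 0
  then show ?case using Lp_comp_alpha[of f] by simp
next
  case (Suc j)
  then show ?case using Lp_div_chi[of "\<lambda>z. f (alpha \<beta> z) / chi \<beta> z ^ j"] by (simp add: mult.commute)
qed

lemma Lp_alpha_sym: "Lp p f \<Longrightarrow> Lp p (alpha_sym j \<epsilon> f)"
  using Lp_add[OF _ Lp_cmult[OF Lp_alpha_power p_pos(1)] p_pos(1), of f f \<epsilon> j]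
  by (simp add: alpha_sym_def[abs_def])

text \<open>Each division by \<chi> pushes the support down by one. For j = 1 this says that
  \<open>J_alpha\<close> maps \<open>Hp\<close> into functions with only negative
  coefficients.\<close>

lemma fourier_coeff_alpha_power:
  assumes f: "Hp p f"
  shows "k > - int j \<Longrightarrow> fourier_coeff (\<lambda>z. f (alpha \<beta> z) / chi \<beta> z ^ j) k = 0"
proof (induction j arbitrary: k)
  case 0
  then show ?case using fourier_coeff_comp_alpha[OF f] by simp
next
  case (Suc j)
  have "fourier_coeff (\<lambda>z. f (alpha \<beta> z) / chi \<beta> z ^ j / chi \<beta> z) k = 0"
    by (rule fourier_coeff_div_chi_eq_0[OF Lp_alpha_power[OF Hp_Lp[OF f]], of "- int j"])
      (use Suc in auto)
  then show ?case by (simp add: mult.commute)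
qed

lemma alpha_sym_add_cmult:
  "alpha_sym j \<epsilon> (\<lambda>z. f z + c * g z) z = alpha_sym j \<epsilon> f z + c * alpha_sym j \<epsilon> g z"
  by (simp add: alpha_sym_def algebra_simps add_divide_distrib)

text \<open>The pairs \<open>(j, \<epsilon>)\<close> that occur for the four operators.\<close>

definition admissible :: "nat \<Rightarrow> complex \<Rightarrow> bool" where
  "admissible j \<epsilon> \<longleftrightarrow> (j = 2 \<and> \<epsilon> = -1) \<or> (j = 0 \<and> \<epsilon> = 1) \<or> (j = 1 \<and> (\<epsilon> = 1 \<or> \<epsilon> = -1))"

text \<open>Multiplying by \<open>1/\<chi>\<close> leaves \<open>H\<^sup>p\<close> only by a multiple of \<open>1/\<chi>\<close>, which is absorbed by a correction \<open>r\<close>;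
  such an \<open>r\<close> exists only for admissible signs.\<close>

lemma alpha_sym_module:
  assumes f: "Hp p f" and adm: "admissible j \<epsilon>"
  obtains g where "Hp p g"
    "\<And>z. norm z = 1 \<Longrightarrow> alpha_sym j \<epsilon> g z = (chi \<beta> z + 1 / chi \<beta> z) * alpha_sym j \<epsilon> f z"
proof -
  obtain c where c: "Hp p (\<lambda>z. (f z - c) / chi \<beta> z)" using Hp_div_chi[OF f] by blast
  obtain r where r: "Hp p r"
    and req: "\<And>z. norm z = 1 \<Longrightarrow>
      r z + \<epsilon> * (r (alpha \<beta> z) / chi \<beta> z ^ j) = c / chi \<beta> z + \<epsilon> * (c * chi \<beta> z / chi \<beta> z ^ j)"
  proof -
    \<comment> \<open>For j = 2 the right side cancels, so r = 0. For j = 0 it is c/\<chi> + c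
      \<chi>, obtained from r = c \<chi> by \<chi> \<circ> \<alpha> = 1/\<chi>. For j = 1 it is
      c/\<chi> + \<epsilon> c, obtained from the constant r = \<epsilon> c because \<epsilon>^2 =
      1.\<close>
    consider "j = 2" "\<epsilon> = -1" | "j = 0" "\<epsilon> = 1" | "j = 1" "\<epsilon> * \<epsilon> = 1"
      using adm by (auto simp: admissible_def)
    then show thesis
    proof cases
      case 1
      show thesis
        by (rule that[of "\<lambda>_. 0"]) (use Hp_const[OF p1] 1 chi_nonzero in \<open>auto simp: power2_eq_square\<close>)
    next
      case 2
      show thesis
        by (rule that[of "\<lambda>z. chi \<beta> z * c"])
          (use Hp_chi_mult[OF Hp_const[OF p1]] 2 chi_alpha in \<open>auto simp: mult.commute\<close>)
    next
      case 3
      show thesis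
        by (rule that[of "\<lambda>_. \<epsilon> * c"]) (use Hp_const[OF p1] 3 chi_nonzero in \<open>auto simp flip: mult.assoc\<close>)
    qed
  qed
  show ?thesis
  proof (rule that)
    show "Hp p (\<lambda>z. chi \<beta> z * f z + (f z - c) / chi \<beta> z + r z)"
      by (intro Hp_add Hp_chi_mult c r f p1)
    fix z :: complex assume z: "norm z = 1"
    have x: "chi \<beta> z \<noteq> 0" using chi_nonzero[OF z] .
    have "alpha_sym j \<epsilon> (\<lambda>z. chi \<beta> z * f z + (f z - c) / chi \<beta> z + r z) z =
      (chi \<beta> z + 1 / chi \<beta> z) * alpha_sym j \<epsilon> f z +
      ((r z + \<epsilon> * (r (alpha \<beta> z) / chi \<beta> z ^ j)) - (c / chi \<beta> z + \<epsilon> * (c * chi \<beta> z / chi \<beta> z ^ j)))"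
      unfolding alpha_sym_def chi_alpha[OF z]
      by (simp add: algebra_simps add_divide_distrib diff_divide_distrib)
    then show "alpha_sym j \<epsilon> (\<lambda>z. chi \<beta> z * f z + (f z - c) / chi \<beta> z + r z) z =
      (chi \<beta> z + 1 / chi \<beta> z) * alpha_sym j \<epsilon> f z"
      using req[OF z] by simp
  qed
qed

lemma alpha_sym_module_power:
  assumes f: "Hp p f" and adm: "admissible j \<epsilon>"
  shows "\<exists>g. Hp p g \<and> (\<forall>z. norm z = 1 \<longrightarrow>
    alpha_sym j \<epsilon> g z = (chi \<beta> z + 1 / chi \<beta> z) ^ n * alpha_sym j \<epsilon> f z)"
proof (induction n)
  case 0
  show ?case using f by auto
next
  case (Suc n)
  then obtain g where g: "Hp p g"
    "\<And>z. norm z = 1 \<Longrightarrow> alpha_sym j \<epsilon> g z = (chi \<beta> z + 1 / chi \<beta> z) ^ n * alpha_sym j \<epsilon> f z" by blast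
  obtain h where h: "Hp p h"
    "\<And>z. norm z = 1 \<Longrightarrow> alpha_sym j \<epsilon> h z = (chi \<beta> z + 1 / chi \<beta> z) * alpha_sym j \<epsilon> g z"
    using alpha_sym_module[OF g(1) adm] by blast
  show ?case using g(2) h by (intro exI[of _ h]) (simp add: mult.assoc)
qed

lemma fourier_coeff_top:
  assumes h: "Lp p h" and top: "fourier_coeff h N \<noteq> 0" "\<And>k. k > N \<Longrightarrow> fourier_coeff h k = 0"
  shows "Lp p (\<lambda>z. (chi \<beta> z + 1 / chi \<beta> z) ^ n * h z) \<and>
    fourier_coeff (\<lambda>z. (chi \<beta> z + 1 / chi \<beta> z) ^ n * h z) (N + int n) \<noteq> 0 \<and>
    (\<forall>k > N + int n. fourier_coeff (\<lambda>z. (chi \<beta> z + 1 / chi \<beta> z) ^ n * h z) k = 0)"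
proof (induction n)
  case 0
  then show ?case using assms by simp
next
  case (Suc n)
  define g where "g = (\<lambda>z. (chi \<beta> z + 1 / chi \<beta> z) ^ n * h z)"
  have g: "Lp p g" "fourier_coeff g (N + int n) \<noteq> 0" "\<And>k. k > N + int n \<Longrightarrow> fourier_coeff g k = 0"
    using Suc by (auto simp: g_def)
  have eq: "(\<lambda>z. (chi \<beta> z + 1 / chi \<beta> z) ^ Suc n * h z) = (\<lambda>z. chi \<beta> z * g z + g z / chi \<beta> z)"
    by (simp add: g_def algebra_simps)
  have L: "Lp p (\<lambda>z. chi \<beta> z * g z)" "Lp p (\<lambda>z. g z / chi \<beta> z)"
    using Lp_chi_mult[OF g(1)] Lp_div_chi[OF g(1)] by auto
  \<comment> \<open>At and above the old top index g/\<chi> contributes nothing, so only the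
    recursion for \<chi> g remains.\<close>
  have co: "fourier_coeff (\<lambda>z. chi \<beta> z * g z + g z / chi \<beta> z) k =
    (cnj \<beta> * fourier_coeff g (k - 1) - fourier_coeff g k) / lam \<beta>" if "k \<ge> N + int n" for k
    using fourier_coeff_add[OF Lp_int[OF L(1)] Lp_int[OF L(2)], of k]
      fourier_coeff_chi_mult[OF g(1), of k] fourier_coeff_div_chi_eq_0[OF g(1,3) that] by simp
  have "fourier_coeff (\<lambda>z. chi \<beta> z * g z + g z / chi \<beta> z) (N + int (Suc n)) = cnj \<beta> * fourier_coeff g (N + int n) / lam \<beta>"
    using co[of "N + int (Suc n)"] g(3)[of "N + int (Suc n)"] by simp
  then have "fourier_coeff (\<lambda>z. chi \<beta> z * g z + g z / chi \<beta> z) (N + int (Suc n)) \<noteq> 0"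
    using g(2) lam_nonzero \<beta> by auto
  moreover have "fourier_coeff (\<lambda>z. chi \<beta> z * g z + g z / chi \<beta> z) k = 0" if "k > N + int (Suc n)" for k
    using co[of k] g(3)[of k] g(3)[of "k - 1"] that by simp
  ultimately show ?case unfolding eq using Lp_add[OF L p_pos(1)] by blast
qed

text \<open>The two summands have supports in k \<ge> 0 and k \<le> -j, which are disjoint for j
  \<ge> 1. For j = 0 both must be constants, and \<epsilon> = 1 then gives twice that constant equal
  to 0.\<close>

lemma alpha_sym_injective:
  assumes f: "Hp p f" and adm: "admissible j \<epsilon>" and 0: "circ_ae_eq (alpha_sym j \<epsilon> f) (\<lambda>_. 0)"
  shows "circ_ae_eq f (\<lambda>_. 0)"
proof -
  have Lpf: "Lp p f" using f by (rule Hp_Lp)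
  define g where "g = (\<lambda>z. f (alpha \<beta> z) / chi \<beta> z ^ j)"
  have g: "Lp p g" unfolding g_def by (rule Lp_alpha_power[OF Lpf])
  have sum: "fourier_coeff f k + \<epsilon> * fourier_coeff g k = 0" for k
  proof -
    have "fourier_coeff (alpha_sym j \<epsilon> f) k = fourier_coeff (\<lambda>_. 0) k"
      by (rule fourier_coeff_cong_AE[OF 0 Lp_int[OF Lp_alpha_sym[OF Lpf]]]) simp
    moreover have "fourier_coeff (alpha_sym j \<epsilon> f) k = fourier_coeff f k + \<epsilon> * fourier_coeff g k"
    proof -
      have "alpha_sym j \<epsilon> f = (\<lambda>z. f z + \<epsilon> * g z)" by (simp add: fun_eq_iff alpha_sym_def g_def)
      then show ?thesis
        using fourier_coeff_add[OF Lp_int[OF Lpf] Lp_int[OF Lp_cmult[OF g p_pos(1)]], of \<epsilon> k]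
        by (simp only: fourier_coeff_cmult)
    qed
    ultimately show ?thesis by (simp add: fourier_coeff_const)
  qed
  have pos: "fourier_coeff f k = 0" if "k > - int j" for k
    using sum[of k] fourier_coeff_alpha_power[OF f that] by (simp add: g_def)
  have neg: "fourier_coeff f k = 0" if "k < 0" for k using f that by (simp add: Hp_def)
  have "fourier_coeff f 0 = 0"
  proof (cases "j = 0")
    case False
    then show ?thesis by (intro pos) simp
  next
    case True
    then have e1: "\<epsilon> = 1" using adm by (auto simp: admissible_def)
    define c where "c = fourier_coeff f 0"
    have "circ_ae_eq f (\<lambda>_. c)"
    proof (rule fourier_coeff_unique[OF Lpf Hp_Lp[OF Hp_const[OF p1]] p1])
      show "fourier_coeff f n = fourier_coeff (\<lambda>_. c) n" for n
        using pos[of n] neg[of n] True by (cases "n = 0"; cases "n < 0") (auto simp: fourier_coeff_const c_def)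
    qed
    then have ae: "circ_ae_eq (\<lambda>z. f z - c) (\<lambda>_. 0)" by (simp add: circ_ae_eq_def)
    have Lc: "Lp p (\<lambda>_. c)" by (rule Hp_Lp[OF Hp_const[OF p1]])
    have Ld: "Lp p (\<lambda>z. f z - c)" by (rule Lp_diff[OF Lpf Lc p_pos(1)])
    have pm0: "p_moment p (\<lambda>z. f z - c) = 0"
      using p_moment_cong_AE[OF ae Ld p_pos(1)] by (simp add: p_moment_def)
    \<comment> \<open>To pass from f = c a.e. to f \<circ> \<alpha> = c a.e., \<alpha> must respect
      null sets; the moment bound for composition expresses this.\<close>
    obtain C where C: "\<And>f. Lp p f \<Longrightarrow> Lp p (\<lambda>z. f (alpha \<beta> z)) \<and>
      p_moment p (\<lambda>z. f (alpha \<beta> z)) \<le> C * p_moment p f"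
      using comp_alpha_Lp[OF \<beta> p_pos(2)] by blast
    have pm: "p_moment p (\<lambda>z. f (alpha \<beta> z) - c) \<le> 0" using C[OF Ld] pm0 by simp
    have Ldc: "Lp p (\<lambda>z. f (alpha \<beta> z) - c)" using C[OF Ld] by simp
    have "2 * pi * norm (fourier_coeff (\<lambda>z. f (alpha \<beta> z) - c) 0) powr p \<le> 2 powr p * p_moment p (\<lambda>z. f (alpha \<beta> z) - c)"
      by (rule fourier_coeff_powr_le[OF Ldc p_pos(2)])
    also have "\<dots> \<le> 0" using pm by (simp add: mult_le_0_iff)
    finally have "fourier_coeff (\<lambda>z. f (alpha \<beta> z) - c) 0 = 0"
      using pi_gt_zero by (auto simp: mult_le_0_iff)
    then have "fourier_coeff g 0 = c"
      using fourier_coeff_diff[OF Lp_int[OF g] Lp_int[OF Lc], of 0] True by (simp add: g_def fourier_coeff_const)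
    then show ?thesis using sum[of 0] e1 by (simp add: c_def)
  qed
  then have "fourier_coeff f k = 0" for k
    using pos[of k] neg[of k] by (cases "k = 0"; cases "k < 0") auto
  then show ?thesis by (rule fourier_coeff_unique_0[OF Lpf p1])
qed

section \<open>The four operators and their images\<close>

lemma J_alpha_power: "J_alpha \<beta> f z = f (alpha \<beta> z) / chi \<beta> z ^ 1"
  by (simp add: J_alpha_def)

text \<open>All coefficients of the projection of \<open>J_alpha \<beta> f\<close> vanish. As
  \<open>rieszP\<close> is a choice among a.e. equal functions, equality holds only almost
  everywhere.\<close>

lemma rieszQ_J_alpha:
  assumes f: "Hp p f"
  shows "circ_ae_eq (rieszQ p (J_alpha \<beta> f)) (J_alpha \<beta> f)" "Lp p (J_alpha \<beta> f)"
proof -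
  have eq: "J_alpha \<beta> f = (\<lambda>z. f (alpha \<beta> z) / chi \<beta> z ^ 1)" by (rule ext) (rule J_alpha_power)
  show L: "Lp p (J_alpha \<beta> f)" unfolding eq by (rule Lp_alpha_power[OF Hp_Lp[OF f]])
  have "fourier_coeff (rieszP p (J_alpha \<beta> f)) k = 0" for k
  proof (cases "k < 0")
    case True
    then show ?thesis using rieszP_Hp(1)[OF L p1] by (simp add: Hp_def)
  next
    case False
    then show ?thesis
      using rieszP_Hp(2)[OF L p1, of k] fourier_coeff_alpha_power[OF f, of 1 k] by (simp add: eq)
  qed
  then have "circ_ae_eq (rieszP p (J_alpha \<beta> f)) (\<lambda>_. 0)"
    by (rule fourier_coeff_unique_0[OF Hp_Lp[OF rieszP_Hp(1)[OF L p1]] p1])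
  then show "circ_ae_eq (rieszQ p (J_alpha \<beta> f)) (J_alpha \<beta> f)"
    by (simp add: circ_ae_eq_def rieszQ_def)
qed

context
  fixes a :: "complex \<Rightarrow> complex"
  assumes a: "GL_inf a"
begin

lemma Lp_a_mult: "Lp p f \<Longrightarrow> Lp p (\<lambda>z. a z * f z)"
  using a Lp_bounded_mult[OF _ _ p_pos(1)] unfolding GL_inf_def by blast

text \<open>\<open>m\<close> is the extra factor in the Hankel symbol. Equality of the nonnegative
  coefficients, together with \<open>Hp p A\<close>, says that \<open>A\<close> is the projection of
  a times the bracket.\<close>

lemma toeplitz_hankel_coeff:
  assumes f: "Hp p f" and mj: "\<And>z. norm z = 1 \<Longrightarrow> m z / chi \<beta> z = 1 / chi \<beta> z ^ j"
    and A_def: "A = (\<lambda>z. toeplitz p a f z + \<epsilon> * hankel_alpha p \<beta> (\<lambda>z. m z * a z) f z)"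
  shows "Hp p A" "\<And>n. 0 \<le> n \<Longrightarrow> fourier_coeff A n = fourier_coeff (\<lambda>z. a z * alpha_sym j \<epsilon> f z) n"
proof -
  have Lpf: "Lp p f" using f by (rule Hp_Lp)
  define g where "g = (\<lambda>z. m z * a z * rieszQ p (J_alpha \<beta> f) z)"
  define h where "h = (\<lambda>z. a z * (f (alpha \<beta> z) / chi \<beta> z ^ j))"
  have h: "Lp p h" unfolding h_def by (rule Lp_a_mult[OF Lp_alpha_power[OF Lpf]])
  have gh: "circ_ae_eq g h"
    using rieszQ_J_alpha(1)[OF f] unfolding circ_ae_eq_def
  proof eventually_elim
    case (elim \<theta>)
    have "m (cis \<theta>) * a (cis \<theta>) * J_alpha \<beta> f (cis \<theta>) = a (cis \<theta>) * f (alpha \<beta> (cis \<theta>)) * (m (cis \<theta>) / chi \<beta> (cis \<theta>))"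
      by (simp add: J_alpha_def)
    also have "\<dots> = h (cis \<theta>)" using mj[of "cis \<theta>"] by (simp add: h_def)
    finally show ?case using elim by (simp add: g_def)
  qed
  have g: "Lp p g" by (rule Lp_cong_AE[OF h gh p_pos(1)])
  have gc: "fourier_coeff g n = fourier_coeff h n" for n
    by (rule fourier_coeff_cong_AE[OF gh Lp_int[OF g] Lp_int[OF h]])
  have af: "Lp p (\<lambda>z. a z * f z)" by (rule Lp_a_mult[OF Lpf])
  have T: "toeplitz p a f = rieszP p (\<lambda>z. a z * f z)" by (simp add: toeplitz_def)
  have Hk: "hankel_alpha p \<beta> (\<lambda>z. m z * a z) f = rieszP p g" by (simp add: hankel_alpha_def g_def)
  show "Hp p A"
    unfolding A_def T Hk by (intro Hp_add Hp_cmult rieszP_Hp af g p1)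
  fix n :: int assume n: "0 \<le> n"
  have "fourier_coeff A n = fourier_coeff (rieszP p (\<lambda>z. a z * f z)) n + fourier_coeff (\<lambda>z. \<epsilon> * rieszP p g z) n"
    unfolding A_def T Hk
    by (rule fourier_coeff_add[OF Hp_integrable[OF rieszP_Hp(1)[OF af p1] p1]
          Hp_integrable[OF Hp_cmult[OF rieszP_Hp(1)[OF g p1] p1] p1]])
  also have "\<dots> = fourier_coeff (\<lambda>z. a z * f z) n + \<epsilon> * fourier_coeff h n"
    by (simp add: fourier_coeff_cmult rieszP_Hp(2)[OF _ p1 n] af g gc)
  also have "\<dots> = fourier_coeff (\<lambda>z. a z * f z) n + fourier_coeff (\<lambda>z. \<epsilon> * h z) n"
    by (simp add: fourier_coeff_cmult)
  also have "\<dots> = fourier_coeff (\<lambda>z. a z * f z + \<epsilon> * h z) n"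
    by (rule fourier_coeff_add[OF Lp_int[OF af] Lp_int[OF Lp_cmult[OF h p_pos(1)]], symmetric])
  also have "(\<lambda>z. a z * f z + \<epsilon> * h z) = (\<lambda>z. a z * alpha_sym j \<epsilon> f z)"
    by (simp add: alpha_sym_def h_def algebra_simps)
  finally show "fourier_coeff A n = fourier_coeff (\<lambda>z. a z * alpha_sym j \<epsilon> f z) n" .
qed

text \<open>After this reduction an operator enters only through its pair (j, \<epsilon>).\<close>

lemma ops_coeff:
  assumes "A \<in> ops p \<beta> a"
  obtains j \<epsilon> where "admissible j \<epsilon>" "\<And>f. Hp p f \<Longrightarrow> Hp p (A f)"
    "\<And>f n. Hp p f \<Longrightarrow> 0 \<le> n \<Longrightarrow> fourier_coeff (A f) n = fourier_coeff (\<lambda>z. a z * alpha_sym j \<epsilon> f z) n"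
proof -
  note main = that
  have gen: thesis if adm: "admissible j \<epsilon>" and m:
    "\<And>z. norm z = 1 \<Longrightarrow> m z / chi \<beta> z = 1 / chi \<beta> z ^ j"
    and A: "A = (\<lambda>f z. toeplitz p a f z + \<epsilon> * hankel_alpha p \<beta> (\<lambda>z. m z * a z) f z)" for j \<epsilon> m
    by (rule main[OF adm]) (use toeplitz_hankel_coeff[OF _ m] A in auto)
  consider
    "A = (\<lambda>f z. toeplitz p a f z - hankel_alpha p \<beta> (\<lambda>t. a t / chi \<beta> t) f z)"
    | "A = (\<lambda>f z. toeplitz p a f z + hankel_alpha p \<beta> (\<lambda>t. a t * chi \<beta> t) f z)"
    | "A = (\<lambda>f z. toeplitz p a f z + hankel_alpha p \<beta> a f z)"
    | "A = (\<lambda>f z. toeplitz p a f z - hankel_alpha p \<beta> a f z)"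
    using assms unfolding ops_def by blast
  then show thesis
  proof cases
    case 1
    show thesis
      by (rule gen[of 2 "-1" "\<lambda>z. 1 / chi \<beta> z"])
        (auto simp: 1 admissible_def power2_eq_square)
  next
    case 2
    show thesis
      by (rule gen[of 0 1 "chi \<beta>"])
        (use chi_nonzero in \<open>auto simp: 2 admissible_def mult.commute\<close>)
  next
    case 3
    show thesis by (rule gen[of 1 1 "\<lambda>_. 1"]) (auto simp: 3 admissible_def)
  next
    case 4
    show thesis by (rule gen[of 1 "-1" "\<lambda>_. 1"]) (auto simp: 4 admissible_def)
  qed
qed

text \<open>The functions \<open>(\<chi> + 1/\<chi>)\<^sup>n h\<close> have the top coefficients needed to solve for a prescribed
  nonnegative part by back substitution.\<close>

lemma prescribed_coefficients:
  assumes f: "Hp p f" and adm: "admissible j \<epsilon>"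
    and m: "fourier_coeff (\<lambda>z. a z * alpha_sym j \<epsilon> f z) (- int m) \<noteq> 0"
    "\<And>k. k > - int m \<Longrightarrow> fourier_coeff (\<lambda>z. a z * alpha_sym j \<epsilon> f z) k = 0"
  shows "\<exists>F. Hp p F \<and> (\<forall>k\<ge>0. fourier_coeff (\<lambda>z. a z * alpha_sym j \<epsilon> F z) k = (if k < int n then c k else 0))"
proof (induction n arbitrary: c)
  case 0
  have "fourier_coeff (\<lambda>z. a z * alpha_sym j \<epsilon> (\<lambda>_. 0) z) k = 0" for k
    by (simp add: alpha_sym_def fourier_coeff_const)
  then show ?case using Hp_const[OF p1] by (intro exI[of _ "\<lambda>_. 0"]) auto
next
  case (Suc n)
  define h where "h = (\<lambda>z. a z * alpha_sym j \<epsilon> f z)"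
  have h: "Lp p h" unfolding h_def by (rule Lp_a_mult[OF Lp_alpha_sym[OF Hp_Lp[OF f]]])
  \<comment> \<open>The power m + n moves the top index from -m to n, the new index to be
    prescribed.\<close>
  obtain G where G: "Hp p G"
    "\<And>z. norm z = 1 \<Longrightarrow> alpha_sym j \<epsilon> G z = (chi \<beta> z + 1 / chi \<beta> z) ^ (m + n) * alpha_sym j \<epsilon> f z"
    using alpha_sym_module_power[OF f adm, of "m + n"] by blast
  define H where "H = (\<lambda>z. a z * alpha_sym j \<epsilon> G z)"
  have H: "Lp p H" unfolding H_def by (rule Lp_a_mult[OF Lp_alpha_sym[OF Hp_Lp[OF G(1)]]])
  have "fourier_coeff H k = fourier_coeff (\<lambda>z. (chi \<beta> z + 1 / chi \<beta> z) ^ (m + n) * h z) k" for k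
    by (rule fourier_coeff_cong) (simp add: H_def h_def G(2) mult.left_commute)
  then have Htop: "fourier_coeff H (int n) \<noteq> 0" "\<And>k. k > int n \<Longrightarrow> fourier_coeff H k = 0"
    using fourier_coeff_top[OF h m[folded h_def], of "m + n"] by auto
  \<comment> \<open>t H has the prescribed coefficient at its top index n. Its lower coefficients
    are subtracted from the targets given to the induction hypothesis.\<close>
  define t where "t = c (int n) / fourier_coeff H (int n)"
  obtain F where F: "Hp p F" "\<And>k. k \<ge> 0 \<Longrightarrow> fourier_coeff (\<lambda>z. a z * alpha_sym j \<epsilon> F z) k =
      (if k < int n then c k - t * fourier_coeff H k else 0)"
    using Suc.IH[of "\<lambda>k. c k - t * fourier_coeff H k"] by blast
  have aF: "Lp p (\<lambda>z. a z * alpha_sym j \<epsilon> F z)" by (rule Lp_a_mult[OF Lp_alpha_sym[OF Hp_Lp[OF F(1)]]])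
  have "fourier_coeff (\<lambda>z. a z * alpha_sym j \<epsilon> (\<lambda>z. F z + t * G z) z) k = (if k < int (Suc n) then c k else 0)"
    if k: "k \<ge> 0" for k
  proof -
    have "(\<lambda>z. a z * alpha_sym j \<epsilon> (\<lambda>z. F z + t * G z) z) = (\<lambda>z. a z * alpha_sym j \<epsilon> F z + t * H z)"
      unfolding alpha_sym_add_cmult H_def by (simp add: algebra_simps)
    then have "fourier_coeff (\<lambda>z. a z * alpha_sym j \<epsilon> (\<lambda>z. F z + t * G z) z) k =
      fourier_coeff (\<lambda>z. a z * alpha_sym j \<epsilon> F z) k + t * fourier_coeff H k"
      using fourier_coeff_add[OF Lp_int[OF aF] Lp_int[OF Lp_cmult[OF H p_pos(1)]], of t k]
      by (simp add: fourier_coeff_cmult)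
    moreover have "t * fourier_coeff H (int n) = c (int n)" using Htop(1) by (simp add: t_def)
    ultimately show ?thesis using F(2)[OF k] Htop(2)[of k] by (cases "k = int n"; cases "k < int n") auto
  qed
  then show ?case using Hp_add[OF F(1) Hp_cmult[OF G(1) p1] p1] by blast
qed

lemma ker_or_coker_trivial:
  assumes A: "A \<in> ops p \<beta> a"
  shows "ker_trivial p A \<or> coker_trivial p A"
proof (cases "ker_trivial p A")
  case False
  then obtain f where f: "Hp p f" "circ_ae_eq (A f) (\<lambda>_. 0)" and f0: "\<not> circ_ae_eq f (\<lambda>_. 0)"
    unfolding ker_trivial_def by blast
  obtain j \<epsilon> where adm: "admissible j \<epsilon>" and AH: "\<And>f. Hp p f \<Longrightarrow> Hp p (A f)"
    and co: "\<And>f n. Hp p f \<Longrightarrow> 0 \<le> n \<Longrightarrow> fourier_coeff (A f) n = fourier_coeff (\<lambda>z. a z * alpha_sym j \<epsilon> f z) n"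
    using ops_coeff[OF A] by blast
  define h where "h = (\<lambda>z. a z * alpha_sym j \<epsilon> f z)"
  have h: "Lp p h" unfolding h_def by (rule Lp_a_mult[OF Lp_alpha_sym[OF Hp_Lp[OF f(1)]]])
  have h0: "fourier_coeff h n = 0" if "n \<ge> 0" for n
  proof -
    have "fourier_coeff (A f) n = fourier_coeff (\<lambda>_. 0) n"
      by (rule fourier_coeff_cong_AE[OF f(2) Hp_integrable[OF AH[OF f(1)] p1]]) simp
    then show ?thesis using co[OF f(1) that] by (simp add: h_def fourier_coeff_const)
  qed
  have "\<exists>k. fourier_coeff h k \<noteq> 0"
  proof (rule ccontr)
    assume "\<not> ?thesis"
    then have ae0: "circ_ae_eq h (\<lambda>_. 0)" using fourier_coeff_unique_0[OF h p1] by blast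
    \<comment> \<open>Here the lower bound on |a| is used: a product with a can vanish a.e. only if
      the other factor does.\<close>
    obtain c where c: "c > 0" "AE \<theta> in circ_meas. c \<le> norm (a (cis \<theta>))"
      using a unfolding GL_inf_def by blast
    have "circ_ae_eq (alpha_sym j \<epsilon> f) (\<lambda>_. 0)"
      using ae0 c(2) unfolding circ_ae_eq_def by eventually_elim (use c(1) in \<open>auto simp: h_def\<close>)
    then show False using alpha_sym_injective[OF f(1) adm] f0 by blast
  qed
  then obtain k where k: "fourier_coeff h k \<noteq> 0" by blast
  then have "k < 0" using h0 by (meson not_le)
  then have ex: "\<exists>m. fourier_coeff h (- int m) \<noteq> 0" using k by (intro exI[of _ "nat (- k)"]) simp
  \<comment> \<open>Since h has no coefficients at indices \<ge> 0, the least such m marks its top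
    index -m.\<close>
  define m where "m = (LEAST m. fourier_coeff h (- int m) \<noteq> 0)"
  have m: "fourier_coeff h (- int m) \<noteq> 0" unfolding m_def by (rule LeastI_ex[OF ex])
  have mtop: "fourier_coeff h k = 0" if "k > - int m" for k
  proof (cases "k \<ge> 0")
    case False
    then show ?thesis
      using not_less_Least[of "nat (- k)" "\<lambda>m. fourier_coeff h (- int m) \<noteq> 0"] that by (simp add: m_def)
  qed (rule h0)
  have "coker_trivial p A"
    unfolding coker_trivial_def
  proof (intro allI impI)
    fix g e assume g: "Hp p g" and e: "(e::real) > 0"
    \<comment> \<open>The factor 2\<pi> accounts for the normalised measure in
      \<open>Lp_norm\<close>.\<close>
    obtain B where B: "p_moment p (\<lambda>z. g z - poly B z) < 2 * pi * e powr p"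
      using Hp_poly_dense[OF g p1, of "2 * pi * e powr p"] e by auto
    obtain N where N: "\<And>k. int N \<le> k \<Longrightarrow> fourier_coeff (poly B) k = 0"
      using fourier_coeff_poly_finite by blast
    obtain F where F: "Hp p F" "\<And>k. k \<ge> 0 \<Longrightarrow> fourier_coeff (\<lambda>z. a z * alpha_sym j \<epsilon> F z) k =
        (if k < int N then fourier_coeff (poly B) k else 0)"
      using prescribed_coefficients[OF f(1) adm m[unfolded h_def] mtop[unfolded h_def], of N "fourier_coeff (poly B)"] by blast
    have LB: "Lp p (poly B)" by (rule Lp_poly[OF p_pos(1)])
    have LA: "Lp p (A F)" by (rule Hp_Lp[OF AH[OF F(1)]])
    \<comment> \<open>The polynomial is attained exactly, up to null sets; the error e comes only
      from approximating g by B.\<close>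
    have "circ_ae_eq (A F) (poly B)"
    proof (rule fourier_coeff_unique[OF LA LB p1])
      fix n show "fourier_coeff (A F) n = fourier_coeff (poly B) n"
      proof (cases "n < 0")
        case True
        then show ?thesis using AH[OF F(1)] fourier_coeff_poly_neg[OF True] by (simp add: Hp_def)
      next
        case False
        then show ?thesis using co[OF F(1), of n] F(2)[of n] N[of n] by auto
      qed
    qed
    then have ae: "circ_ae_eq (\<lambda>z. A F z - g z) (\<lambda>z. poly B z - g z)"
      unfolding circ_ae_eq_def by eventually_elim simp
    have L: "Lp p (\<lambda>z. A F z - g z)" by (rule Lp_diff[OF LA Hp_Lp[OF g] p_pos(1)])
    have "p_moment p (\<lambda>z. A F z - g z) < 2 * pi * e powr p"
      using B p_moment_cong_AE[OF ae L p_pos(1)] p_moment_commute[of p g "poly B"] by simp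
    then show "\<exists>f. Hp p f \<and> Lp_norm p (\<lambda>z. A f z - g z) < e"
      using F(1) Lp_norm_less[OF p_pos(1) e] by blast
  qed
  then show ?thesis ..
qed simp

end

end

theorem theorem8p1:
  fixes p :: real and \<beta> :: complex and a :: "complex \<Rightarrow> complex"
    and A :: "(complex \<Rightarrow> complex) \<Rightarrow> (complex \<Rightarrow> complex)"
  assumes "1 < p" and "cmod \<beta> > 1" and "GL_inf a" and "A \<in> ops p \<beta> a"
  shows "ker_trivial p A \<or> coker_trivial p A"
  using ker_or_coker_trivial[OF assms(2,1,3,4)] .

end
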